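(* Consider the testing setup of the context (test statistics with density $q_0$ under true nulls and $q_1$ under false nulls, $p$-values $\boldsymbol{\xi}_i=\phi(\boldsymbol{X}_i)$, density $g$). Suppose that i) $\mathrm{sppt}(q_1)\subset\mathrm{sppt}(q_0)$; ii) all $f_k$, $1\le k\le K$, are continuous; iii) $q_1$ is continuous on $\mathrm{sppt}(q_0)$; and suppose that $h(u)=\ell(\Gamma_u)$, with $\Gamma_u=\{\boldsymbol{x}\in[0,1]^K: g(\boldsymbol{x})\ge u\}$, $0\le u<\infty$, is continuous. For $t\in[0,1]$ let $h^*(t)=\inf\{u\ge0: h(u)\le t\}$ and $D_t=\Gamma_{h^*(t)}$. Then $\{D_t\}$ satisfies: $D_1=[0,1]^K$, $\ell(D_t)=t$, $D_s\subset D_t$ for $0\le s<t\le1$, and $D_t=\bigcap_{s>t}D_s$ for $t\in[0,1)$. Let $\alpha\in(0,1)$, and let $\mathcal{P}_\alpha$ be the procedure that rejects $H_i$ if and only if $\boldsymbol{\xi}_i\in D_\tau$, where $\tau=\sup\{t\in[0,1]: t/\alpha\le (R(t)\vee1)/n\}$ and $R(t)=\#\{i:\boldsymbol{\xi}_i\in D_t\}$. Then, among procedures that satisfy conditions (A) and (B) of the context and attain $\mathrm{FDR}\le(1-a)\alpha$, $\mathcal{P}_\alpha$ belongs to those which asymptotically have the maximum power as $n\to\infty$ (i.e. $\mathcal{P}_\alpha$ is such a procedure, and for any other such procedure $\boldsymbol{\delta}$, $\liminf_{n\to\infty}(\mathrm{power}_n(\mathcal{P}_\alpha)-\mathrm{power}_n(\boldsymbol{\delta}))\ge0$).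 Furthermore, the following hold for $\mathcal{P}_\alpha$, with $\alpha_*=1/(1-a+a\sup g)$: 1) it always rejects the same set of nulls as the Benjamini–Hochberg (BH) procedure with control parameter $\alpha$ does when applied to $p_i=h(g(\boldsymbol{\xi}_i))$, $i=1,\dots,n$; 2) for $\alpha>\alpha_*$, the power is asymptotically positive and $\mathrm{pFDR}\to\mathrm{FDR}=(1-a)\alpha$ as $n\to\infty$; 3) for $\alpha<\alpha_*$, the power is asymptotically $0$ and $\mathrm{pFDR}\to(1-a)\alpha_*$ as $n\to\infty$.
   Context: Notation: $\ell$ is Lebesgue measure; $x\vee y=\max(x,y)$; $\sup g$ denotes the essential supremum; $\mathrm{sppt}(q)=\{\boldsymbol{x}:q(\boldsymbol{x})>0\}$; $\Gamma_\infty=\emptyset$ and $1/\infty=0$. Setup: $H_1,\dots,H_n$ are nulls, $\theta_i=\mathbf{1}\{H_i\text{ is false}\}$ and $\boldsymbol{X}_i\in\mathbb{R}^K$ is the test statistic of $H_i$. The pairs $(\theta_i,\boldsymbol{X}_i)$ are i.i.d., $P(\theta_i=1)=a\in(0,1)$; given $\theta_i=0$, $\boldsymbol{X}_i\sim Q_0$ with density $q_0$; given $\theta_i=1$, $\boldsymbol{X}_i\sim Q_1$ with density $q_1$. $f_k(x_1,\dots,x_k)$ is the marginal density of $(X_1,\dots,X_k)$ under $Q_0$ (so $f_K=q_0$). The map $\phi=(\phi_1,\dots,\phi_K)'$ is defined by $\phi_1(\boldsymbol{x})=Q_0(X_1\le x_1)$ and $\phi_k(\boldsymbol{x})=Q_0(X_k\le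 x_k\mid X_s=x_s,\ s<k)$ for $k>1$ (conditional probabilities computed from the densities $f_k$), and $\boldsymbol{\xi}_i=\phi(\boldsymbol{X}_i)$. Under i)–iii), $\phi$ is one-to-one and continuous on $\mathrm{sppt}(q_0)$, $E=\phi(\mathrm{sppt}(q_0))$ is an open subset of $[0,1]^K$ of full measure, $\boldsymbol{\xi}_i\sim\mathrm{Unif}([0,1]^K)$ given $\theta_i=0$, and given $\theta_i=1$, $\boldsymbol{\xi}_i$ has distribution $G$ with density $g(\boldsymbol{x})=q_1(\phi^{-1}(\boldsymbol{x}))/q_0(\phi^{-1}(\boldsymbol{x}))$ for $\boldsymbol{x}\in E$ (set $g=0$ on $[0,1]^K\setminus E$). A multiple testing procedure is a deterministic or random function $\boldsymbol{\delta}$ mapping each $n$-tuple of $p$-values (for every $n$) to $(\delta_1,\dots,\delta_n)\in\{0,1\}^n$, $\delta_i=\mathbf{1}\{H_i\text{ is rejected}\}$. $R$ is the number of rejected nulls, $V$ the number of rejected true nulls, $N$ the number of true nulls; $\mathrm{FDR}=E[V/(R\vee1)]$, $\mathrm{pFDR}=E[V/R\mid R>0]$, $\mathrm{power}=E[(R-V)/((n-N)\vee1)]$. Condition (A): for every $n\ge1$, $\boldsymbol{\delta}$ and $\boldsymbol{\theta}=(\theta_1,\dots,\theta_n)$ are independent conditional on $\boldsymbol{\xi}_1,\dots,\boldsymbol{\xi}_n$, i.e. $P(\boldsymbol{\delta}=\boldsymbol{d}\mid\boldsymbol{\xi}_1,\dots,\boldsymbol{\xi}_n,\boldsymbol{\theta}=\boldsymbol{b})=P(\boldsymbol{\delta}=\boldsymbol{d}\mid\boldsymbol{\xi}_1,\dots,\boldsymbol{\xi}_n)$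 for $\boldsymbol{d},\boldsymbol{b}\in\{0,1\}^n$. Condition (B): for an $n$-tuple $S=(\boldsymbol{x}_1,\dots,\boldsymbol{x}_n)$ with $\boldsymbol{x}_i\in[0,1]^K$ let $R(S;\boldsymbol{\delta})=\sum_{i=1}^n\delta_i(S)$ and $\hat F(\boldsymbol{x};S)=\#\{i:x_{ik}\le x_k,\ k=1,\dots,K\}/n$. For any sequence of $n_k$-tuples $S_k$ with $n_k\to\infty$, if $\sup_{\boldsymbol{x}}|\hat F(\boldsymbol{x};S_k)-F(\boldsymbol{x})|\to0$ for a distribution function $F$, then $R(S_k;\boldsymbol{\delta})/n_k$ converges in probability (to a constant). BH procedure with control parameter $\alpha$ applied to $p_1,\dots,p_n\in[0,1]$: reject $H_i$ iff $p_i\le\sup\{t\in[0,1]:t/\alpha\le(\#\{j:p_j\le t\}\vee1)/n\}$.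
   Formalization: Condition (B) is required only for F equal to the distribution function of the p-values in the model, not for every distribution function F; P_α itself violates (B) for some other F, while the class of competing procedures only gets larger. *)

theory Defs
  imports "HOL-Probability.Probability"
begin

text \<open>The coordinates of an observation are indexed by a finite linear order \<open>'k\<close>, so that
  ``the first k coordinates'' are the index set \<open>{..k}\<close>.\<close>

abbreviation unit_cube :: "(real ^ 'k::finite) set" where
  "unit_cube \<equiv> cbox 0 1"

definition sppt :: "('a \<Rightarrow> real) \<Rightarrow> 'a set" where
  "sppt q = {x. 0 < q x}"


section \<open>The p-value transform\<close>

text \<open>\<open>marginal q A\<close> integrates out the coordinates outside \<open>A\<close>.  It is a function on the whole
  space that only looks at the coordinates in \<open>A\<close>.  Thus \<open>f\<^sub>k\<close> is \<open>marginal q0 {..k}\<close>, its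
  predecessor \<open>f\<^sub>k\<^sub>-\<^sub>1\<close> is \<open>marginal q0 {..<k}\<close>, and for the first index the latter is
  \<open>marginal q0 {}\<close>, the constant total mass 1.\<close>

definition marginal :: "(real ^ 'k::finite \<Rightarrow> real) \<Rightarrow> 'k set \<Rightarrow> real ^ 'k \<Rightarrow> real" where
  "marginal q A x =
     (\<integral>y. q (\<chi> j. if j \<in> A then x $ j else y j) \<partial>(\<Pi>\<^sub>M j\<in>- A. lborel))"

text \<open>Conditional distribution functions; the value off \<open>sppt q0\<close> is irrelevant.\<close>

definition phi ::
  "(real ^ 'k::{finite,linorder} \<Rightarrow> real) \<Rightarrow>
   real ^ 'k::{finite,linorder} \<Rightarrow> real ^ 'k::{finite,linorder}" where
  "phi q0 x = (\<chi> k.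
     (LINT t:{..x $ k}|lborel. marginal q0 {..k} (\<chi> j. if j = k then t else x $ j))
       / marginal q0 {..<k} x)"

definition gdens ::
  "(real ^ 'k::{finite,linorder} \<Rightarrow> real) \<Rightarrow> (real ^ 'k::{finite,linorder} \<Rightarrow> real) \<Rightarrow>
   real ^ 'k::{finite,linorder} \<Rightarrow> real" where
  "gdens q0 q1 x =
     (if x \<in> phi q0 ` sppt q0
      then q1 (inv_into (sppt q0) (phi q0) x) / q0 (inv_into (sppt q0) (phi q0) x)
      else 0)"


section \<open>Nested rejection regions\<close>

text \<open>The level is an extended real so that \<open>Gam g \<infinity> = {}\<close>; correspondingly the infimum in
  \<open>hstar\<close> is \<open>\<infinity>\<close> if no level qualifies (possible only for \<open>t = 0\<close>).\<close>

definition Gam :: "(real ^ 'k::finite \<Rightarrow> real) \<Rightarrow> ereal \<Rightarrow> (real ^ 'k) set" where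
  "Gam g u = {x \<in> unit_cube. u \<le> ereal (g x)}"

definition hfun :: "(real ^ 'k::finite \<Rightarrow> real) \<Rightarrow> real \<Rightarrow> real" where
  "hfun g u = measure lborel (Gam g (ereal u))"

definition hstar :: "(real ^ 'k::finite \<Rightarrow> real) \<Rightarrow> real \<Rightarrow> ereal" where
  "hstar g t = Inf {ereal u | u. 0 \<le> u \<and> hfun g u \<le> t}"

definition Dset :: "(real ^ 'k::finite \<Rightarrow> real) \<Rightarrow> real \<Rightarrow> (real ^ 'k) set" where
  "Dset g t = Gam g (hstar g t)"

text \<open>In \<open>ereal\<close> arithmetic \<open>1 / \<infinity> = 0\<close>, so the value is 0 for essentially unbounded \<open>g\<close>.\<close>

definition alpha_star :: "real \<Rightarrow> (real ^ 'k::finite \<Rightarrow> real) \<Rightarrow> real" where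
  "alpha_star a g = real_of_ereal
     (1 / (ereal (1 - a) + ereal a * esssup (restrict_space lborel unit_cube) (\<lambda>x. ereal (g x))))"


section \<open>Multiple testing procedures\<close>

text \<open>Hypotheses are numbered \<open>0, \<dots>, n - 1\<close>.  A decision vector in \<open>{0,1}\<^sup>n\<close> is represented by
  the set of rejected indices, a subset of \<open>{..<n}\<close>.\<close>

definition BH_reject :: "real \<Rightarrow> nat \<Rightarrow> (nat \<Rightarrow> real) \<Rightarrow> nat set" where
  "BH_reject \<alpha> n p = {i \<in> {..<n}.
     p i \<le> Sup {t \<in> {0..1}. t / \<alpha> \<le> max (real (card {j \<in> {..<n}. p j \<le> t})) 1 / real n}}"

definition D_reject ::
  "(real ^ 'k::finite \<Rightarrow> real) \<Rightarrow> real \<Rightarrow> nat \<Rightarrow> (nat \<Rightarrow> real ^ 'k) \<Rightarrow> nat set" where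
  "D_reject g \<alpha> n S = {i \<in> {..<n}.
     S i \<in> Dset g (Sup {t \<in> {0..1}.
       t / \<alpha> \<le> max (real (card {j \<in> {..<n}. S j \<in> Dset g t})) 1 / real n})}"

text \<open>\<open>\<theta> i \<omega>\<close> says that the i-th null is false; \<open>\<Delta> n \<omega>\<close> is the set of rejected indices when
  n nulls are tested.\<close>

definition FDR :: "'w measure \<Rightarrow> (nat \<Rightarrow> 'w \<Rightarrow> bool) \<Rightarrow> (nat \<Rightarrow> 'w \<Rightarrow> nat set) \<Rightarrow> nat \<Rightarrow> real" where
  "FDR M \<theta> \<Delta> n =
     (\<integral>\<omega>. real (card {i \<in> \<Delta> n \<omega>. \<not> \<theta> i \<omega>}) / max (real (card (\<Delta> n \<omega>))) 1 \<partial>M)"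

definition pFDR :: "'w measure \<Rightarrow> (nat \<Rightarrow> 'w \<Rightarrow> bool) \<Rightarrow> (nat \<Rightarrow> 'w \<Rightarrow> nat set) \<Rightarrow> nat \<Rightarrow> real" where
  "pFDR M \<theta> \<Delta> n =
     (LINT \<omega>:{\<omega> \<in> space M. 0 < card (\<Delta> n \<omega>)}|M.
        real (card {i \<in> \<Delta> n \<omega>. \<not> \<theta> i \<omega>}) / real (card (\<Delta> n \<omega>)))
     / measure M {\<omega> \<in> space M. 0 < card (\<Delta> n \<omega>)}"

definition mt_power :: "'w measure \<Rightarrow> (nat \<Rightarrow> 'w \<Rightarrow> bool) \<Rightarrow> (nat \<Rightarrow> 'w \<Rightarrow> nat set) \<Rightarrow> nat \<Rightarrow> real" where
  "mt_power M \<theta> \<Delta> n =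
     (\<integral>\<omega>. (real (card (\<Delta> n \<omega>)) - real (card {i \<in> \<Delta> n \<omega>. \<not> \<theta> i \<omega>}))
           / max (real n - real (card {i \<in> {..<n}. \<not> \<theta> i \<omega>})) 1 \<partial>M)"

definition sigma_xi ::
  "'w measure \<Rightarrow> (nat \<Rightarrow> 'w \<Rightarrow> real ^ 'k::finite) \<Rightarrow> nat \<Rightarrow> 'w measure" where
  "sigma_xi M \<xi> n =
     vimage_algebra (space M) (\<lambda>\<omega>. \<lambda>i\<in>{..<n}. \<xi> i \<omega>) (\<Pi>\<^sub>M i\<in>{..<n}. borel)"

definition sigma_xi_theta ::
  "'w measure \<Rightarrow> (nat \<Rightarrow> 'w \<Rightarrow> real ^ 'k::finite) \<Rightarrow> (nat \<Rightarrow> 'w \<Rightarrow> bool) \<Rightarrow> nat \<Rightarrow> 'w measure" where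
  "sigma_xi_theta M \<xi> \<theta> n =
     vimage_algebra (space M) (\<lambda>\<omega>. \<lambda>i\<in>{..<n}. (\<xi> i \<omega>, \<theta> i \<omega>))
       (\<Pi>\<^sub>M i\<in>{..<n}. borel \<Otimes>\<^sub>M count_space UNIV)"

text \<open>A (possibly random) function of p-value tuples.  For every n and every n-tuple \<open>S\<close> in the
  unit cube, \<open>\<kappa> n S\<close> is the law of the random decision \<open>\<delta>(S)\<close> (a point mass if the procedure is
  deterministic).  \<open>\<Delta> n\<close> is the decision actually taken on the data, a random variable on the same
  space as the data, whose conditional law given the p-values is \<open>\<kappa> n\<close> evaluated at them.  How
  \<open>\<Delta> n\<close> depends on \<open>\<theta>\<close> is left open here and is the subject of condition (A).\<close>

definition testing_procedure ::
  "'w measure \<Rightarrow> (nat \<Rightarrow> 'w \<Rightarrow> real ^ 'k::finite) \<Rightarrow>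
   (nat \<Rightarrow> (nat \<Rightarrow> real ^ 'k) \<Rightarrow> nat set pmf) \<Rightarrow> (nat \<Rightarrow> 'w \<Rightarrow> nat set) \<Rightarrow> bool" where
  "testing_procedure M \<xi> \<kappa> \<Delta> \<longleftrightarrow>
     (\<forall>n\<ge>1.
        (\<forall>S \<in> {..<n} \<rightarrow>\<^sub>E unit_cube. set_pmf (\<kappa> n S) \<subseteq> Pow {..<n}) \<and>
        (\<forall>D. (\<lambda>S. pmf (\<kappa> n S) D)
               \<in> borel_measurable (restrict_space (\<Pi>\<^sub>M i\<in>{..<n}. borel) ({..<n} \<rightarrow>\<^sub>E unit_cube))) \<and>
        \<Delta> n \<in> M \<rightarrow>\<^sub>M count_space (Pow {..<n}) \<and>
        (\<forall>D. AE \<omega> in M.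
           real_cond_exp M (sigma_xi M \<xi> n) (indicator {\<omega> \<in> space M. \<Delta> n \<omega> = D}) \<omega>
             = pmf (\<kappa> n (\<lambda>i\<in>{..<n}. \<xi> i \<omega>)) D))"

text \<open>Conditioning on the p-values and the event \<open>\<theta> = b\<close>, for all \<open>b\<close> at once, is conditioning
  on the sigma-algebra generated by the p-values and \<open>\<theta>\<close>.\<close>

definition condition_A ::
  "'w measure \<Rightarrow> (nat \<Rightarrow> 'w \<Rightarrow> real ^ 'k::finite) \<Rightarrow> (nat \<Rightarrow> 'w \<Rightarrow> bool) \<Rightarrow>
   (nat \<Rightarrow> 'w \<Rightarrow> nat set) \<Rightarrow> bool" where
  "condition_A M \<xi> \<theta> \<Delta> \<longleftrightarrow>
     (\<forall>n\<ge>1. \<forall>D\<subseteq>{..<n}. AE \<omega> in M.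
        real_cond_exp M (sigma_xi_theta M \<xi> \<theta> n) (indicator {\<omega> \<in> space M. \<Delta> n \<omega> = D}) \<omega>
          = real_cond_exp M (sigma_xi M \<xi> n) (indicator {\<omega> \<in> space M. \<Delta> n \<omega> = D}) \<omega>)"

definition Fhat :: "nat \<Rightarrow> (nat \<Rightarrow> real ^ 'k::finite) \<Rightarrow> real ^ 'k \<Rightarrow> real" where
  "Fhat n S x = real (card {i \<in> {..<n}. \<forall>k. S i $ k \<le> x $ k}) / real n"

definition distr_fun :: "'w measure \<Rightarrow> ('w \<Rightarrow> real ^ 'k::finite) \<Rightarrow> real ^ 'k \<Rightarrow> real" where
  "distr_fun M Y x = measure M {\<omega> \<in> space M. \<forall>k. Y \<omega> $ k \<le> x $ k}"

text \<open>Condition (B) at a distribution function \<open>F\<close>; it will be used with \<open>F\<close> the common distribution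
  function of the p-values.  Demanding it at every \<open>F\<close> at once would exclude even the
  Benjamini--Hochberg procedure: if K = 1 and \<open>F(t) \<le> t/\<alpha>\<close> for all \<open>t\<close>, with equality only at 0 and
  at some \<open>0 < t\<^sub>0 < \<alpha>\<close>, tuples approximating \<open>F\<close> slightly from above and slightly from below have
  different limiting proportions of rejections.\<close>

definition condition_B ::
  "(real ^ 'k::finite \<Rightarrow> real) \<Rightarrow> (nat \<Rightarrow> (nat \<Rightarrow> real ^ 'k) \<Rightarrow> nat set pmf) \<Rightarrow> bool" where
  "condition_B F \<kappa> \<longleftrightarrow>
     (\<forall>m S. filterlim m at_top sequentially \<longrightarrow>
        (\<forall>j. S j \<in> {..<m j} \<rightarrow>\<^sub>E unit_cube) \<longrightarrow>
        (\<lambda>j. SUP x. \<bar>Fhat (m j) (S j) x - F x\<bar>) \<longlonglongrightarrow> 0 \<longrightarrow>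
        (\<exists>c. \<forall>\<epsilon>>0.
           (\<lambda>j. measure_pmf.prob (\<kappa> (m j) (S j)) {D. \<epsilon> < \<bar>real (card D) / real (m j) - c\<bar>})
             \<longlonglongrightarrow> 0))"

end

theory Submission
  imports Defs
begin

text \<open>The conditional distribution functions make \<open>phi q0\<close> triangular and increasing in each
  new coordinate, so it is injective on the support and carries the null law to the uniform law; by
  invariance of domain its image is open.  On the cube, \<open>x \<in> D\<^sub>t\<close> iff \<open>h (g x) \<le> t\<close>, which
  turns the procedure into BH applied to the scalars \<open>h (g (\<xi> i))\<close>, uniform under true nulls and
  with distribution function \<open>G\<close> (the \<open>g\<close>-mass of \<open>D\<^sub>t\<close>) under false ones.  Let
  \<open>H t = (1 - a) t + a G t\<close> and let \<open>t*\<close> be the largest root of \<open>t = \<alpha> H t\<close>.  Since the p-values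
  have no atoms, the FDR is exactly \<open>(1 - a) \<alpha>\<close>, and by a Glivenko--Cantelli argument the power
  tends to \<open>G t*\<close>, where \<open>t* > 0\<close> if \<open>\<alpha> > \<alpha>\<^sub>*\<close> and \<open>t* = 0\<close> if
  \<open>\<alpha> < \<alpha>\<^sub>*\<close>.

  For an arbitrary procedure, (B) makes \<open>R / n\<close> converge to a constant \<open>c\<close>, so the FDR bound
  becomes a bound on the expected number of false rejections by \<open>(1 - a) \<alpha> c n\<close>.  By (A) the
  decisions see \<open>\<theta>\<close> only through its posterior given the p-values, so Neyman--Pearson bounds the
  rates \<open>r\<close> of true and \<open>s\<close> of false rejections by the tangents of \<open>G\<close>:
  \<open>r - u s \<le> G t - u t\<close> with \<open>u\<close> the density level of \<open>D\<^sub>t\<close>.  For every \<open>t > t*\<close>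
  the two bounds together force \<open>r \<le> G t\<close> in the limit.

  If \<open>\<alpha> < \<alpha>\<^sub>*\<close>, the FDR is still exact, so the pFDR is determined by the
  probability of rejecting anything; on the scale \<open>H (p)\<close>, where all p-values are uniform, BH at
  level \<open>\<beta>\<close> rejects something with probability exactly \<open>\<beta>\<close>, and near 0 the procedure is
  squeezed between two such levels close to \<open>\<alpha> / \<alpha>\<^sub>*\<close>.\<close>

section \<open>Lebesgue measure on coordinates\<close>

text \<open>Continuity of \<open>h\<close> enters as the absence of level sets of positive measure.
  It makes \<open>h (g x)\<close> exactly uniform, which the exact FDR needs, and it makes
  \<open>G t / t\<close> strictly decreasing, so that \<open>t < \<alpha> * H t\<close> on the whole
  interval below the largest root; with equality allowed there, the empirical threshold could hang
  at a point of tangency. The obstacle is that (B), even for the procedure itself, knows a sample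
  only through its distribution function on orthants, while the procedure counts points in level
  sets of \<open>g\<close>. Openness of the image of the transform and continuity of
  \<open>g\<close> on it bridge the gap: strict super- and sublevel sets are open, so both counts
  are bounded below under weak convergence, and the two bounds meet because the level set between
  them is null. For a competitor the limiting rejection rate is unknown and may be 0, so it is never
  divided by; it is eliminated from linear inequalities. The same bound, applied to the procedure
  itself, shows that its power vanishes when \<open>\<alpha>\<close> is below the critical
  level.\<close>

lemma Basis_vec_real: "(Basis :: (real ^ 'k::finite) set) = range (\<lambda>k. axis k 1)"
  by (auto simp: Basis_vec_def)

lemma prod_Basis_vec: "(\<Prod>b\<in>(Basis :: (real ^ 'k::finite) set). f b) = (\<Prod>k\<in>UNIV. f (axis k 1))"
  unfolding Basis_vec_real by (subst prod.reindex) (auto simp: inj_on_def axis_eq_axis)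

lemma borel_measurable_vec_lambda:
  fixes f :: "'a \<Rightarrow> 'k::finite \<Rightarrow> real"
  assumes "\<And>k. (\<lambda>x. f x k) \<in> borel_measurable M"
  shows "(\<lambda>x. \<chi> k. f x k) \<in> borel_measurable M"
  by (subst borel_measurable_euclidean_space)
     (use assms in \<open>auto simp: Basis_vec_real inner_axis\<close>)

lemma borel_measurable_PiM_lborel_component:
  "k \<in> I \<Longrightarrow> (\<lambda>y. y k) \<in> borel_measurable (\<Pi>\<^sub>M j\<in>I. (lborel :: real measure))"
  using measurable_component_singleton[of k I "\<lambda>_. lborel :: real measure"] by simp

interpretation lborel_prod: product_sigma_finite "\<lambda>_. lborel :: real measure"
  by standard

text \<open>Open boxes determine Lebesgue measure and correspond to products of intervals. This
  carries Fubini over to vectors: marginals are integrals over function-indexed products, while the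
  densities live on vectors.\<close>

lemma lborel_vec_eq:
  "(lborel :: (real ^ 'k::finite) measure) = distr (\<Pi>\<^sub>M j\<in>UNIV. lborel) borel (\<lambda>f. \<chi> j. f j)"
proof (rule lborel_eqI)
  fix l u :: "real ^ 'k"
  assume le: "\<And>b. b \<in> Basis \<Longrightarrow> l \<bullet> b \<le> u \<bullet> b"
  have le': "l $ k \<le> u $ k" for k
    using le[of "axis k 1"] by (simp add: inner_axis Basis_vec_real)
  have m: "(\<lambda>f. \<chi> j. f j) \<in> borel_measurable (\<Pi>\<^sub>M j\<in>(UNIV :: 'k set). (lborel :: real measure))"
    by (rule borel_measurable_vec_lambda) simp
  have "emeasure (distr (\<Pi>\<^sub>M j\<in>UNIV. lborel) borel (\<lambda>f. \<chi> j. f j)) (box l u)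
      = emeasure (\<Pi>\<^sub>M j\<in>UNIV. lborel) ((\<lambda>f. \<chi> j. f j) -` box l u \<inter> space (\<Pi>\<^sub>M j\<in>(UNIV :: 'k set). (lborel :: real measure)))"
    by (subst emeasure_distr) (auto intro: m)
  also have "(\<lambda>f. \<chi> j. f j) -` box l u \<inter> space (\<Pi>\<^sub>M j\<in>(UNIV :: 'k set). (lborel :: real measure))
      = (\<Pi>\<^sub>E k\<in>UNIV. {l $ k <..< u $ k})"
    by (auto simp: space_PiM mem_box Basis_vec_real inner_axis PiE_def Pi_def)
  also have "emeasure (\<Pi>\<^sub>M j\<in>UNIV. lborel) \<dots> = (\<Prod>k\<in>UNIV. ennreal (u $ k - l $ k))"
    by (subst lborel_prod.emeasure_PiM) (auto simp: le')
  also have "\<dots> = ennreal (\<Prod>b\<in>Basis. (u - l) \<bullet> b)"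
    by (subst prod_Basis_vec) (simp add: prod_ennreal le' inner_axis)
  finally show "emeasure (distr (\<Pi>\<^sub>M j\<in>UNIV. lborel) borel (\<lambda>f. \<chi> j. f j)) (box l u)
      = ennreal (\<Prod>b\<in>Basis. (u - l) \<bullet> b)" .
qed simp

lemma nn_integral_lborel_vec:
  assumes "f \<in> borel_measurable (borel :: (real ^ 'k::finite) measure)"
  shows "(\<integral>\<^sup>+x. f x \<partial>lborel) = (\<integral>\<^sup>+y. f (\<chi> j. y j) \<partial>(\<Pi>\<^sub>M j\<in>UNIV. lborel))"
  by (subst lborel_vec_eq, subst nn_integral_distr)
     (auto intro!: assms borel_measurable_vec_lambda)

definition vupd :: "real ^ 'k \<Rightarrow> 'k \<Rightarrow> real \<Rightarrow> real ^ 'k::finite" where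
  "vupd x k t = (\<chi> j. if j = k then t else x $ j)"

lemma vupd_nth [simp]: "vupd x k t $ j = (if j = k then t else x $ j)"
  by (simp add: vupd_def)

lemma vupd_same [simp]: "vupd x k (x $ k) = x"
  by (simp add: vec_eq_iff)

lemma continuous_on_vupd [continuous_intros]:
  assumes "continuous_on S f" "continuous_on S h"
  shows "continuous_on S (\<lambda>x. vupd (f x) k (h x))"
proof -
  have "continuous_on S (\<lambda>x. if j = k then h x else f x $ j)" for j
    using assms by (cases "j = k") (auto intro!: continuous_intros)
  then show ?thesis unfolding vupd_def by (intro continuous_on_vec_lambda)
qed

text \<open>The \<open>ennreal\<close> counterpart of \<open>marginal\<close>. It keeps the value
  infinity where the Bochner integral defaults to 0, so that Tonelli and Fatou apply before
  finiteness is known.\<close>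

definition nmarg :: "(real ^ 'k::finite \<Rightarrow> real) \<Rightarrow> 'k set \<Rightarrow> real ^ 'k \<Rightarrow> ennreal" where
  "nmarg q A x = (\<integral>\<^sup>+y. ennreal (q (\<chi> j. if j \<in> A then x $ j else y j)) \<partial>(\<Pi>\<^sub>M j\<in>- A. lborel))"

text \<open>The probability integral transform for an atomless finite measure of arbitrary total
  mass. Without atoms the cdf is continuous, so a sublevel set is a half line at whose endpoint the
  cdf equals \<open>y\<close>; flat stretches of the cdf do no harm.\<close>

lemma (in finite_borel_measure) measure_cdf_le:
  assumes "\<And>x. measure M {x} = 0"
  shows "measure M {t. cdf M t \<le> y} = max 0 (min y (measure M (space M)))"
proof -
  have cont: "continuous_on UNIV (cdf M)"
    using assms by (auto simp: continuous_on_eq_continuous_at isCont_cdf)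
  let ?S = "{t. cdf M t \<le> y}"
  consider "y < 0" | "measure M (space M) \<le> y" "0 \<le> y" | "0 \<le> y" "y < measure M (space M)"
    by linarith
  then show ?thesis
  proof cases
    case 1
    have "?S = {}" using cdf_nonneg 1 by (auto simp: not_le intro: less_le_trans)
    then show ?thesis using 1 by (simp add: measure_nonneg)
  next
    case 2
    have "?S = space M" using cdf_bounded 2 by (auto simp: borel_UNIV intro: order_trans)
    then show ?thesis using 2 by simp
  next
    case 3
    have "\<forall>\<^sub>F x in at_top. y < cdf M x"
      using order_tendstoD(1)[OF cdf_lim_at_top, of y] 3 by simp
    then obtain x where x: "y < cdf M x" by (auto simp: eventually_at_top_linorder)
    show ?thesis
    proof (cases "?S = {}")
      case True
      \<comment> \<open>The cdf tends to 0 at minus infinity, so only for \<open>y = 0\<close> can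
        it stay above \<open>y\<close> everywhere.\<close>
      have "y \<le> 0"
      proof (rule ccontr)
        assume "\<not> y \<le> 0"
        then have "\<forall>\<^sub>F x in at_bot. cdf M x < y"
          using order_tendstoD(2)[OF cdf_lim_at_bot, of y] by simp
        then obtain z where "cdf M z < y" by (auto simp: eventually_at_bot_linorder)
        then show False using True by (auto dest: less_imp_le)
      qed
      then show ?thesis unfolding True using 3 by simp
    next
      case False
      then obtain z where z: "cdf M z \<le> y" by auto
      then have zx: "z \<le> x" using x cdf_nondecreasing[of x z] by linarith
      have bdd: "bdd_above ?S"
      proof (rule bdd_aboveI[of _ x])
        fix t assume "t \<in> ?S"
        then show "t \<le> x" using x cdf_nondecreasing[of x t] by (cases "t \<le> x") auto
      qed
      have "closed ?S" using cont by (intro closed_Collect_le continuous_intros) auto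
      then have T: "Sup ?S \<in> ?S" using closed_contains_Sup[OF False bdd] by simp
      obtain t where t: "cdf M t = y"
        using IVT'[of "cdf M" z y x] z x zx continuous_on_subset[OF cont] by auto
      then have "t \<le> Sup ?S" using bdd by (intro cSup_upper) auto
      then have eq: "cdf M (Sup ?S) = y" using cdf_nondecreasing[of t "Sup ?S"] T t by simp
      have "?S = {..Sup ?S}"
      proof (intro equalityI subsetI)
        fix t assume "t \<in> ?S" then show "t \<in> {..Sup ?S}" using cSup_upper[OF _ bdd] by simp
      next
        fix t assume "t \<in> {..Sup ?S}"
        then show "t \<in> ?S" using cdf_nondecreasing[of t "Sup ?S"] eq by simp
      qed
      then have "measure M ?S = cdf M (Sup ?S)" by (metis cdf_def)
      then show ?thesis using eq 3 by simp
    qed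
  qed
qed

text \<open>Continuity at \<open>t0\<close> makes \<open>c\<close> positive on a short interval to
  its right; negative values further on are cut off by \<open>ennreal\<close>.\<close>

lemma nn_integral_cont_pos:
  fixes c :: "real \<Rightarrow> real"
  assumes c: "continuous_on UNIV c" "c t0 > 0" and t: "t0 < t1"
  shows "(\<integral>\<^sup>+t. ennreal (c t) * indicator {t0<..t1} t \<partial>lborel) > 0"
proof (rule ccontr)
  have [measurable]: "c \<in> borel_measurable borel"
    using c by (intro borel_measurable_continuous_onI)
  assume "\<not> ?thesis"
  then have "(\<integral>\<^sup>+t. ennreal (c t) * indicator {t0<..t1} t \<partial>lborel) = 0" by simp
  then have ae: "AE t in lborel. ennreal (c t) * indicator {t0<..t1} t = 0"
    by (subst (asm) nn_integral_0_iff_AE) auto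
  have "isCont c t0" using c by (simp add: continuous_on_eq_continuous_at)
  then have "\<forall>\<^sub>F t in at t0. 0 < c t" using c(2) by (auto simp: isCont_def dest: order_tendstoD)
  then obtain d where d: "d > 0" "\<And>t. t \<noteq> t0 \<Longrightarrow> dist t t0 < d \<Longrightarrow> 0 < c t"
    by (auto simp: eventually_at)
  let ?I = "{t0 <..< min t1 (t0 + d)}"
  have "AE t in lborel. t \<notin> ?I"
    using ae
  proof eventually_elim
    case (elim t)
    show ?case
    proof
      assume t: "t \<in> ?I"
      then have "0 < c t" by (intro d) (auto simp: dist_real_def)
      with elim t show False by (auto simp: ennreal_eq_0_iff)
    qed
  qed
  then have "emeasure lborel ?I = 0"
    by (subst (asm) AE_iff_null_sets[symmetric]) (auto simp: null_sets_def)
  then show False using t d(1) by (simp add: ennreal_eq_0_iff min_def split: if_splits)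
qed

section \<open>The p-value transform\<close>

locale transform =
  fixes q0 :: "real ^ 'k::{finite,linorder} \<Rightarrow> real"
  assumes q0_meas [measurable]: "q0 \<in> borel_measurable borel"
    and q0_nonneg: "\<And>x. 0 \<le> q0 x"
    and q0_prob: "prob_space (density lborel q0)"
    and marg_cont: "\<And>k. continuous_on UNIV (marginal q0 {..k})"
begin

lemma patch_meas [measurable]:
  "(\<lambda>y. \<chi> j. if j \<in> A then x $ j else y j) \<in> borel_measurable (\<Pi>\<^sub>M j\<in>- A. (lborel :: real measure))"
proof (rule borel_measurable_vec_lambda)
  fix k show "(\<lambda>y. if k \<in> A then x $ k else y k) \<in> borel_measurable (\<Pi>\<^sub>M j\<in>- A. (lborel :: real measure))"
    by (cases "k \<in> A") (simp_all add: borel_measurable_PiM_lborel_component)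
qed

lemma marginal_eq_nmarg: "marginal q0 A x = enn2real (nmarg q0 A x)"
  unfolding marginal_def nmarg_def
  by (intro integral_eq_nn_integral) (auto simp: q0_nonneg)

lemma nmarg_cong: "(\<And>j. j \<in> A \<Longrightarrow> x $ j = y $ j) \<Longrightarrow> nmarg q0 A x = nmarg q0 A y"
  unfolding nmarg_def by (intro nn_integral_cong arg_cong[where f = "\<lambda>z. ennreal (q0 z)"]) (simp add: vec_eq_iff)

lemma marginal_cong: "(\<And>j. j \<in> A \<Longrightarrow> x $ j = y $ j) \<Longrightarrow> marginal q0 A x = marginal q0 A y"
  using nmarg_cong marginal_eq_nmarg by metis

lemma q0_integral: "(\<integral>\<^sup>+x. ennreal (q0 x) \<partial>lborel) = 1"
proof -
  interpret prob_space "density lborel q0" by (rule q0_prob)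
  show ?thesis using emeasure_space_1 by (simp add: emeasure_density)
qed

lemma nmarg_empty: "nmarg q0 {} x = 1"
  using q0_integral by (simp add: nmarg_def nn_integral_lborel_vec)

lemma marginal_UNIV: "marginal q0 UNIV x = q0 x"
proof -
  have "nmarg q0 UNIV x = ennreal (q0 x)"
    by (simp add: nmarg_def PiM_empty nn_integral_count_space_finite)
  then show ?thesis by (simp add: marginal_eq_nmarg q0_nonneg)
qed

lemma nmarg_insert:
  assumes "k \<notin> A"
  shows "nmarg q0 A x = (\<integral>\<^sup>+t. nmarg q0 (insert k A) (vupd x k t) \<partial>lborel)"
proof -
  have *: "- A = insert k (- insert k A)" using assms by auto
  have m: "(\<lambda>y. ennreal (q0 (\<chi> j. if j \<in> A then x $ j else y j)))
       \<in> borel_measurable (\<Pi>\<^sub>M j\<in>insert k (- insert k A). (lborel :: real measure))"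
    unfolding *[symmetric] by measurable
  have "nmarg q0 A x = (\<integral>\<^sup>+t. (\<integral>\<^sup>+y. ennreal (q0 (\<chi> j. if j \<in> A then x $ j else (y(k := t)) j))
      \<partial>(\<Pi>\<^sub>M j\<in>- insert k A. lborel)) \<partial>lborel)"
    unfolding nmarg_def by (subst *, rule lborel_prod.product_nn_integral_insert_rev) (auto intro!: m)
  also have "\<dots> = (\<integral>\<^sup>+t. nmarg q0 (insert k A) (vupd x k t) \<partial>lborel)"
    unfolding nmarg_def using assms
    by (intro nn_integral_cong arg_cong[where f = "\<lambda>z. ennreal (q0 z)"]) (auto simp: vec_eq_iff)
  finally show ?thesis .
qed

lemma q0_cont: "continuous_on UNIV q0"
proof -
  have "{..Max (UNIV :: 'k set)} = UNIV" by (auto simp: Max_ge)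
  with marg_cont[of "Max UNIV"] have "continuous_on UNIV (marginal q0 UNIV)" by simp
  then show ?thesis by (simp add: marginal_UNIV)
qed

text \<open>With no integrable majorant at hand, Fatou is all that continuity of the integrand
  yields.\<close>

lemma nmarg_lsc:
  assumes "X \<longlonglongrightarrow> x"
  shows "nmarg q0 A x \<le> liminf (\<lambda>n. nmarg q0 A (X n))"
proof -
  have lim: "(\<lambda>n. ennreal (q0 (\<chi> j. if j \<in> A then X n $ j else y j)))
      \<longlonglongrightarrow> ennreal (q0 (\<chi> j. if j \<in> A then x $ j else y j))" for y
  proof -
    have *: "continuous_on UNIV (\<lambda>x::(real,'k) vec. if j \<in> A then x $ j else y j)" for j
      by (cases "j \<in> A") (auto intro!: continuous_intros)
    have "continuous_on UNIV (\<lambda>x. q0 (\<chi> j. if j \<in> A then x $ j else y j))"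
      by (intro continuous_on_compose2[OF q0_cont] continuous_on_vec_lambda *) auto
    from continuous_on_tendsto_compose[OF this assms] show ?thesis
      by (intro tendsto_ennrealI) auto
  qed
  have "nmarg q0 A x = (\<integral>\<^sup>+y. liminf (\<lambda>n. ennreal (q0 (\<chi> j. if j \<in> A then X n $ j else y j))) \<partial>(\<Pi>\<^sub>M j\<in>- A. lborel))"
    unfolding nmarg_def
    by (intro nn_integral_cong) (simp add: lim_imp_Liminf[OF _ lim])
  also have "\<dots> \<le> liminf (\<lambda>n. nmarg q0 A (X n))"
    unfolding nmarg_def by (rule nn_integral_liminf) measurable
  finally show ?thesis .
qed

lemma insert_lessThan_atMost: "insert k {..<k} = {..k::'k}"
  by auto

text \<open>A marginal that is infinite at a point has the junk value 0 there, but by Fatou its values at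
  nearby points of finiteness are then unbounded.  So continuity excludes this.\<close>

lemma nmarg_downset:
  assumes "finite A" "\<And>j k. k \<in> A \<Longrightarrow> j \<le> k \<Longrightarrow> j \<in> A"
  shows "nmarg q0 A x = ennreal (marginal q0 A x)"
  using assms
proof (induction A arbitrary: x rule: finite_linorder_max_induct)
  case empty
  show ?case by (simp add: marginal_eq_nmarg nmarg_empty)
next
  case (insert k A)
  have "j \<in> A" if "j < k" for j
    using insert.prems[OF insertI1 less_imp_le[OF that]] that by auto
  with insert.hyps have A: "A = {..<k}" by auto
  then have kA: "insert k A = {..k}" by auto
  have IH: "nmarg q0 A x = ennreal (marginal q0 A x)" for x
    by (rule insert.IH) (auto simp: A)
  let ?f = "\<lambda>t. nmarg q0 {..k} (vupd x k t)"
  have "(\<integral>\<^sup>+t. ?f t \<partial>lborel) < \<infinity>"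
    using nmarg_insert[of k A x] IH[of x] by (simp add: A insert_lessThan_atMost less_top[symmetric])
  moreover have fm: "?f \<in> borel_measurable lborel"
  proof -
    have *: "- {..<k} = insert k (- {..k})" by auto
    have m: "(\<lambda>(t, y). \<chi> j. if j \<in> {..k} then vupd x k t $ j else y j)
      \<in> borel_measurable (lborel \<Otimes>\<^sub>M (\<Pi>\<^sub>M j\<in>- {..k}. (lborel :: real measure)))"
      unfolding split_beta
    proof (rule borel_measurable_vec_lambda)
      fix j
      show "(\<lambda>z. if j \<in> {..k} then vupd x k (fst z) $ j else snd z j)
        \<in> borel_measurable (lborel \<Otimes>\<^sub>M (\<Pi>\<^sub>M j\<in>- {..k}. (lborel :: real measure)))"
        by (cases "j \<le> k"; cases "j = k")
          (simp_all add: measurable_compose[OF measurable_snd borel_measurable_PiM_lborel_component])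
    qed
    have m2: "(\<lambda>z. ennreal (q0 (case z of (t, y) \<Rightarrow> \<chi> j. if j \<in> {..k} then vupd x k t $ j else y j)))
      \<in> borel_measurable (lborel \<Otimes>\<^sub>M (\<Pi>\<^sub>M j\<in>- {..k}. (lborel :: real measure)))"
      by (rule measurable_compose[OF m]) simp
    interpret P: finite_product_sigma_finite "\<lambda>_. lborel :: real measure" "- {..k}" by standard auto
    show ?thesis unfolding nmarg_def
      using P.borel_measurable_nn_integral_fst[OF m2] by simp
  qed
  ultimately have ae: "AE t in lborel. ?f t < \<infinity>"
    using nn_integral_PInf_AE[of ?f lborel] by (auto simp: less_top[symmetric] infinity_ennreal_def)
  \<comment> \<open>By the induction hypothesis the integral over the fibre is finite, so the
    integrand is finite almost everywhere, in particular at points arbitrarily close to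
    \<open>x $ k\<close>.\<close>
  have "\<exists>t. \<bar>t - x $ k\<bar> < 1 / Suc n \<and> ?f t < \<infinity>" for n
  proof (rule ccontr)
    assume neg: "\<nexists>t. \<bar>t - x $ k\<bar> < 1 / Suc n \<and> ?f t < \<infinity>"
    have "AE t in lborel. t \<notin> {x $ k - 1 / Suc n <..< x $ k + 1 / Suc n}"
      using ae by eventually_elim (use neg in \<open>force simp: abs_less_iff\<close>)
    then have "emeasure lborel {x $ k - 1 / Suc n <..< x $ k + 1 / Suc n} = 0"
      by (subst (asm) AE_iff_null_sets[symmetric]) (auto simp: null_sets_def)
    then show False by (simp add: ennreal_eq_0_iff divide_le_0_iff)
  qed
  then obtain T where T: "\<And>n. \<bar>T n - x $ k\<bar> < 1 / Suc n" "\<And>n. ?f (T n) < \<infinity>" by metis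
  have Tx: "T \<longlonglongrightarrow> x $ k"
  proof (rule LIM_zero_cancel, rule Lim_null_comparison)
    show "\<forall>\<^sub>F n in sequentially. norm (T n - x $ k) \<le> 1 / Suc n" using T(1) by (auto intro!: always_eventually less_imp_le)
    show "(\<lambda>n. 1 / real (Suc n)) \<longlonglongrightarrow> 0" by (rule LIMSEQ_inverse_real_of_nat[unfolded inverse_eq_divide])
  qed
  have vT: "(\<lambda>n. vupd x k (T n)) \<longlonglongrightarrow> x"
  proof -
    have "continuous_on UNIV (vupd x k)" by (intro continuous_intros)
    from continuous_on_tendsto_compose[OF this Tx] show ?thesis by simp
  qed
  \<comment> \<open>Along this sequence \<open>marginal\<close> is the true integral, so its
    continuity turns the Fatou bound into a finite one.\<close>
  have "nmarg q0 {..k} x \<le> liminf (\<lambda>n. ?f (T n))" by (rule nmarg_lsc[OF vT])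
  also have "(\<lambda>n. ?f (T n)) = (\<lambda>n. ennreal (marginal q0 {..k} (vupd x k (T n))))"
    using T(2) by (simp add: marginal_eq_nmarg less_top)
  also have "liminf \<dots> = ennreal (marginal q0 {..k} x)"
    using continuous_on_tendsto_compose[OF marg_cont vT] by (intro lim_imp_Liminf tendsto_ennrealI) auto
  finally have "nmarg q0 {..k} x < \<infinity>" by (simp add: le_less_trans)
  then show ?case unfolding kA by (simp add: marginal_eq_nmarg less_top)
qed

lemma nmarg_atMost: "nmarg q0 {..k} x = ennreal (marginal q0 {..k} x)"
  and nmarg_lessThan: "nmarg q0 {..<k} x = ennreal (marginal q0 {..<k} x)"
  by (intro nmarg_downset; auto)+

lemma marginal_nonneg: "0 \<le> marginal q0 A x"
  by (simp add: marginal_eq_nmarg)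

lemma marginal_lessThan:
  "(\<integral>\<^sup>+t. ennreal (marginal q0 {..k} (vupd x k t)) \<partial>lborel) = ennreal (marginal q0 {..<k} x)"
  using nmarg_insert[of k "{..<k}" x] by (simp add: insert_lessThan_atMost nmarg_atMost nmarg_lessThan)

text \<open>Continuity is given for closed initial segments only. An open one is either empty, with
  constant marginal 1, or the closed segment of the predecessor of \<open>k\<close>.\<close>

lemma marginal_lessThan_cont: "continuous_on UNIV (marginal q0 {..<k})"
proof (cases "{..<k} = {}")
  case True
  then show ?thesis by (simp add: marginal_eq_nmarg nmarg_empty)
next
  case False
  then obtain m where "m < k" "\<And>j. j < k \<Longrightarrow> j \<le> m"
    using Max_in[OF finite False] Max_ge[of "{..<k}"] by (metis finite lessThan_iff)
  then have "{..<k} = {..m}" by (auto intro: le_less_trans)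
  then show ?thesis using marg_cont by metis
qed

lemma marginal_vupd_cont: "continuous_on UNIV (\<lambda>t. marginal q0 {..k} (vupd x k t))"
  by (intro continuous_on_compose2[OF marg_cont] continuous_intros) auto

text \<open>The conditional law of coordinate \<open>k\<close> given the earlier ones, left
  unnormalised with total mass \<open>marginal q0 {..<k} x\<close>, so that it also makes sense
  where that marginal vanishes.\<close>

definition cond :: "'k \<Rightarrow> (real, 'k) vec \<Rightarrow> real measure" where
  "cond k x = density lborel (\<lambda>t. ennreal (marginal q0 {..k} (vupd x k t)))"

lemma marginal_vupd_meas [measurable]: "(\<lambda>t. marginal q0 {..k} (vupd x k t)) \<in> borel_measurable borel"
  by (intro borel_measurable_continuous_onI marginal_vupd_cont)

lemma sets_cond [simp, measurable_cong]: "sets (cond k x) = sets borel"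
  and space_cond [simp]: "space (cond k x) = UNIV"
  by (simp_all add: cond_def)

lemma emeasure_cond_UNIV: "emeasure (cond k x) UNIV = ennreal (marginal q0 {..<k} x)"
  by (simp add: cond_def emeasure_density marginal_lessThan)

lemma finite_cond: "finite_borel_measure (cond k x)"
  by (intro finite_borel_measure.intro finite_borel_measure_axioms.intro finite_measureI)
     (simp_all add: emeasure_cond_UNIV)

lemma measure_cond_UNIV: "measure (cond k x) UNIV = marginal q0 {..<k} x"
  by (simp add: measure_def emeasure_cond_UNIV marginal_nonneg)

lemma measure_cond_singleton: "measure (cond k x) {t} = 0"
proof -
  have "emeasure (cond k x) {t} = 0"
    unfolding cond_def by (subst emeasure_density) (auto simp: nn_integral_0_iff_AE intro!: AE_I[where N = "{t}"])
  then show ?thesis by (simp add: measure_def)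
qed

lemma cond_cong: "(\<And>j. j < k \<Longrightarrow> x $ j = y $ j) \<Longrightarrow> cond k x = cond k y"
  unfolding cond_def by (intro arg_cong[where f = "density lborel"] ext arg_cong[where f = ennreal] marginal_cong) auto

lemma phi_nth: "phi q0 x $ k = measure (cond k x) {..x $ k} / marginal q0 {..<k} x"
proof -
  have "(LINT t:{..x $ k}|lborel. marginal q0 {..k} (\<chi> j. if j = k then t else x $ j))
     = enn2real (\<integral>\<^sup>+t. ennreal (marginal q0 {..k} (vupd x k t)) * indicator {..x $ k} t \<partial>lborel)"
    unfolding set_lebesgue_integral_def vupd_def[symmetric]
    by (subst integral_eq_nn_integral)
       (auto simp: marginal_nonneg indicator_def intro!: arg_cong[where f = enn2real] nn_integral_cong)
  also have "\<dots> = measure (cond k x) {..x $ k}"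
    by (simp add: measure_def cond_def emeasure_density)
  finally show ?thesis by (simp add: phi_def)
qed

lemma phi_cong: "(\<And>j. j \<le> k \<Longrightarrow> x $ j = y $ j) \<Longrightarrow> phi q0 x $ k = phi q0 y $ k"
  using cond_cong[of k x y] marginal_cong[of "{..<k}" x y] by (simp add: phi_nth)

text \<open>This holds off \<open>sppt q0\<close> too: where the denominator vanishes, the quotient
  is 0 by convention. Hence p-values lie in the cube surely, not just almost surely.\<close>

lemma phi_cube: "phi q0 x \<in> unit_cube"
proof -
  have "0 \<le> phi q0 x $ k \<and> phi q0 x $ k \<le> 1" for k
  proof -
    interpret finite_borel_measure "cond k x" by (rule finite_cond)
    have "measure (cond k x) {..x $ k} \<le> marginal q0 {..<k} x"
      unfolding measure_cond_UNIV[symmetric] by (rule finite_measure_mono) auto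
    then show ?thesis
      by (auto simp: phi_nth marginal_nonneg divide_le_eq_1 less_le)
  qed
  then show ?thesis by (simp add: mem_box_cart)
qed

text \<open>Fatou once more, now with a domain of integration that moves with the point;
  \<open>ev\<close> says that almost every element of the limiting set eventually belongs to the
  moving ones.\<close>

lemma cond_lsc:
  assumes X: "X \<longlonglongrightarrow> x" and B: "\<And>s. B s \<in> sets borel"
    and ev: "AE t in lborel. t \<in> B (x $ k) \<longrightarrow> (\<forall>\<^sub>F n in sequentially. t \<in> B (X n $ k))"
  shows "emeasure (cond k x) (B (x $ k)) \<le> liminf (\<lambda>n. emeasure (cond k (X n)) (B (X n $ k)))"
proof -
  note B [measurable]
  let ?f = "\<lambda>x t. ennreal (marginal q0 {..k} (vupd x k t)) * indicator (B (x $ k)) t"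
  have "AE t in lborel. ?f x t \<le> liminf (\<lambda>n. ?f (X n) t)"
    using ev
  proof eventually_elim
    case (elim t)
    show ?case
    proof (cases "t \<in> B (x $ k)")
      case True
      have "continuous_on UNIV (\<lambda>x. marginal q0 {..k} (vupd x k t))"
        by (intro continuous_on_compose2[OF marg_cont] continuous_intros) auto
      from continuous_on_tendsto_compose[OF this X]
      have "(\<lambda>n. ennreal (marginal q0 {..k} (vupd (X n) k t))) \<longlonglongrightarrow> ennreal (marginal q0 {..k} (vupd x k t))"
        by (intro tendsto_ennrealI) auto
      then have "(\<lambda>n. ?f (X n) t) \<longlonglongrightarrow> ennreal (marginal q0 {..k} (vupd x k t))"
        by (rule Lim_transform_eventually) (use elim True in \<open>auto elim!: eventually_mono\<close>)
      then show ?thesis using True by (simp add: lim_imp_Liminf)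
    qed simp
  qed
  then have "(\<integral>\<^sup>+t. ?f x t \<partial>lborel) \<le> (\<integral>\<^sup>+t. liminf (\<lambda>n. ?f (X n) t) \<partial>lborel)"
    by (rule nn_integral_mono_AE)
  also have "\<dots> \<le> liminf (\<lambda>n. \<integral>\<^sup>+t. ?f (X n) t \<partial>lborel)"
    by (rule nn_integral_liminf) measurable
  finally show ?thesis by (simp add: cond_def emeasure_density B)
qed

text \<open>Both tails are lower semicontinuous by Fatou and their sum is continuous.\<close>

lemma cond_cont: "continuous_on UNIV (\<lambda>x. measure (cond k x) {..x $ k})"
  unfolding continuous_on_sequentially
proof safe
  fix X :: "nat \<Rightarrow> (real, 'k) vec" and x assume X: "X \<longlonglongrightarrow> x"
  let ?L = "\<lambda>x. measure (cond k x) {..x $ k}" and ?U = "\<lambda>x. measure (cond k x) {x $ k<..}"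
  have em: "emeasure (cond k x) A = ennreal (measure (cond k x) A)" for x A
    using finite_cond[of k x] by (simp add: finite_borel_measure_def finite_measure.emeasure_eq_measure)
  have LU: "?L x + ?U x = marginal q0 {..<k} x" for x
  proof -
    interpret finite_borel_measure "cond k x" by (rule finite_cond)
    have "{..x $ k} \<union> {x $ k<..} = UNIV" "{..x $ k} \<inter> {x $ k<..} = {}" by auto
    with finite_measure_Union[of "{..x $ k}" "{x $ k<..}"] show ?thesis
      by (simp only: measure_cond_UNIV) simp
  qed
  have Xk: "(\<lambda>n. X n $ k) \<longlonglongrightarrow> x $ k" using X by (intro tendsto_vec_nth)
  have 1: "ennreal (?L x) \<le> liminf (\<lambda>n. ennreal (?L (X n)))"
    unfolding em[symmetric]
  proof (rule cond_lsc[OF X, where B = "\<lambda>s. {..s}"])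
    \<comment> \<open>Only the endpoint of the closed half line can be lost in the limit, and it is
      a null set.\<close>
    show "AE t in lborel. t \<in> {..x $ k} \<longrightarrow> (\<forall>\<^sub>F n in sequentially. t \<in> {..X n $ k})"
      using AE_lborel_singleton[of "x $ k"]
    proof eventually_elim
      case (elim t)
      then have "t \<in> {..x $ k} \<Longrightarrow> \<forall>\<^sub>F n in sequentially. t < X n $ k"
        by (intro order_tendstoD(1)[OF Xk]) auto
      then show ?case by (auto elim!: eventually_mono intro: less_imp_le)
    qed
  qed auto
  have 2: "ennreal (?U x) \<le> liminf (\<lambda>n. ennreal (?U (X n)))"
    unfolding em[symmetric]
    by (rule cond_lsc[OF X, where B = "\<lambda>s. {s<..}"]) (use order_tendstoD(2)[OF Xk] in auto)
  have 3: "(\<lambda>n. marginal q0 {..<k} (X n)) \<longlonglongrightarrow> marginal q0 {..<k} x"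
    by (rule continuous_on_tendsto_compose[OF marginal_lessThan_cont X]) auto
  have low: "\<forall>\<^sub>F n in sequentially. a - e < b n"
    if "ennreal a \<le> liminf (\<lambda>n. ennreal (b n))" "e > 0" "\<And>n. 0 \<le> b n" "0 \<le> a" for a e :: real and b
  proof (cases "a - e < 0")
    case True
    then have "a - e < b n" for n using that(3)[of n] by linarith
    then show ?thesis by simp
  next
    case False
    then have "ennreal (a - e) < liminf (\<lambda>n. ennreal (b n))"
      using that by (intro less_le_trans[OF _ that(1)]) (auto simp: ennreal_less_iff)
    from less_LiminfD[OF this] show ?thesis
      using False by (auto elim!: eventually_mono simp: ennreal_less_iff)
  qed
  show "((\<lambda>x. ?L x) \<circ> X) \<longlonglongrightarrow> ?L x"
  proof (rule tendstoI)
    fix e :: real assume "e > 0"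
    then have e: "e / 2 > 0" by simp
    have "\<forall>\<^sub>F n in sequentially. ?L x - e / 2 < ?L (X n)" by (rule low[OF 1 e]) auto
    moreover have "\<forall>\<^sub>F n in sequentially. ?U x - e / 2 < ?U (X n)" by (rule low[OF 2 e]) auto
    moreover have "\<forall>\<^sub>F n in sequentially. marginal q0 {..<k} (X n) < marginal q0 {..<k} x + e / 2"
      using e by (intro order_tendstoD(2)[OF 3]) auto
    ultimately show "\<forall>\<^sub>F n in sequentially. dist (((\<lambda>x. ?L x) \<circ> X) n) (?L x) < e"
    proof eventually_elim
      case (elim n)
      then show ?case using LU[of x] LU[of "X n"] e by (simp add: dist_real_def abs_less_iff)
    qed
  qed
qed

lemma phi_meas [measurable]: "phi q0 \<in> borel_measurable borel"
proof -
  have [measurable]: "(\<lambda>x. measure (cond k x) {..x $ k}) \<in> borel_measurable borel"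
    "marginal q0 {..<k} \<in> borel_measurable borel" for k
    by (intro borel_measurable_continuous_onI cond_cont marginal_lessThan_cont)+
  have "phi q0 = (\<lambda>x. \<chi> k. measure (cond k x) {..x $ k} / marginal q0 {..<k} x)"
    by (simp add: fun_eq_iff vec_eq_iff phi_nth)
  also have "\<dots> \<in> borel_measurable borel" by (rule borel_measurable_vec_lambda) measurable
  finally show ?thesis .
qed

lemma marginal_pos_step:
  assumes "marginal q0 {..k} x > 0"
  shows "marginal q0 {..<k} x > 0"
proof -
  have "0 < (\<integral>\<^sup>+t. ennreal (marginal q0 {..k} (vupd x k t)) * indicator {x $ k<..x $ k + 1} t \<partial>lborel)"
    by (rule nn_integral_cont_pos[OF marginal_vupd_cont]) (auto simp: assms)
  also have "\<dots> \<le> (\<integral>\<^sup>+t. ennreal (marginal q0 {..k} (vupd x k t)) \<partial>lborel)"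
    by (intro nn_integral_mono) (auto simp: indicator_def)
  finally show ?thesis by (simp add: marginal_lessThan)
qed

text \<open>Coordinates are integrated out from the largest downwards, each time over a continuous
  function that is positive at \<open>x\<close>. The induction therefore runs over the up-closed set
  \<open>B\<close> of coordinates already removed.\<close>

lemma marginal_pos:
  assumes x: "q0 x > 0"
  shows "marginal q0 {..<k} x > 0"
proof -
  have "(\<forall>j\<in>B. \<forall>i\<ge>j. i \<in> B) \<longrightarrow> marginal q0 (- B) x > 0" if "finite B" for B
    using that
  proof (induction B rule: finite_linorder_min_induct)
    case empty
    then show ?case using x by (simp add: marginal_UNIV)
  next
    case (insert b B)
    show ?case
    proof
      assume up: "\<forall>j\<in>insert b B. \<forall>i\<ge>j. i \<in> insert b B"
      then have B: "B = {b<..}" using insert.hyps by (auto simp: less_le)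
      have eq: "- B = {..b}" "- insert b B = {..<b}" unfolding B by auto
      have "\<forall>j\<in>B. \<forall>i\<ge>j. i \<in> B" by (auto simp: B)
      then show "marginal q0 (- insert b B) x > 0"
        using insert.IH marginal_pos_step unfolding eq by auto
    qed
  qed
  from this[of "{k..}"] show ?thesis by (auto simp: Compl_atLeast)
qed

lemma phi_cont: "continuous_on (sppt q0) (phi q0)"
proof -
  have "phi q0 = (\<lambda>x. \<chi> k. measure (cond k x) {..x $ k} / marginal q0 {..<k} x)"
    by (simp add: fun_eq_iff vec_eq_iff phi_nth)
  moreover have "continuous_on (sppt q0) (\<lambda>x. measure (cond k x) {..x $ k} / marginal q0 {..<k} x)" for k
    by (intro continuous_on_divide continuous_on_subset[OF cond_cont] continuous_on_subset[OF marginal_lessThan_cont])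
       (auto simp: sppt_def dest: marginal_pos[of _ k])
  ultimately show ?thesis by (simp only:) (intro continuous_on_vec_lambda)
qed

text \<open>At the first coordinate in which two points differ, both are measured by the same
  conditional law. Its density is continuous and positive at \<open>x $ k\<close>, so its cdf
  increases strictly to the right of that point.\<close>

lemma phi_inj_aux:
  assumes x: "x \<in> sppt q0" and eq: "phi q0 x $ k = phi q0 y $ k"
    and agree: "\<And>j. j < k \<Longrightarrow> x $ j = y $ j"
  shows "\<not> x $ k < y $ k"
proof
  assume less: "x $ k < y $ k"
  interpret finite_borel_measure "cond k x" by (rule finite_cond)
  have mk: "marginal q0 {..k} x > 0"
  proof -
    \<comment> \<open>\<open>marginal_pos\<close> speaks of open initial segments:
      \<open>{..k}\<close> is the one below the successor of \<open>k\<close>, or everything if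
      \<open>k\<close> is the largest index.\<close>
    consider "{..<Min {k<..}} = {..k}" | "{k<..} = {}"
    proof (cases "{k<..} = {}")
      case False
      have "{..<Min {k<..}} = {..k}"
        using False Min_in[OF finite False] by (auto simp: not_le[symmetric] intro: Min_le) 
      with that show thesis by blast
    qed (use that in blast)
    then show ?thesis
    proof cases
      case 1
      then show ?thesis using marginal_pos[of x "Min {k<..}"] x by (simp add: sppt_def)
    next
      case 2
      then have "{..k} = UNIV" by (auto simp: not_le[symmetric])
      then show ?thesis using x by (simp add: marginal_UNIV sppt_def)
    qed
  qed
  have "marginal q0 {..<k} x = marginal q0 {..<k} y" "cond k y = cond k x"
    using agree by (auto intro!: marginal_cong cond_cong)
  then have "measure (cond k x) {..x $ k} = measure (cond k x) {..y $ k}"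
    using eq marginal_pos[of x k] x by (simp add: phi_nth sppt_def)
  moreover have "measure (cond k x) {..y $ k} = measure (cond k x) {..x $ k} + measure (cond k x) {x $ k<..y $ k}"
    by (subst finite_measure_Union[symmetric]) (use less in \<open>auto intro!: arg_cong[where f = "measure _"]\<close>)
  ultimately have "measure (cond k x) {x $ k<..y $ k} = 0" by simp
  then have "emeasure (cond k x) {x $ k<..y $ k} = 0" by (simp add: emeasure_eq_measure)
  moreover have "emeasure (cond k x) {x $ k<..y $ k} > 0"
    unfolding cond_def using mk less
    by (subst emeasure_density) (auto intro!: nn_integral_cont_pos marginal_vupd_cont)
  ultimately show False by simp
qed

lemma phi_inj: "inj_on (phi q0) (sppt q0)"
proof (rule inj_onI, rule ccontr)
  fix x y assume xy: "x \<in> sppt q0" "y \<in> sppt q0" and eq: "phi q0 x = phi q0 y" and ne: "x \<noteq> y"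
  let ?k = "Min {j. x $ j \<noteq> y $ j}"
  have k: "x $ ?k \<noteq> y $ ?k"
    using Min_in[of "{j. x $ j \<noteq> y $ j}"] ne by (auto simp: vec_eq_iff)
  have agree: "x $ j = y $ j" if "j < ?k" for j
  proof (rule ccontr)
    assume "x $ j \<noteq> y $ j"
    then have "?k \<le> j" by (intro Min_le) auto
    with that show False by simp
  qed
  have "\<not> x $ ?k < y $ ?k" by (rule phi_inj_aux[OF xy(1) _ agree]) (simp add: eq)
  moreover have "\<not> y $ ?k < x $ ?k" by (rule phi_inj_aux[OF xy(2) _ agree[symmetric]]) (simp add: eq)
  ultimately show False using k by linarith
qed

end

section \<open>Uniformity of the transform under the null\<close>

definition vecA :: "'k set \<Rightarrow> ('k::finite \<Rightarrow> real) \<Rightarrow> real ^ 'k" where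
  "vecA A y = (\<chi> j. if j \<in> A then y j else 0)"

lemma vecA_meas [measurable]: "vecA A \<in> borel_measurable (\<Pi>\<^sub>M j\<in>A. (lborel :: real measure))"
  unfolding vecA_def
proof (rule borel_measurable_vec_lambda)
  fix k
  show "(\<lambda>y. if k \<in> A then y k else 0) \<in> borel_measurable (\<Pi>\<^sub>M j\<in>A. (lborel :: real measure))"
    by (cases "k \<in> A") (simp_all add: borel_measurable_PiM_lborel_component)
qed

lemma vecA_upd: "k \<notin> A \<Longrightarrow> vecA (insert k A) (y(k := t)) = vupd (vecA A y) k t"
  by (auto simp: vec_eq_iff vecA_def)

context transform
begin

text \<open>With the earlier coordinates frozen, component \<open>k\<close> of the transform is the
  normalised cdf of \<open>cond k x\<close>, so the integral transform applies. Keeping the factor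
  \<open>marginal q0 {..<k} x\<close> on the right makes the case of zero mass hold as 0 =
  0.\<close>

lemma cond_integral_transform:
  "(\<integral>\<^sup>+t. ennreal (marginal q0 {..k} (vupd x k t)) * indicator {z. phi q0 z $ k \<le> c} (vupd x k t) \<partial>lborel)
    = ennreal (marginal q0 {..<k} x) * ennreal (max 0 (min 1 c))"
proof -
  interpret finite_borel_measure "cond k x" by (rule finite_cond)
  have *: "phi q0 (vupd x k t) $ k = cdf (cond k x) t / marginal q0 {..<k} x" for t
  proof -
    have "cond k (vupd x k t) = cond k x" "marginal q0 {..<k} (vupd x k t) = marginal q0 {..<k} x"
      by (auto intro!: cond_cong marginal_cong)
    then show ?thesis by (simp add: phi_nth cdf_def)
  qed
  have [measurable]: "{t. cdf (cond k x) t / marginal q0 {..<k} x \<le> c} \<in> sets borel"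
  proof -
    have "cdf (cond k x) \<in> borel_measurable borel"
      using cdf_nondecreasing by (intro borel_measurable_mono monoI) auto
    then show ?thesis by measurable
  qed
  have iff: "?thesis \<longleftrightarrow> emeasure (cond k x) {t. cdf (cond k x) t / marginal q0 {..<k} x \<le> c}
      = ennreal (marginal q0 {..<k} x) * ennreal (max 0 (min 1 c))"
    unfolding cond_def[of k x] by (subst emeasure_density)
      (auto simp: * cond_def[symmetric] indicator_def intro!: arg_cong2[where f = "(=)"] nn_integral_cong)
  have "emeasure (cond k x) {t. cdf (cond k x) t / marginal q0 {..<k} x \<le> c}
      = ennreal (marginal q0 {..<k} x) * ennreal (max 0 (min 1 c))"
  proof (cases "marginal q0 {..<k} x = 0")
    case True
    have "emeasure (cond k x) {t. cdf (cond k x) t / marginal q0 {..<k} x \<le> c} \<le> emeasure (cond k x) UNIV"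
      by (rule emeasure_mono) auto
    then show ?thesis using True by (simp add: emeasure_cond_UNIV)
  next
    case False
    then have pos: "marginal q0 {..<k} x > 0" using marginal_nonneg less_le by metis
    have "measure (cond k x) {t. cdf (cond k x) t / marginal q0 {..<k} x \<le> c}
       = measure (cond k x) {t. cdf (cond k x) t \<le> c * marginal q0 {..<k} x}"
      using pos by (simp add: pos_divide_le_eq)
    also have "\<dots> = max 0 (min (c * marginal q0 {..<k} x) (marginal q0 {..<k} x))"
      using measure_cdf_le[OF measure_cond_singleton] by (simp add: measure_cond_UNIV)
    also have "\<dots> = marginal q0 {..<k} x * max 0 (min 1 c)"
      using pos by (auto simp: max_def min_def mult_less_cancel_right1 mult_le_cancel_right1 zero_le_mult_iff)
    finally show ?thesis
      by (simp add: emeasure_eq_measure ennreal_mult'' marginal_nonneg)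
  qed
  with iff show ?thesis by blast
qed

text \<open>The transform is triangular: component \<open>j\<close> sees only coordinates up to
  \<open>j\<close>. Integrating over the largest coordinate first splits off one factor of the
  uniform law and leaves the same integral over the smaller set.\<close>

lemma phi_law_downset:
  assumes "finite A" "\<And>j k. k \<in> A \<Longrightarrow> j \<le> k \<Longrightarrow> j \<in> A"
  shows "(\<integral>\<^sup>+y. ennreal (marginal q0 A (vecA A y)) * (\<Prod>j\<in>A. indicator {z. phi q0 z $ j \<le> c $ j} (vecA A y))
      \<partial>(\<Pi>\<^sub>M j\<in>A. lborel)) = (\<Prod>j\<in>A. ennreal (max 0 (min 1 (c $ j))))"
  using assms
proof (induction A rule: finite_linorder_max_induct)
  case empty
  show ?case by (simp add: PiM_empty nn_integral_count_space_finite marginal_eq_nmarg nmarg_empty)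
next
  case (insert k A)
  have "j \<in> A" if "j < k" for j
    using insert.prems[OF insertI1 less_imp_le[OF that]] that by auto
  with insert.hyps have A: "A = {..<k}" by auto
  then have kA: "insert k A = {..k}" by auto
  have k: "k \<notin> A" by (simp add: A)
  have IH: "(\<integral>\<^sup>+y. ennreal (marginal q0 A (vecA A y)) * (\<Prod>j\<in>A. indicator {z. phi q0 z $ j \<le> c $ j} (vecA A y))
      \<partial>(\<Pi>\<^sub>M j\<in>A. lborel)) = (\<Prod>j\<in>A. ennreal (max 0 (min 1 (c $ j))))"
    by (rule insert.IH) (auto simp: A)
  have [measurable]: "marginal q0 {..k} \<in> borel_measurable borel" "marginal q0 {..<k} \<in> borel_measurable borel" for k
    by (intro borel_measurable_continuous_onI marg_cont marginal_lessThan_cont)+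
  have [measurable]: "{z. phi q0 z $ j \<le> b} \<in> sets borel" for j b by measurable
  let ?P = "\<lambda>y. \<Prod>j\<in>A. indicator {z. phi q0 z $ j \<le> c $ j} (vecA A y) :: ennreal"
  have m: "(\<lambda>y. ennreal (marginal q0 {..k} (vecA {..k} y)) * (\<Prod>j\<in>{..k}. indicator {z. phi q0 z $ j \<le> c $ j} (vecA {..k} y)))
       \<in> borel_measurable (\<Pi>\<^sub>M j\<in>{..k}. (lborel :: real measure))" by measurable
  \<comment> \<open>The earlier components do not see coordinate \<open>k\<close>, so their
    indicators leave the inner integral.\<close>
  have P: "(\<Prod>j\<in>A. indicator {z. phi q0 z $ j \<le> c $ j} (vupd (vecA A y) k t)) = ?P y" for y t
  proof (intro prod.cong refl)
    fix j assume "j \<in> A"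
    then have "phi q0 (vupd (vecA A y) k t) $ j = phi q0 (vecA A y) $ j"
      by (intro phi_cong) (auto simp: A)
    then show "indicator {z. phi q0 z $ j \<le> c $ j} (vupd (vecA A y) k t)
        = (indicator {z. phi q0 z $ j \<le> c $ j} (vecA A y) :: ennreal)"
      by (simp add: indicator_def)
  qed
  have "(\<integral>\<^sup>+y. ennreal (marginal q0 (insert k A) (vecA (insert k A) y)) *
        (\<Prod>j\<in>insert k A. indicator {z. phi q0 z $ j \<le> c $ j} (vecA (insert k A) y)) \<partial>(\<Pi>\<^sub>M j\<in>insert k A. lborel))
     = (\<integral>\<^sup>+y. (\<integral>\<^sup>+t. ennreal (marginal q0 (insert k A) (vecA (insert k A) (y(k := t)))) *
        (\<Prod>j\<in>insert k A. indicator {z. phi q0 z $ j \<le> c $ j} (vecA (insert k A) (y(k := t)))) \<partial>lborel) \<partial>(\<Pi>\<^sub>M j\<in>A. lborel))"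
    by (rule lborel_prod.product_nn_integral_insert) (use insert.hyps k m in \<open>simp_all add: kA\<close>)
  also have "\<dots> = (\<integral>\<^sup>+y. ?P y * (\<integral>\<^sup>+t. ennreal (marginal q0 {..k} (vupd (vecA A y) k t)) *
        indicator {z. phi q0 z $ k \<le> c $ k} (vupd (vecA A y) k t) \<partial>lborel) \<partial>(\<Pi>\<^sub>M j\<in>A. lborel))"
  proof (intro nn_integral_cong)
    fix y
    have [measurable]: "(\<lambda>t. vupd (vecA A y) k t) \<in> borel_measurable borel"
      by (intro borel_measurable_continuous_onI continuous_intros)
    have "(\<integral>\<^sup>+t. ennreal (marginal q0 (insert k A) (vecA (insert k A) (y(k := t)))) *
        (\<Prod>j\<in>insert k A. indicator {z. phi q0 z $ j \<le> c $ j} (vecA (insert k A) (y(k := t)))) \<partial>lborel)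
      = (\<integral>\<^sup>+t. ?P y * (ennreal (marginal q0 {..k} (vupd (vecA A y) k t)) *
        indicator {z. phi q0 z $ k \<le> c $ k} (vupd (vecA A y) k t)) \<partial>lborel)"
      unfolding kA[symmetric] vecA_upd[OF k] prod.insert[OF insert.hyps(1) k] P by (simp add: mult_ac)
    also have "\<dots> = ?P y * (\<integral>\<^sup>+t. ennreal (marginal q0 {..k} (vupd (vecA A y) k t)) *
        indicator {z. phi q0 z $ k \<le> c $ k} (vupd (vecA A y) k t) \<partial>lborel)"
      by (rule nn_integral_cmult) measurable
    finally show "(\<integral>\<^sup>+t. ennreal (marginal q0 (insert k A) (vecA (insert k A) (y(k := t)))) *
        (\<Prod>j\<in>insert k A. indicator {z. phi q0 z $ j \<le> c $ j} (vecA (insert k A) (y(k := t)))) \<partial>lborel)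
      = ?P y * (\<integral>\<^sup>+t. ennreal (marginal q0 {..k} (vupd (vecA A y) k t)) *
        indicator {z. phi q0 z $ k \<le> c $ k} (vupd (vecA A y) k t) \<partial>lborel)" .
  qed
  also have "\<dots> = (\<integral>\<^sup>+y. (ennreal (marginal q0 A (vecA A y)) * ?P y) * ennreal (max 0 (min 1 (c $ k))) \<partial>(\<Pi>\<^sub>M j\<in>A. lborel))"
    by (simp add: cond_integral_transform A mult_ac)
  also have "\<dots> = (\<integral>\<^sup>+y. (ennreal (marginal q0 A (vecA A y)) * ?P y) \<partial>(\<Pi>\<^sub>M j\<in>A. lborel)) * ennreal (max 0 (min 1 (c $ k)))"
    unfolding A by (rule nn_integral_multc) measurable
  also have "\<dots> = (\<Prod>j\<in>insert k A. ennreal (max 0 (min 1 (c $ j))))"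
    using k insert.hyps by (simp add: IH mult_ac)
  finally show ?case .
qed

lemma phi_law_orthant:
  "emeasure (density lborel q0) {x. phi q0 x \<le> c} = (\<Prod>j\<in>UNIV. ennreal (max 0 (min 1 (c $ j))))"
proof -
  have m [measurable]: "{z. phi q0 z $ j \<le> b} \<in> sets borel" for j b by measurable
  have "{x. phi q0 x \<le> c} = (\<Inter>j. {z. phi q0 z $ j \<le> c $ j})" by (auto simp: less_eq_vec_def)
  then have s: "{x. phi q0 x \<le> c} \<in> sets borel" by auto
  have "emeasure (density lborel q0) {x. phi q0 x \<le> c}
      = (\<integral>\<^sup>+x. ennreal (q0 x) * (\<Prod>j\<in>UNIV. indicator {z. phi q0 z $ j \<le> c $ j} x) \<partial>lborel)"
    using s by (subst emeasure_density)
      (auto simp: less_eq_vec_def indicator_def prod_zero_iff intro!: nn_integral_cong)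
  also have "\<dots> = (\<integral>\<^sup>+y. ennreal (marginal q0 UNIV (vecA UNIV y)) *
      (\<Prod>j\<in>UNIV. indicator {z. phi q0 z $ j \<le> c $ j} (vecA UNIV y)) \<partial>(\<Pi>\<^sub>M j\<in>UNIV. lborel))"
    by (subst nn_integral_lborel_vec) (auto simp: vecA_def marginal_UNIV)
  also have "\<dots> = (\<Prod>j\<in>UNIV. ennreal (max 0 (min 1 (c $ j))))"
    by (rule phi_law_downset) auto
  finally show ?thesis .
qed

lemma emeasure_cube_orthant:
  "emeasure lborel (unit_cube \<inter> {..c :: (real, 'k) vec}) = (\<Prod>j\<in>UNIV. ennreal (max 0 (min 1 (c $ j))))"
proof (cases "\<forall>j. 0 \<le> c $ j")
  case True
  have "unit_cube \<inter> {..c} = cbox 0 (\<chi> j. min 1 (c $ j))"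
    by (auto simp: set_eq_iff mem_box_cart less_eq_vec_def)
  moreover have "emeasure lborel (cbox 0 (\<chi> j. min 1 (c $ j)))
      = ennreal (\<Prod>b\<in>Basis. ((\<chi> j. min 1 (c $ j)) - 0) \<bullet> b)"
    by (rule emeasure_lborel_cbox) (use True in \<open>auto simp: Basis_vec_real inner_axis\<close>)
  moreover have "(\<Prod>b\<in>Basis. ((\<chi> j. min 1 (c $ j)) - 0) \<bullet> b) = (\<Prod>j\<in>UNIV. max 0 (min 1 (c $ j)))"
    using True by (subst prod_Basis_vec) (auto simp: inner_axis intro!: prod.cong)
  moreover have "ennreal (\<Prod>j\<in>UNIV. max 0 (min 1 (c $ j))) = (\<Prod>j\<in>UNIV. ennreal (max 0 (min 1 (c $ j))))"
    by (rule prod_ennreal[symmetric]) simp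
  ultimately show ?thesis by simp
next
  case False
  then obtain j where j: "c $ j < 0" by (auto simp: not_le)
  then have "unit_cube \<inter> {..c} = {}"
    by (auto simp: mem_box_cart less_eq_vec_def) (meson not_le order_trans)
  moreover have "(\<Prod>j\<in>UNIV. ennreal (max 0 (min 1 (c $ j)))) = 0"
    using j by (auto intro!: exI[of _ j] simp: ennreal_neg min_def)
  ultimately show ?thesis by simp
qed

lemma phi_law: "distr (density lborel q0) borel (phi q0) = density lborel (indicator unit_cube)"
proof (rule measure_eqI_generator_eq[where E = "range atMost" and \<Omega> = UNIV and A = "\<lambda>n. {.. \<chi> j. real n}"])
  show "Int_stable (range (atMost :: (real, 'k) vec \<Rightarrow> _))"
  proof (rule Int_stableI_image)
    fix a b :: "(real, 'k) vec"
    have "{..a} \<inter> {..b} = {.. \<chi> j. min (a $ j) (b $ j)}" by (auto simp: less_eq_vec_def)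
    then show "\<exists>c\<in>UNIV. {..a} \<inter> {..b} = {..c}" by blast
  qed
  show "emeasure (distr (density lborel q0) borel (phi q0)) X = emeasure (density lborel (indicator unit_cube)) X"
    if "X \<in> range atMost" for X :: "(real, 'k) vec set"
  proof -
    from that obtain c where X: "X = {..c}" by auto
    have [measurable]: "{..c} \<in> sets borel" by simp
    have "emeasure (distr (density lborel q0) borel (phi q0)) X = emeasure (density lborel q0) {x. phi q0 x \<le> c}"
      unfolding X by (subst emeasure_distr) (auto intro!: arg_cong[where f = "emeasure _"])
    also have "\<dots> = emeasure (density lborel (indicator unit_cube)) X"
      unfolding X phi_law_orthant emeasure_cube_orthant[symmetric]
      by (subst emeasure_density) (auto simp: indicator_inter_arith[symmetric])
    finally show ?thesis .
  qed
  show "(\<Union>n. {.. \<chi> j. real n}) = (UNIV :: (real, 'k) vec set)"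
  proof (rule equalityI, simp, rule subsetI)
    fix x :: "(real, 'k) vec"
    obtain n :: nat where n: "Max (range (($) x)) \<le> n" using real_arch_simple by blast
    have "x $ j \<le> n" for j using Max_ge[of "range (($) x)" "x $ j"] n by simp
    then show "x \<in> (\<Union>n. {.. \<chi> j. real n})" by (auto simp: less_eq_vec_def)
  qed
  show "emeasure (distr (density lborel q0) borel (phi q0)) {.. \<chi> j. real n} \<noteq> \<infinity>" for n :: nat
  proof -
    interpret prob_space "density lborel q0" by (rule q0_prob)
    interpret D: prob_space "distr (density lborel q0) borel (phi q0)" by (rule prob_space_distr) simp
    show ?thesis by simp
  qed
qed (simp_all add: borel_eq_atMost image_subset_iff)

end

section \<open>The law of the p-values under the alternative\<close>

locale transform2 = transform q0 for q0 :: "real ^ 'k::{finite,linorder} \<Rightarrow> real" +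
  fixes q1 :: "(real, 'k) vec \<Rightarrow> real"
  assumes q1_meas [measurable]: "q1 \<in> borel_measurable borel"
    and q1_nonneg: "\<And>x. 0 \<le> q1 x"
    and q1_sppt: "sppt q1 \<subseteq> sppt q0"
    and q1_cont: "continuous_on (sppt q0) q1"
begin

abbreviation E :: "(real, 'k) vec set" where "E \<equiv> phi q0 ` sppt q0"

lemma open_sppt: "open (sppt q0)"
  unfolding sppt_def by (intro open_Collect_less q0_cont continuous_intros)

lemma open_E: "open E"
  by (rule invariance_of_domain[OF phi_cont open_sppt phi_inj])

lemma E_cube: "E \<subseteq> unit_cube"
  using phi_cube by auto

lemma gdens_phi: "x \<in> sppt q0 \<Longrightarrow> gdens q0 q1 (phi q0 x) = q1 x / q0 x"
  using phi_inj by (simp add: gdens_def)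

lemma gdens_cont: "continuous_on E (gdens q0 q1)"
proof -
  have inv: "continuous_on E (inv_into (sppt q0) (phi q0))"
    by (rule continuous_on_inverse_open[OF open_sppt phi_cont]) (simp_all add: phi_inj)
  have "continuous_on (sppt q0) (\<lambda>x. q1 x / q0 x)"
    by (intro continuous_on_divide q1_cont continuous_on_subset[OF q0_cont]) (auto simp: sppt_def)
  then have "continuous_on E (\<lambda>x. q1 (inv_into (sppt q0) (phi q0) x) / q0 (inv_into (sppt q0) (phi q0) x))"
    by (rule continuous_on_compose2[OF _ inv]) (auto simp: inv_into_into)
  then show ?thesis by (rule continuous_on_eq) (simp add: gdens_def)
qed

lemma gdens_nonneg: "0 \<le> gdens q0 q1 x"
  using q0_nonneg q1_nonneg by (simp add: gdens_def)

lemma gdens_meas [measurable]: "gdens q0 q1 \<in> borel_measurable borel"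
proof -
  have "gdens q0 q1 = (\<lambda>x. if x \<in> E then gdens q0 q1 x else 0)" by (auto simp: gdens_def)
  also have "\<dots> \<in> borel_measurable borel"
    using open_E gdens_cont by (intro borel_measurable_continuous_on_if) auto
  finally show ?thesis .
qed

text \<open>The uniform law is the image of the null law. A point mapped outside \<open>E\<close>
  lies outside the support of \<open>q0\<close>, which has null mass 0.\<close>

lemma E_full: "emeasure lborel (unit_cube - E) = 0"
proof -
  have [measurable]: "E \<in> sets borel" using open_E by simp
  have "emeasure lborel (unit_cube - E) = emeasure (density lborel (indicator unit_cube)) (- E)"
    by (subst emeasure_density) (auto simp: indicator_inter_arith[symmetric] Diff_eq)
  also have "\<dots> = emeasure (density lborel q0) (phi q0 -` (- E))"
    unfolding phi_law[symmetric] by (subst emeasure_distr) auto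
  also have "\<dots> = 0"
  proof -
    have "phi q0 -` (- E) \<in> sets borel" using measurable_sets[OF phi_meas, of "- E"] by simp
    then have "emeasure (density lborel q0) (phi q0 -` (- E))
        = (\<integral>\<^sup>+x. ennreal (q0 x) * indicator (phi q0 -` (- E)) x \<partial>lborel)"
      by (intro emeasure_density) auto
    also have "\<dots> = (\<integral>\<^sup>+x. 0 \<partial>(lborel :: (real, 'k) vec measure))"
    proof (intro nn_integral_cong)
      fix x
      show "ennreal (q0 x) * indicator (phi q0 -` (- E)) x = 0"
        by (cases "x \<in> sppt q0") (auto simp: sppt_def ennreal_neg)
    qed
    finally show ?thesis by simp
  qed
  finally show ?thesis .
qed

text \<open>A change of variables without Jacobian: \<open>q1\<close> is written as
  \<open>q0\<close> times the likelihood ratio, which is possible because its support lies in that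
  of \<open>q0\<close>, and the null law is then pushed forward by \<open>phi_law\<close>.\<close>

lemma phi_law_alt:
  assumes B [measurable]: "B \<in> sets borel"
  shows "emeasure (density lborel q1) (phi q0 -` B) = (\<integral>\<^sup>+x. ennreal (gdens q0 q1 x) * indicator (B \<inter> unit_cube) x \<partial>lborel)"
proof -
  have [measurable]: "phi q0 -` B \<in> sets borel" using measurable_sets[OF phi_meas B] by simp
  have "emeasure (density lborel q1) (phi q0 -` B) = (\<integral>\<^sup>+x. ennreal (q1 x) * indicator (phi q0 -` B) x \<partial>lborel)"
    by (rule emeasure_density) auto
  also have "\<dots> = (\<integral>\<^sup>+x. ennreal (q0 x) * (ennreal (gdens q0 q1 (phi q0 x)) * indicator B (phi q0 x)) \<partial>lborel)"
  proof (intro nn_integral_cong)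
    fix x
    show "ennreal (q1 x) * indicator (phi q0 -` B) x = ennreal (q0 x) * (ennreal (gdens q0 q1 (phi q0 x)) * indicator B (phi q0 x))"
    proof (cases "x \<in> sppt q0")
      case True
      then have "ennreal (q1 x) = ennreal (q0 x) * ennreal (gdens q0 q1 (phi q0 x))"
        using q1_nonneg[of x] by (subst ennreal_mult[symmetric]) (auto simp: gdens_phi sppt_def)
      then show ?thesis by (simp add: mult.assoc indicator_def)
    next
      case False
      then have "\<not> 0 < q0 x" "\<not> 0 < q1 x" using q1_sppt by (auto simp: sppt_def)
      then have "q0 x = 0" "q1 x = 0" using q0_nonneg[of x] q1_nonneg[of x] by auto
      then show ?thesis by simp
    qed
  qed
  also have "\<dots> = (\<integral>\<^sup>+x. ennreal (gdens q0 q1 (phi q0 x)) * indicator B (phi q0 x) \<partial>density lborel q0)"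
    by (subst nn_integral_density) auto
  also have "\<dots> = (\<integral>\<^sup>+x. ennreal (gdens q0 q1 x) * indicator B x \<partial>distr (density lborel q0) borel (phi q0))"
    by (subst nn_integral_distr) auto
  also have "\<dots> = (\<integral>\<^sup>+x. ennreal (gdens q0 q1 x) * indicator (B \<inter> unit_cube) x \<partial>lborel)"
    unfolding phi_law by (subst nn_integral_density) (auto simp: indicator_inter_arith mult_ac)
  finally show ?thesis .
qed

end

section \<open>Level sets of the alternative density\<close>

abbreviation unif_cube :: "(real ^ 'k::finite) measure" where
  "unif_cube \<equiv> density lborel (indicator unit_cube)"

lemma emeasure_unit_cube: "emeasure lborel (unit_cube :: (real ^ 'k::finite) set) = 1"
  by (subst emeasure_lborel_cbox) (auto simp: Basis_vec_real prod_Basis_vec[unfolded Basis_vec_real] inner_axis)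

lemma prob_space_unif_cube: "prob_space (unif_cube :: (real ^ 'k::finite) measure)"
  by (intro prob_spaceI) (simp add: emeasure_density emeasure_unit_cube)

lemma emeasure_unif_cube:
  assumes "A \<in> sets borel"
  shows "emeasure unif_cube A = emeasure lborel (A \<inter> unit_cube)"
  using assms by (subst emeasure_density) (auto simp: indicator_inter_arith[symmetric] Int_commute)

lemma AE_unif_cube: "AE x in unif_cube. x \<in> unit_cube"
  by (subst AE_density) (auto simp: indicator_def)

lemma (in transform) phi_law_measure:
  assumes B [measurable]: "B \<in> sets borel"
  shows "measure (density lborel q0) (phi q0 -` B) = measure unif_cube B"
proof -
  have "measure unif_cube B = measure (distr (density lborel q0) borel (phi q0)) B" by (simp add: phi_law)
  also have "\<dots> = measure (density lborel q0) (phi q0 -` B)" by (subst measure_distr) auto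
  finally show ?thesis by simp
qed

text \<open>What the geometry of the rejection regions uses of \<open>g\<close>. Its origin as a
  likelihood ratio is forgotten here; only its total mass and the continuity of \<open>h\<close> are
  kept.\<close>

locale cube_density =
  fixes g :: "real ^ 'k::finite \<Rightarrow> real"
  assumes g_meas [measurable]: "g \<in> borel_measurable borel"
    and g_nonneg: "\<And>x. 0 \<le> g x"
    and g_int: "(\<integral>\<^sup>+x. ennreal (g x) * indicator unit_cube x \<partial>lborel) = 1"
    and h_cont: "continuous_on {0..} (hfun g)"
begin

sublocale U: prob_space "unif_cube :: (real, 'k) vec measure"
  by (rule prob_space_unif_cube)

lemma hfun_eq: "hfun g u = U.prob {x. u \<le> g x}"
proof -
  have "{x. u \<le> g x} \<in> sets borel" by measurable
  moreover have "Gam g (ereal u) = {x. u \<le> g x} \<inter> unit_cube" by (auto simp: Gam_def)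
  ultimately show ?thesis by (simp add: hfun_def measure_def emeasure_unif_cube)
qed

lemma hfun_nonneg: "0 \<le> hfun g u" and hfun_le_1: "hfun g u \<le> 1"
  by (simp_all add: hfun_eq)

lemma hfun_antimono: "u \<le> v \<Longrightarrow> hfun g v \<le> hfun g u"
  unfolding hfun_eq by (intro U.finite_measure_mono) auto

lemma hfun_0: "hfun g 0 = 1"
  using U.prob_space by (simp add: hfun_eq g_nonneg)

text \<open>As \<open>v\<close> decreases to \<open>u\<close>, \<open>hfun g v\<close> tends to the
  mass of \<open>{x. u < g x}\<close>; a level set of positive mass would thus be a jump of
  \<open>h\<close>.\<close>

lemma prob_level_set: "0 \<le> u \<Longrightarrow> U.prob {x. g x = u} = 0"
proof -
  assume u: "0 \<le> u"
  have "(\<lambda>n. U.prob {x. u + 1 / Suc n \<le> g x}) \<longlonglongrightarrow> U.prob (\<Union>n. {x. u + 1 / Suc n \<le> g x})"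
  proof (rule U.finite_Lim_measure_incseq)
    show "incseq (\<lambda>n. {x. u + 1 / Suc n \<le> g x})"
    proof (rule incseq_SucI, rule subsetI)
      fix n x assume "x \<in> {x. u + 1 / Suc n \<le> g x}"
      moreover have "1 / real (Suc (Suc n)) \<le> 1 / real (Suc n)" by (intro divide_left_mono) auto
      ultimately show "x \<in> {x. u + 1 / Suc (Suc n) \<le> g x}" by simp
    qed
  qed auto
  also have "(\<Union>n. {x. u + 1 / Suc n \<le> g x}) = {x. u < g x}"
  proof (intro equalityI subsetI)
    fix x assume "x \<in> {x. u < g x}"
    then obtain n where "inverse (real (Suc n)) < g x - u" using reals_Archimedean[of "g x - u"] by auto
    then have "u + 1 / Suc n \<le> g x" by (simp add: inverse_eq_divide)
    then show "x \<in> (\<Union>n. {x. u + 1 / Suc n \<le> g x})" by blast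
  next
    fix x assume "x \<in> (\<Union>n. {x. u + 1 / Suc n \<le> g x})"
    then obtain n where "u + 1 / Suc n \<le> g x" by auto
    moreover have "0 < 1 / real (Suc n)" by simp
    ultimately have "u < g x" by linarith
    then show "x \<in> {x. u < g x}" by simp
  qed
  finally have 1: "(\<lambda>n. hfun g (u + 1 / Suc n)) \<longlonglongrightarrow> U.prob {x. u < g x}" by (simp add: hfun_eq)
  have "(\<lambda>n. u + 1 / Suc n) \<longlonglongrightarrow> u + 0"
    by (intro tendsto_intros LIMSEQ_inverse_real_of_nat[unfolded inverse_eq_divide])
  then have "(\<lambda>n. hfun g (u + 1 / Suc n)) \<longlonglongrightarrow> hfun g u"
    by (intro continuous_on_tendsto_compose[OF h_cont]) (use u in auto)
  then have "U.prob {x. u < g x} = U.prob {x. u \<le> g x}" using 1 LIMSEQ_unique by (auto simp: hfun_eq)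
  moreover have "U.prob {x. u \<le> g x} = U.prob {x. u < g x} + U.prob {x. g x = u}"
    by (subst U.finite_measure_Union[symmetric]) (auto intro!: arg_cong[where f = "measure _"])
  ultimately show ?thesis by simp
qed

text \<open>The real-valued form of \<open>hstar\<close>, meaningful only if some level qualifies,
  since the infimum of an empty set of reals is unspecified.\<close>

definition lev :: "real \<Rightarrow> real" where
  "lev t = Inf {u. 0 \<le> u \<and> hfun g u \<le> t}"

lemma lev:
  assumes ne: "{u. 0 \<le> u \<and> hfun g u \<le> t} \<noteq> {}" and t: "t \<le> 1"
  shows "0 \<le> lev t" "hfun g (lev t) = t" "\<And>u. 0 \<le> u \<Longrightarrow> hfun g u \<le> t \<Longrightarrow> lev t \<le> u"
    and "hstar g t = ereal (lev t)"
proof -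
  let ?S = "{u. 0 \<le> u \<and> hfun g u \<le> t}"
  have bdd: "bdd_below ?S" by (auto intro: bdd_belowI[of _ 0])
  have "closed {u \<in> {0..}. hfun g u \<le> t}"
    by (rule continuous_on_closed_Collect_le[OF h_cont continuous_on_const closed_atLeast])
  then have "lev t \<in> ?S"
    using closed_contains_Inf[OF ne bdd] by (simp add: lev_def)
  then have 0: "0 \<le> lev t" and le: "hfun g (lev t) \<le> t" by auto
  show "0 \<le> lev t" by (rule 0)
  have low: "lev t \<le> u" if "0 \<le> u" "hfun g u \<le> t" for u
    unfolding lev_def using that by (intro cInf_lower bdd) auto
  then show "\<And>u. 0 \<le> u \<Longrightarrow> hfun g u \<le> t \<Longrightarrow> lev t \<le> u" .
  \<comment> \<open>On \<open>{0..lev t}\<close> the function \<open>h\<close> descends continuously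
    from 1 to at most \<open>t\<close>, so it takes the value \<open>t\<close>; minimality of
    \<open>lev t\<close> leaves no other place for this than \<open>lev t\<close> itself.\<close>
  obtain u where "0 \<le> u" "u \<le> lev t" "hfun g u = t"
    using IVT2'[of "hfun g" "lev t" t 0] le t 0 continuous_on_subset[OF h_cont] by (auto simp: hfun_0)
  with low show "hfun g (lev t) = t" by (metis antisym order_refl)
  show "hstar g t = ereal (lev t)"
    unfolding hstar_def using low 0 le
    by (intro antisym Inf_lower Inf_greatest) auto
qed

text \<open>Since \<open>g\<close> is real valued, the sets where it is at least \<open>n\<close>
  decrease to the empty set and \<open>h\<close> tends to 0. For \<open>t = 0\<close> an unbounded
  \<open>g\<close> may leave no level at all, and then \<open>hstar\<close> is infinite.\<close>

lemma ex_level: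
  assumes t: "0 < t"
  shows "{u. 0 \<le> u \<and> hfun g u \<le> t} \<noteq> {}"
proof -
  have "(\<lambda>n. U.prob {x. real n \<le> g x}) \<longlonglongrightarrow> U.prob (\<Inter>n. {x. real n \<le> g x})"
    by (rule U.finite_Lim_measure_decseq) (auto simp: decseq_def)
  also have "(\<Inter>n. {x. real n \<le> g x}) = {}"
  proof (rule equals0I)
    fix x assume "x \<in> (\<Inter>n. {x. real n \<le> g x})"
    moreover obtain n :: nat where "g x < n" using reals_Archimedean2 by blast
    ultimately show False by (auto simp: not_le[symmetric])
  qed
  finally have "(\<lambda>n. hfun g (real n)) \<longlonglongrightarrow> 0" by (simp add: hfun_eq)
  then have "\<forall>\<^sub>F n in sequentially. hfun g (real n) < t" using t by (rule order_tendstoD)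
  then obtain n where "hfun g (real n) < t" by (auto simp: eventually_sequentially)
  then show ?thesis by (auto intro!: exI[of _ "real n"])
qed

lemmas lev_pos = lev[OF ex_level]

text \<open>Outside the unit cube, where p-values never lie, \<open>pval\<close> is an arbitrary number above 1.\<close>

definition pval :: "(real, 'k) vec \<Rightarrow> real" where
  "pval x = (if x \<in> unit_cube then hfun g (g x) else 2)"

lemma hfun_g_measurable: "(\<lambda>x. hfun g (g x)) \<in> borel_measurable borel"
proof -
  have "mono (\<lambda>u. - hfun g u)" by (intro monoI) (simp add: hfun_antimono)
  from borel_measurable_mono[OF this] have "(\<lambda>u. - (- hfun g u)) \<in> borel_measurable borel" by measurable
  then show ?thesis by (intro measurable_compose[OF g_meas]) simp
qed

lemma pval_meas [measurable]: "pval \<in> borel_measurable borel"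
  using hfun_g_measurable unfolding pval_def by measurable

lemma Dset_iff:
  assumes t: "0 \<le> t" "t \<le> 1"
  shows "x \<in> Dset g t \<longleftrightarrow> pval x \<le> t"
proof (cases "x \<in> unit_cube")
  case False
  then show ?thesis using t by (simp add: Dset_def Gam_def pval_def)
next
  case x: True
  show ?thesis
  proof (cases "{u. 0 \<le> u \<and> hfun g u \<le> t} = {}")
    case True
    then have "{ereal u |u. 0 \<le> u \<and> hfun g u \<le> t} = {}" by auto
    then have "hstar g t = \<infinity>" by (simp only: hstar_def) (simp add: top_ereal_def)
    \<comment> \<open>\<open>g x\<close> is itself a candidate level, so if none qualifies then
      \<open>h (g x)\<close> exceeds \<open>t\<close>, in agreement with an empty region.\<close>
    moreover have "\<not> hfun g (g x) \<le> t" using True g_nonneg by auto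
    ultimately show ?thesis using x by (simp add: Dset_def Gam_def pval_def)
  next
    case False
    note l = lev[OF False t(2)]
    have "lev t \<le> g x \<longleftrightarrow> hfun g (g x) \<le> t"
      using l(3)[of "g x"] g_nonneg hfun_antimono[of "lev t" "g x"] l(2) by auto
    then show ?thesis using x by (simp add: Dset_def Gam_def pval_def l(4))
  qed
qed

lemma prob_pval_le:
  assumes t: "0 \<le> t" "t \<le> 1"
  shows "U.prob {x. pval x \<le> t} = t"
proof -
  have eq: "U.prob {x. pval x \<le> t} = U.prob {x. hfun g (g x) \<le> t}"
  proof (rule U.finite_measure_eq_AE)
    note hfun_g_measurable [measurable]
    show "{x. pval x \<le> t} \<in> U.events" "{x. hfun g (g x) \<le> t} \<in> U.events" by measurable
    show "AE x in unif_cube. x \<in> {x. pval x \<le> t} \<longleftrightarrow> x \<in> {x. hfun g (g x) \<le> t}"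
      using AE_unif_cube by eventually_elim (auto simp: pval_def)
  qed
  show ?thesis
  proof (cases "{u. 0 \<le> u \<and> hfun g u \<le> t} = {}")
    case True
    then have "t = 0" using ex_level[of t] t by linarith
    moreover have "{x. hfun g (g x) \<le> t} = {}" using True g_nonneg by auto
    ultimately show ?thesis using eq by simp
  next
    case False
    note l = lev[OF False t(2)]
    have "{x. hfun g (g x) \<le> t} = {x. lev t \<le> g x}"
      using l(3) g_nonneg hfun_antimono l(2) by fastforce
    then show ?thesis using eq l(2) by (simp add: hfun_eq)
  qed
qed

lemma measure_Dset:
  assumes t: "0 \<le> t" "t \<le> 1"
  shows "measure lborel (Dset g t) = t"
proof -
  have "Dset g t = {x. pval x \<le> t} \<inter> unit_cube"
    unfolding set_eq_iff Dset_iff[OF t] using t by (simp add: pval_def)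
  moreover have "{x. pval x \<le> t} \<in> sets borel" by measurable
  ultimately show ?thesis
    using prob_pval_le[OF t] by (simp add: measure_def emeasure_unif_cube)
qed

lemma Dset_nested:
  "Dset g 1 = unit_cube"
  "0 \<le> s \<Longrightarrow> s < t \<Longrightarrow> t \<le> 1 \<Longrightarrow> Dset g s \<subseteq> Dset g t"
  "0 \<le> t \<Longrightarrow> t < 1 \<Longrightarrow> Dset g t = (\<Inter>s\<in>{t<..1}. Dset g s)"
proof -
  show "Dset g 1 = unit_cube"
    using hfun_le_1 by (auto simp: Dset_iff pval_def split: if_splits)
  show "Dset g s \<subseteq> Dset g t" if "0 \<le> s" "s < t" "t \<le> 1"
    using that by (auto simp: Dset_iff)
  assume t: "0 \<le> t" "t < 1"
  have "pval x \<le> t" if "\<And>s. t < s \<Longrightarrow> s \<le> 1 \<Longrightarrow> pval x \<le> s" for x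
    using t(2) that by (intro dense_ge_bounded[of t 1]) auto
  then show "Dset g t = (\<Inter>s\<in>{t<..1}. Dset g s)"
    using t by (fastforce simp: Dset_iff)
qed

section \<open>The alternative distribution function of the p-values\<close>

lemma g_integrable: "integrable unif_cube g" and g_integral: "(\<integral>x. g x \<partial>unif_cube) = 1"
proof -
  have 1: "(\<integral>\<^sup>+x. ennreal (g x) \<partial>unif_cube) = 1"
    using g_int by (simp add: nn_integral_density mult.commute)
  then show "integrable unif_cube g"
    by (intro integrableI_nonneg) (auto simp: g_nonneg)
  show "(\<integral>x. g x \<partial>unif_cube) = 1"
    by (subst integral_eq_nn_integral) (auto simp: g_nonneg 1)
qed

lemma g_indicator_integrable: "A \<in> sets borel \<Longrightarrow> integrable unif_cube (\<lambda>x. g x * indicator A x)"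
  using g_integrable by (intro integrable_real_mult_indicator) auto

text \<open>The power of the likelihood ratio test as a function of its level (its ROC curve). Its
  concavity enters through the tangent lines of \<open>G_tangent\<close>.\<close>

definition G :: "real \<Rightarrow> real" where
  "G t = (\<integral>x. g x * indicator {x. pval x \<le> t} x \<partial>unif_cube)"

lemma pval_sets [measurable]: "{x. pval x \<le> t} \<in> sets borel"
  by measurable

lemma G_mono: "s \<le> t \<Longrightarrow> G s \<le> G t"
  unfolding G_def
  by (intro integral_mono g_indicator_integrable) (auto simp: g_nonneg indicator_def)

lemma G_1: "G 1 = 1"
proof -
  have "G 1 = (\<integral>x. g x \<partial>unif_cube)"
    unfolding G_def
  proof (rule integral_cong_AE)
    show "AE x in unif_cube. g x * indicator {x. pval x \<le> 1} x = g x"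
      using AE_unif_cube by eventually_elim (auto simp: pval_def indicator_def hfun_le_1)
  qed measurable
  then show ?thesis by (simp add: g_integral)
qed

text \<open>The positive part of \<open>g - lev t\<close> lives on \<open>D_t\<close>. Its integral
  is the largest value that the integral of \<open>g - lev t\<close> over any set can take, and it
  is the constant behind both \<open>G_tangent\<close> and \<open>neyman_pearson\<close>.\<close>

lemma excess_integral:
  assumes t: "0 < t" "t \<le> 1"
  shows "(\<integral>x. max 0 (g x - lev t) \<partial>unif_cube) = G t - lev t * t"
proof -
  note l = lev_pos[OF t]
  have *: "lev t \<le> g x \<longleftrightarrow> hfun g (g x) \<le> t" for x
    using l(3)[of "g x"] g_nonneg[of x] hfun_antimono[of "lev t" "g x"] l(2) by auto
  have i: "integrable unif_cube (\<lambda>x. lev t * indicator {x. pval x \<le> t} x)"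
    by (auto simp: U.emeasure_eq_measure)
  have "(\<integral>x. max 0 (g x - lev t) \<partial>unif_cube)
      = (\<integral>x. g x * indicator {x. pval x \<le> t} x - lev t * indicator {x. pval x \<le> t} x \<partial>unif_cube)"
  proof (rule integral_cong_AE)
    show "AE x in unif_cube. max 0 (g x - lev t)
        = g x * indicator {x. pval x \<le> t} x - lev t * indicator {x. pval x \<le> t} x"
      using AE_unif_cube by eventually_elim (auto simp: pval_def indicator_def *[symmetric])
  qed measurable
  also have "\<dots> = G t - lev t * t"
    unfolding G_def using i t
    by (subst Bochner_Integration.integral_diff) (auto simp: g_indicator_integrable prob_pval_le)
  finally show ?thesis .
qed

text \<open>Over any region, in particular the one at \<open>s\<close>, the integral of
  \<open>g - lev t\<close> is at most that of its positive part, and the region at \<open>t\<close>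
  attains this. So \<open>lev t\<close> is the slope of a supporting line at
  \<open>t\<close>.\<close>

lemma G_tangent:
  assumes t: "0 < t" "t \<le> 1" and s: "0 \<le> s" "s \<le> 1"
  shows "G s \<le> G t + lev t * (s - t)"
proof -
  have i: "integrable unif_cube (\<lambda>x. lev t * indicator {x. pval x \<le> s} x)"
    by (auto simp: U.emeasure_eq_measure)
  have "G s - lev t * s = (\<integral>x. g x * indicator {x. pval x \<le> s} x - lev t * indicator {x. pval x \<le> s} x \<partial>unif_cube)"
    unfolding G_def using i s
    by (subst Bochner_Integration.integral_diff) (auto simp: g_indicator_integrable prob_pval_le)
  also have "\<dots> \<le> (\<integral>x. max 0 (g x - lev t) \<partial>unif_cube)"
    using g_integrable i
    by (intro integral_mono Bochner_Integration.integrable_diff g_indicator_integrable integrable_max) (auto simp: indicator_def)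
  finally show ?thesis by (simp add: excess_integral[OF t] algebra_simps)
qed

text \<open>Equality would force \<open>g = lev t\<close> almost everywhere on \<open>D_t\<close>,
  making a level set of mass \<open>t > 0\<close>. This strictness is what later separates the roots
  of \<open>t = \<alpha> * H t\<close>.\<close>

lemma G_gt:
  assumes t: "0 < t" "t \<le> 1"
  shows "lev t * t < G t"
proof -
  note l = lev_pos[OF t]
  have i: "integrable unif_cube (\<lambda>x. max 0 (g x - lev t))"
    using g_integrable by (intro integrable_max) auto
  have "0 < (\<integral>x. max 0 (g x - lev t) \<partial>unif_cube)"
  proof (rule ccontr)
    assume "\<not> ?thesis"
    then have "(\<integral>x. max 0 (g x - lev t) \<partial>unif_cube) = 0"
      by (simp add: not_less antisym integral_nonneg_AE)
    then have "AE x in unif_cube. max 0 (g x - lev t) = 0"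
      by (subst (asm) integral_nonneg_eq_0_iff_AE[OF i]) auto
    then have "U.prob {x. lev t \<le> g x} = U.prob {x. g x = lev t}"
      by (intro U.finite_measure_eq_AE) (auto simp: max_def split: if_splits)
    then show False using l t by (simp add: hfun_eq prob_level_set)
  qed
  then show ?thesis by (simp add: excess_integral[OF t])
qed

text \<open>\<open>g\<close> is split at a height \<open>n\<close> above which it integrates to less
  than \<open>\<epsilon>\<close>; the part below contributes at most \<open>n\<close> times the
  measure of the set.\<close>

lemma G_abs_cont:
  assumes \<epsilon>: "0 < \<epsilon>"
  shows "\<exists>C\<ge>0. \<forall>A\<in>sets borel. (\<integral>x. g x * indicator A x \<partial>unif_cube) \<le> \<epsilon> + C * U.prob A"
proof -
  have lim: "(\<lambda>n. \<integral>x. max 0 (g x - real n) \<partial>unif_cube) \<longlonglongrightarrow> (\<integral>x. 0 \<partial>(unif_cube :: (real, 'k) vec measure))"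
  proof (rule integral_dominated_convergence[where w = g])
    show "AE x in unif_cube. (\<lambda>n. max 0 (g x - real n)) \<longlonglongrightarrow> 0"
    proof (rule AE_I2, rule tendsto_eventually)
      fix x
      obtain N :: nat where "g x \<le> N" using real_arch_simple by blast
      then show "\<forall>\<^sub>F n in sequentially. max 0 (g x - real n) = 0"
        by (auto simp: eventually_sequentially intro!: exI[of _ N] max_absorb1)
    qed
  qed (use g_nonneg in \<open>auto intro: g_integrable\<close>)
  then obtain n where n: "(\<integral>x. max 0 (g x - real n) \<partial>unif_cube) < \<epsilon>"
    using order_tendstoD(2)[OF lim, of \<epsilon>] \<epsilon> by (auto simp: eventually_sequentially)
  show ?thesis
  proof (intro exI[of _ "real n"] conjI ballI)
    fix A :: "(real, 'k) vec set" assume A [measurable]: "A \<in> sets borel"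
    have i1: "integrable unif_cube (\<lambda>x. max 0 (g x - real n))"
      using g_integrable by (intro integrable_max) auto
    have i2: "integrable unif_cube (\<lambda>x. real n * indicator A x)"
      by (auto simp: U.emeasure_eq_measure)
    have "(\<integral>x. g x * indicator A x \<partial>unif_cube) \<le> (\<integral>x. max 0 (g x - real n) + real n * indicator A x \<partial>unif_cube)"
      using i1 i2 by (intro integral_mono g_indicator_integrable) (auto simp: indicator_def)
    also have "\<dots> \<le> \<epsilon> + real n * U.prob A"
      using n i1 i2 by (subst Bochner_Integration.integral_add) auto
    finally show "(\<integral>x. g x * indicator A x \<partial>unif_cube) \<le> \<epsilon> + real n * U.prob A" .
  qed simp
qed

lemma G_diff_small:
  assumes \<epsilon>: "0 < \<epsilon>"
  shows "\<exists>C\<ge>0. \<forall>s t. 0 \<le> s \<longrightarrow> s \<le> t \<longrightarrow> t \<le> 1 \<longrightarrow> G t - G s \<le> \<epsilon> + C * (t - s)"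
proof -
  obtain C where C: "C \<ge> 0" "\<And>A. A \<in> sets borel \<Longrightarrow> (\<integral>x. g x * indicator A x \<partial>unif_cube) \<le> \<epsilon> + C * U.prob A"
    using G_abs_cont[OF \<epsilon>] by auto
  have "G t - G s \<le> \<epsilon> + C * (t - s)" if st: "0 \<le> s" "s \<le> t" "t \<le> 1" for s t
  proof -
    let ?A = "{x. pval x \<le> t} - {x. pval x \<le> s}"
    have "G t - G s = (\<integral>x. g x * indicator {x. pval x \<le> t} x - g x * indicator {x. pval x \<le> s} x \<partial>unif_cube)"
      unfolding G_def by (subst Bochner_Integration.integral_diff) (auto simp: g_indicator_integrable)
    also have "\<dots> = (\<integral>x. g x * indicator ?A x \<partial>unif_cube)"
      using st by (intro Bochner_Integration.integral_cong) (auto simp: indicator_def)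
    also have "\<dots> \<le> \<epsilon> + C * U.prob ?A" by (rule C) auto
    also have "U.prob ?A = t - s"
      using st by (subst U.finite_measure_Diff) (auto simp: prob_pval_le)
    finally show ?thesis .
  qed
  with C(1) show ?thesis by blast
qed

lemma G_0: "G 0 = 0"
proof -
  have "AE x in unif_cube. x \<notin> {x. pval x \<le> 0}"
    using prob_pval_le[of 0] by (subst AE_iff_null_sets[symmetric]) (auto simp: null_sets_def U.emeasure_eq_measure)
  then have "G 0 = (\<integral>x. 0 \<partial>(unif_cube :: (real, 'k) vec measure))"
    unfolding G_def by (intro integral_cong_AE) auto
  then show ?thesis by simp
qed

lemma G_cont: "continuous_on {0..1} G"
proof (rule continuous_onI)
  fix t e :: real assume t: "t \<in> {0..1}" and e: "0 < e"
  obtain C where C: "C \<ge> 0" "\<And>s t. 0 \<le> s \<Longrightarrow> s \<le> t \<Longrightarrow> t \<le> 1 \<Longrightarrow> G t - G s \<le> e / 3 + C * (t - s)"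
    using G_diff_small[of "e / 3"] e by auto
  show "\<exists>d>0. \<forall>s\<in>{0..1}. dist s t < d \<longrightarrow> dist (G s) (G t) \<le> e"
  \<comment> \<open>\<open>C\<close> may be 0, hence \<open>C + 1\<close> in the
    denominator.\<close>
  proof (intro exI[of _ "e / (3 * (C + 1))"] conjI ballI impI)
    show "e / (3 * (C + 1)) > 0" using e C(1) by simp
    fix s :: real assume s: "s \<in> {0..1}" "dist s t < e / (3 * (C + 1))"
    have "C * \<bar>t - s\<bar> \<le> (C + 1) * (e / (3 * (C + 1)))"
      using C(1) s by (intro mult_mono) (auto simp: dist_real_def abs_minus_commute)
    also have "\<dots> = e / 3" using C(1) by (simp add: field_simps)
    finally have "C * \<bar>t - s\<bar> \<le> e / 3" .
    then show "dist (G s) (G t) \<le> e"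
      using C(2)[of s t] C(2)[of t s] s(1) t G_mono[of s t] G_mono[of t s] e
      by (cases "s \<le> t") (auto simp: dist_real_def)
  qed
qed

text \<open>The tangent at \<open>t\<close> has slope \<open>lev t < G t / t\<close>, so to the
  right of \<open>t\<close> the curve runs strictly below the ray from the origin through its point
  at \<open>t\<close>. Hence \<open>G t / t\<close> is strictly decreasing.\<close>

lemma G_star_shaped:
  assumes "0 < t" "t < s" "s \<le> 1"
  shows "G s * t < G t * s"
proof -
  have "G s \<le> G t + lev t * (s - t)" using assms by (intro G_tangent) auto
  then have "G s * t \<le> (G t + lev t * (s - t)) * t" using assms by (intro mult_right_mono) auto
  also have "\<dots> = G t * t + (lev t * t) * (s - t)" by (simp add: algebra_simps)
  also have "\<dots> < G t * t + G t * (s - t)"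
    using G_gt[of t] assms by (intro add_strict_left_mono mult_strict_right_mono) auto
  finally show ?thesis by (simp add: algebra_simps)
qed

end

section \<open>The mixture distribution function and the limiting threshold\<close>

locale mixture = cube_density +
  fixes a :: real
  assumes a: "0 < a" "a < 1"
begin

definition H :: "real \<Rightarrow> real" where
  "H t = (1 - a) * t + a * G t"

lemma H_0: "H 0 = 0" and H_1: "H 1 = 1"
  by (simp_all add: H_def G_0 G_1)

lemma H_strict_mono: "s < t \<Longrightarrow> H s < H t"
  unfolding H_def using a G_mono[of s t] by (intro add_less_le_mono mult_strict_left_mono mult_left_mono) auto

lemma H_mono: "s \<le> t \<Longrightarrow> H s \<le> H t"
  using H_strict_mono[of s t] by (cases "s = t") auto

lemma H_le_iff: "H s \<le> H t \<longleftrightarrow> s \<le> t"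
  using H_strict_mono[of t s] H_mono[of s t] by (cases "s \<le> t") auto

lemma H_cont: "continuous_on {0..1} H"
  unfolding H_def by (intro continuous_intros G_cont)

lemma H_star_shaped:
  assumes "0 < t" "t < s" "s \<le> 1"
  shows "H s * t < H t * s"
proof -
  have "a * (G s * t) < a * (G t * s)" using a G_star_shaped[OF assms] by simp
  then show ?thesis by (simp add: H_def algebra_simps)
qed

definition tstar :: "real \<Rightarrow> real" where
  "tstar \<alpha> = Sup {t \<in> {0..1}. t \<le> \<alpha> * H t}"

text \<open>The two strict inequalities make the empirical threshold converge: a uniformly small
  perturbation of \<open>H\<close> cannot move its last crossing far. Above
  \<open>tstar \<alpha>\<close> strictness is maximality, below it is star-shapedness.\<close>

lemma tstar:
  assumes \<alpha>: "0 < \<alpha>" "\<alpha> < 1"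
  shows "0 \<le> tstar \<alpha>" "tstar \<alpha> < 1" "tstar \<alpha> \<le> \<alpha> * H (tstar \<alpha>)"
    and "\<And>t. tstar \<alpha> < t \<Longrightarrow> t \<le> 1 \<Longrightarrow> \<alpha> * H t < t"
    and "\<And>t. 0 < t \<Longrightarrow> t < tstar \<alpha> \<Longrightarrow> t < \<alpha> * H t"
proof -
  let ?S = "{t \<in> {0..1}. t \<le> \<alpha> * H t}"
  have ne: "?S \<noteq> {}" by (auto intro!: exI[of _ 0] simp: H_0)
  have bdd: "bdd_above ?S" by (auto intro: bdd_aboveI[of _ 1])
  have "closed ?S"
    by (intro continuous_on_closed_Collect_le continuous_intros H_cont)
  then have in_S: "tstar \<alpha> \<in> ?S"
    unfolding tstar_def by (rule closed_contains_Sup[OF ne bdd])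
  then show "0 \<le> tstar \<alpha>" "tstar \<alpha> \<le> \<alpha> * H (tstar \<alpha>)" by auto
  show "tstar \<alpha> < 1"
    using in_S \<alpha> by (cases "tstar \<alpha> = 1") (auto simp: H_1)
  show above: "\<alpha> * H t < t" if "tstar \<alpha> < t" "t \<le> 1" for t
  proof (rule ccontr)
    assume "\<not> \<alpha> * H t < t"
    then have "t \<in> ?S" using that in_S by auto
    then have "t \<le> tstar \<alpha>" unfolding tstar_def by (intro cSup_upper bdd)
    with that show False by simp
  qed
  show "t < \<alpha> * H t" if t: "0 < t" "t < tstar \<alpha>" for t
  proof -
    have "tstar \<alpha> * t \<le> \<alpha> * H (tstar \<alpha>) * t" using in_S t by (intro mult_right_mono) auto
    also have "\<dots> < \<alpha> * H t * tstar \<alpha>"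
      using H_star_shaped[of t "tstar \<alpha>"] t in_S \<alpha> by (simp add: mult.assoc)
    finally show ?thesis using t by (simp add: mult.commute)
  qed
qed

lemma tstar_ge: "0 \<le> t \<Longrightarrow> t \<le> 1 \<Longrightarrow> t \<le> \<alpha> * H t \<Longrightarrow> t \<le> tstar \<alpha>"
  unfolding tstar_def by (intro cSup_upper) (auto intro: bdd_aboveI[of _ 1])

text \<open>On \<open>D_t\<close>, a set of measure \<open>t\<close>, the mixture density is at
  least \<open>1 - a + a * lev t\<close>.\<close>

lemma H_ge_lev:
  assumes "0 < t" "t \<le> 1"
  shows "(1 - a + a * lev t) * t \<le> H t"
proof -
  have "a * (lev t * t) \<le> a * G t" using G_gt[OF assms] a by (intro mult_left_mono) auto
  then show ?thesis by (simp add: H_def algebra_simps)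
qed

abbreviation sup_g :: ereal where
  "sup_g \<equiv> esssup (restrict_space lborel unit_cube) (\<lambda>x. ereal (g x))"

lemma AE_restrict_cube: "(AE x in restrict_space lborel unit_cube. P x) \<longleftrightarrow> (AE x in unif_cube. P x)"
  by (subst AE_restrict_space_iff, simp, subst AE_density) (auto simp: indicator_def)

lemma g_le_sup: "AE x in unif_cube. ereal (g x) \<le> sup_g"
  unfolding AE_restrict_cube[symmetric] by (rule esssup_AE)

lemma sup_g_le: "AE x in unif_cube. g x \<le> c \<Longrightarrow> sup_g \<le> ereal c"
  by (intro esssup_I) (auto simp: AE_restrict_cube intro!: measurable_restrict_space1)

lemma sup_g_ge_1: "1 \<le> sup_g"
proof (cases sup_g)
  case (real r)
  have "(\<integral>x. g x \<partial>unif_cube) \<le> (\<integral>x. r \<partial>(unif_cube :: (real, 'a) vec measure))"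
    using g_le_sup real by (intro integral_mono_AE g_integrable) auto
  then show ?thesis using real g_integral U.prob_space by (simp add: one_ereal_def)
next
  case MInf
  then have "AE x in unif_cube. False" using g_le_sup by simp
  then show ?thesis using U.AE_const[of False] by blast
qed auto

lemma AE_g_less:
  assumes "hfun g u = 0"
  shows "AE x in unif_cube. g x < u"
proof -
  have "AE x in unif_cube. x \<notin> {x. u \<le> g x}"
    using assms by (subst AE_iff_null_sets[symmetric]) (auto simp: hfun_eq null_sets_def U.emeasure_eq_measure)
  then show ?thesis by (simp add: not_le)
qed

text \<open>\<open>1 / alpha_star a g\<close> is the essential supremum of the mixture density. If
  it exceeds \<open>1 / \<alpha>\<close>, the density must do so already at some level reached on a
  set of positive measure.\<close>

lemma alpha_star_less:
  assumes \<alpha>: "0 < \<alpha>" "\<alpha> < 1" and less: "alpha_star a g < \<alpha>"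
  shows "\<exists>u\<ge>0. 0 < hfun g u \<and> 1 / \<alpha> < 1 - a + a * u"
proof (rule ccontr)
  assume neg: "\<not> ?thesis"
  \<comment> \<open>The level at which the mixture density \<open>1 - a + a * c\<close> equals
    \<open>1 / \<alpha>\<close>.\<close>
  define c where "c = (1 / \<alpha> - (1 - a)) / a"
  have "1 / \<alpha> > 1" using \<alpha> by simp
  then have c: "0 < c" using a by (simp add: c_def)
  have "sup_g \<le> ereal c"
  proof (rule ereal_le_epsilon2)
    fix e :: real assume e: "0 < e"
    have "1 / \<alpha> < 1 - a + a * (c + e)" using a e by (simp add: c_def field_simps)
    then have "\<not> 0 < hfun g (c + e)"
      using neg c e by auto
    then have "hfun g (c + e) = 0"
      using hfun_nonneg[of "c + e"] by simp
    from AE_g_less[OF this] have "AE x in unif_cube. g x \<le> c + e" by eventually_elim simp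
    then show "sup_g \<le> ereal c + ereal e" using sup_g_le by simp
  qed
  moreover obtain r where r: "sup_g = ereal r" "1 \<le> r"
    using sup_g_ge_1 calculation by (cases sup_g) auto
  ultimately have "1 - a + a * r \<le> 1 - a + a * c" using a by simp
  also have "\<dots> = 1 / \<alpha>" using a by (simp add: c_def)
  finally have le: "1 - a + a * r \<le> 1 / \<alpha>" .
  have pos: "0 < 1 - a + a * r" using a r by (simp add: add_pos_pos)
  have "alpha_star a g = 1 / (1 - a + a * r)"
    using pos by (simp add: alpha_star_def r one_ereal_def)
  also have "\<dots> \<ge> 1 / (1 / \<alpha>)" using le pos \<alpha> by (intro divide_left_mono) auto
  finally have "\<alpha> \<le> alpha_star a g" by simp
  with less show False by simp
qed

text \<open>\<open>L\<close> is the slope of \<open>H\<close> at 0. It is an upper bound because the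
  mixture density is at most \<open>L\<close> almost everywhere, and it is attained in the limit
  because small regions \<open>D_t\<close> only contain points where \<open>g\<close> is close to
  its supremum.\<close>

lemma alpha_less_star:
  assumes "0 < \<alpha>" "\<alpha> < alpha_star a g"
  obtains L where "0 < L" "alpha_star a g = 1 / L" "\<And>t. 0 \<le> t \<Longrightarrow> t \<le> 1 \<Longrightarrow> H t \<le> L * t"
    "\<And>\<epsilon>. 0 < \<epsilon> \<Longrightarrow> \<exists>t0>0. t0 \<le> 1 \<and> (\<forall>t. 0 \<le> t \<longrightarrow> t \<le> t0 \<longrightarrow> (L - \<epsilon>) * t \<le> H t)"
proof -
  have ne: "sup_g \<noteq> \<infinity>"
    using assms a by (auto simp: alpha_star_def)
  then obtain r where r: "sup_g = ereal r" "1 \<le> r"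
    using sup_g_ge_1 by (cases sup_g) auto
  define L where "L = 1 - a + a * r"
  have L: "0 < L" using a r by (simp add: L_def add_pos_pos)
  have 1: "alpha_star a g = 1 / L"
    using L by (simp add: alpha_star_def r one_ereal_def L_def)
  have 2: "H t \<le> L * t" if t: "0 \<le> t" "t \<le> 1" for t
  proof -
    have "G t \<le> (\<integral>x. r * indicator {x. pval x \<le> t} x \<partial>unif_cube)"
      unfolding G_def
    proof (rule integral_mono_AE)
      show "AE x in unif_cube. g x * indicator {x. pval x \<le> t} x \<le> r * indicator {x. pval x \<le> t} x"
        using g_le_sup unfolding r by eventually_elim (simp add: indicator_def)
    qed (auto intro: g_indicator_integrable simp: U.emeasure_eq_measure)
    then have "G t \<le> r * t" using t by (simp add: prob_pval_le)
    then have "a * G t \<le> a * (r * t)" using a by (intro mult_left_mono) auto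
    then show ?thesis by (simp add: H_def L_def algebra_simps)
  qed
  have 3: "\<exists>t0>0. t0 \<le> 1 \<and> (\<forall>t. 0 \<le> t \<longrightarrow> t \<le> t0 \<longrightarrow> (L - \<epsilon>) * t \<le> H t)" if \<epsilon>: "0 < \<epsilon>" for \<epsilon>
  proof -
    \<comment> \<open>Chosen so that \<open>1 - a + a * u \<ge> L - \<epsilon>\<close>; the maximum
      with 0 keeps \<open>u\<close> a legitimate level.\<close>
    define u where "u = max 0 (r - \<epsilon> / a)"
    have u: "0 \<le> u" "u < r" using r \<epsilon> a by (auto simp: u_def)
    have h: "0 < hfun g u"
    proof (rule ccontr)
      assume "\<not> 0 < hfun g u"
      then have "AE x in unif_cube. g x \<le> u" using AE_g_less[of u] hfun_nonneg[of u] by (auto elim: eventually_mono)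
      from sup_g_le[OF this] u r show False by simp
    qed
    \<comment> \<open>Halving puts \<open>t\<close> strictly below \<open>hfun g u\<close>, which
      forces \<open>u \<le> lev t\<close>.\<close>
    have "(L - \<epsilon>) * t \<le> H t" if t: "0 \<le> t" "t \<le> hfun g u / 2" for t
    proof (cases "t = 0")
      case False
      then have t': "0 < t" "t \<le> 1" using t hfun_le_1[of u] by auto
      have "u \<le> lev t"
      proof (rule ccontr)
        assume "\<not> u \<le> lev t"
        then have "hfun g u \<le> t" using hfun_antimono[of "lev t" u] lev_pos(2)[OF t'] by simp
        with t h show False by simp
      qed
      have "a * (\<epsilon> / a) = \<epsilon>" using a by simp
      then have "L - \<epsilon> = 1 - a + a * (r - \<epsilon> / a)" by (simp only: L_def right_diff_distrib)
      also have "\<dots> \<le> 1 - a + a * lev t"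
        using a \<open>u \<le> lev t\<close> by (intro add_left_mono mult_left_mono) (auto simp: u_def)
      finally have "(L - \<epsilon>) * t \<le> (1 - a + a * lev t) * t" using t by (intro mult_right_mono)
      then show ?thesis using H_ge_lev[OF t'] by simp
    qed (simp add: H_0)
    then show ?thesis using h hfun_le_1[of u] by (intro exI[of _ "hfun g u / 2"]) auto
  qed
  show thesis by (rule that[OF L 1 2 3])
qed

text \<open>A small region \<open>D_t\<close> on which the mixture density exceeds
  \<open>1 / \<alpha>\<close> has \<open>H t \<ge> t / \<alpha>\<close>, so its \<open>t\<close> is
  a lower bound for the last crossing.\<close>

lemma tstar_pos:
  assumes \<alpha>: "0 < \<alpha>" "\<alpha> < 1" and less: "alpha_star a g < \<alpha>"
  shows "0 < tstar \<alpha>"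
proof -
  obtain u where u: "0 \<le> u" "0 < hfun g u" "1 / \<alpha> < 1 - a + a * u"
    using alpha_star_less[OF assms] by auto
  define t where "t = hfun g u / 2"
  have t: "0 < t" "t \<le> 1" using u hfun_le_1[of u] by (auto simp: t_def)
  have "u \<le> lev t"
  proof (rule ccontr)
    assume "\<not> u \<le> lev t"
    then have "hfun g u \<le> t" using hfun_antimono[of "lev t" u] lev_pos(2)[OF t] by simp
    with u show False by (simp add: t_def)
  qed
  then have "1 / \<alpha> < 1 - a + a * lev t" using u(3) a by (smt (verit) mult_left_mono)
  then have "t * (1 / \<alpha>) \<le> (1 - a + a * lev t) * t"
    using t by (subst mult.commute) (intro mult_right_mono, auto)
  also have "\<dots> \<le> H t" by (rule H_ge_lev[OF t])
  finally have "t \<le> \<alpha> * H t" using \<alpha> by (simp add: field_simps)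
  then have "t \<le> tstar \<alpha>" using t by (intro tstar_ge) auto
  then show ?thesis using t by simp
qed

lemma tstar_zero:
  assumes \<alpha>: "0 < \<alpha>" "\<alpha> < 1" and less: "\<alpha> < alpha_star a g"
  shows "tstar \<alpha> = 0"
proof (rule ccontr)
  assume "tstar \<alpha> \<noteq> 0"
  then have t: "0 < tstar \<alpha>" using tstar(1)[OF \<alpha>] by simp
  obtain L where L: "0 < L" "alpha_star a g = 1 / L" "\<And>t. 0 \<le> t \<Longrightarrow> t \<le> 1 \<Longrightarrow> H t \<le> L * t"
    using alpha_less_star[OF \<alpha>(1) less] by metis
  have "tstar \<alpha> \<le> \<alpha> * (L * tstar \<alpha>)"
    using tstar[OF \<alpha>] L(3)[of "tstar \<alpha>"] \<alpha> t by (intro order_trans[OF tstar(3)[OF \<alpha>]] mult_left_mono) auto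
  then have "1 \<le> \<alpha> * L" using t by (simp add: mult.assoc[symmetric])
  moreover have "\<alpha> * L < 1" using less L by (simp add: field_simps)
  ultimately show False by simp
qed

lemma G_pos: "0 < t \<Longrightarrow> t \<le> 1 \<Longrightarrow> 0 < G t"
  using G_gt[of t] lev_pos(1)[of t] mult_nonneg_nonneg[of "lev t" t] by linarith

end

section \<open>The Benjamini--Hochberg procedure\<close>

definition count_le :: "nat \<Rightarrow> (nat \<Rightarrow> real) \<Rightarrow> real \<Rightarrow> nat" where
  "count_le n p t = card {j \<in> {..<n}. p j \<le> t}"

text \<open>\<open>R \<or> 1\<close> for the number \<open>R\<close> of rejections, as
  \<open>card_BH_reject\<close> shows. The clause \<open>r = 1\<close> mirrors the maximum with 1 in
  the threshold: \<open>\<alpha> / n\<close> is always admissible, whether or not a p-value lies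
  below it.\<close>

definition bh_rank :: "real \<Rightarrow> nat \<Rightarrow> (nat \<Rightarrow> real) \<Rightarrow> nat" where
  "bh_rank \<alpha> n p = Max {r \<in> {1..n}. r = 1 \<or> r \<le> count_le n p (\<alpha> * real r / real n)}"

lemma count_le_mono: "s \<le> t \<Longrightarrow> count_le n p s \<le> count_le n p t"
  unfolding count_le_def by (intro card_mono) auto

lemma count_le_bound: "count_le n p t \<le> n"
  unfolding count_le_def by (rule order_trans[OF card_mono[of "{..<n}"]]) auto

lemma bh_rank_in:
  assumes "1 \<le> n"
  shows "bh_rank \<alpha> n p \<in> {1..n}"
    and "bh_rank \<alpha> n p = 1 \<or> bh_rank \<alpha> n p \<le> count_le n p (\<alpha> * bh_rank \<alpha> n p / n)"
proof -
  have "bh_rank \<alpha> n p \<in> {r \<in> {1..n}. r = 1 \<or> r \<le> count_le n p (\<alpha> * real r / real n)}"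
    unfolding bh_rank_def using assms by (intro Max_in) auto
  then show "bh_rank \<alpha> n p \<in> {1..n}"
    "bh_rank \<alpha> n p = 1 \<or> bh_rank \<alpha> n p \<le> count_le n p (\<alpha> * bh_rank \<alpha> n p / n)" by auto
qed

lemma bh_rank_ge: "r \<in> {1..n} \<Longrightarrow> r \<le> count_le n p (\<alpha> * r / n) \<Longrightarrow> r \<le> bh_rank \<alpha> n p"
  unfolding bh_rank_def by (intro Max_ge) auto

text \<open>An admissible \<open>t\<close> is dominated by a grid point
  \<open>\<alpha> * r / n\<close>, and raising \<open>t\<close> to it can only increase the count,
  so the grid point is admissible too. Hence the supremum is attained on the grid.\<close>

lemma bh_level:
  assumes n: "1 \<le> n" and \<alpha>: "0 < \<alpha>" and t: "t / \<alpha> \<le> max (real (count_le n p t)) 1 / n"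
  shows "t \<le> \<alpha> * bh_rank \<alpha> n p / n"
proof -
  define r where "r = max (count_le n p t) 1"
  have tr: "t \<le> \<alpha> * r / n"
    using t \<alpha> n by (simp add: r_def field_simps of_nat_max)
  have r: "r \<in> {1..n}" using n count_le_bound[of n p t] by (auto simp: r_def)
  have "r \<le> bh_rank \<alpha> n p"
  proof (cases "r = 1")
    case True
    then show ?thesis using bh_rank_in(1)[OF n] by simp
  next
    case False
    then have "r = count_le n p t" by (auto simp: r_def max_def split: if_splits)
    also have "\<dots> \<le> count_le n p (\<alpha> * r / n)" by (rule count_le_mono[OF tr])
    finally show ?thesis using r by (intro bh_rank_ge)
  qed
  then have "\<alpha> * r / n \<le> \<alpha> * bh_rank \<alpha> n p / n"
    using \<alpha> by (intro divide_right_mono mult_left_mono) auto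
  with tr show ?thesis by simp
qed

lemma bh_threshold:
  assumes n: "1 \<le> n" and \<alpha>: "0 < \<alpha>" "\<alpha> \<le> 1"
  shows "Sup {t \<in> {0..1}. t / \<alpha> \<le> max (real (count_le n p t)) 1 / n} = \<alpha> * bh_rank \<alpha> n p / n"
proof (rule cSup_eq_maximum)
  let ?\<rho> = "bh_rank \<alpha> n p"
  have \<rho>: "?\<rho> \<in> {1..n}" by (rule bh_rank_in(1)[OF n])
  have "\<alpha> * ?\<rho> \<le> 1 * real n" using \<rho> \<alpha> by (intro mult_mono) auto
  moreover have "real ?\<rho> \<le> max (real (count_le n p (\<alpha> * ?\<rho> / n))) 1"
    using bh_rank_in(2)[OF n, of \<alpha> p] by auto
  ultimately show "\<alpha> * ?\<rho> / n \<in> {t \<in> {0..1}. t / \<alpha> \<le> max (real (count_le n p t)) 1 / n}"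
    using n \<alpha> by (auto simp: divide_le_eq_1 intro!: divide_right_mono)
qed (use bh_level[OF n \<alpha>(1)] in auto)

lemma BH_reject_eq:
  assumes "1 \<le> n" "0 < \<alpha>" "\<alpha> \<le> 1"
  shows "BH_reject \<alpha> n p = {i \<in> {..<n}. p i \<le> \<alpha> * bh_rank \<alpha> n p / n}"
  using bh_threshold[OF assms, of p] by (simp add: BH_reject_def count_le_def)

lemma card_BH_reject:
  assumes n: "1 \<le> n" and \<alpha>: "0 < \<alpha>" "\<alpha> \<le> 1"
  shows "max (card (BH_reject \<alpha> n p)) 1 = bh_rank \<alpha> n p"
proof -
  let ?\<rho> = "bh_rank \<alpha> n p" and ?c = "count_le n p (\<alpha> * bh_rank \<alpha> n p / n)"
  have \<rho>: "?\<rho> \<in> {1..n}" by (rule bh_rank_in(1)[OF n])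
  have "card (BH_reject \<alpha> n p) = ?c"
    by (simp add: BH_reject_eq[OF assms] count_le_def)
  moreover have "?\<rho> \<le> max ?c 1" using bh_rank_in(2)[OF n, of \<alpha> p] by auto
  \<comment> \<open>More than \<open>?\<rho>\<close> p-values below the threshold would make their
    number an admissible rank larger than the maximal one.\<close>
  moreover have "?c \<le> ?\<rho>"
  proof (rule ccontr)
    assume less: "\<not> ?c \<le> ?\<rho>"
    then have "\<alpha> * ?\<rho> / n \<le> \<alpha> * ?c / n"
      using \<alpha> by (intro divide_right_mono mult_left_mono) auto
    then have "?c \<le> count_le n p (\<alpha> * ?c / n)" by (rule count_le_mono)
    then have "?c \<le> ?\<rho>" using less \<rho> count_le_bound[of n p] by (intro bh_rank_ge) auto
    with less show False by simp
  qed
  ultimately show ?thesis using \<rho> by auto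
qed

text \<open>Rank 1 also stands for no rejection at all; the difference is whether it is backed by a
  p-value. In this form, rejecting something is monotone in the counts and can be compared across
  scales and levels.\<close>

lemma BH_reject_nonempty_iff:
  assumes n: "1 \<le> n" and \<alpha>: "0 < \<alpha>" "\<alpha> \<le> 1"
  shows "BH_reject \<alpha> n p \<noteq> {} \<longleftrightarrow> (\<exists>r\<in>{1..n}. r \<le> count_le n p (\<alpha> * real r / n))"
proof
  assume ne: "BH_reject \<alpha> n p \<noteq> {}"
  have fin: "finite (BH_reject \<alpha> n p)" by (simp add: BH_reject_def)
  let ?\<rho> = "bh_rank \<alpha> n p"
  have "card (BH_reject \<alpha> n p) \<ge> 1" using ne fin by (simp add: Suc_le_eq card_gt_0_iff)
  then have "?\<rho> = card (BH_reject \<alpha> n p)" using card_BH_reject[OF assms, of p] by simp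
  also have "\<dots> = count_le n p (\<alpha> * ?\<rho> / n)"
    by (simp add: BH_reject_eq[OF assms] count_le_def)
  finally show "\<exists>r\<in>{1..n}. r \<le> count_le n p (\<alpha> * real r / n)"
    using bh_rank_in(1)[OF n] by (metis order_refl)
next
  assume "\<exists>r\<in>{1..n}. r \<le> count_le n p (\<alpha> * real r / n)"
  then obtain r where r: "r \<in> {1..n}" "r \<le> count_le n p (\<alpha> * real r / n)" by blast
  then have "r \<le> bh_rank \<alpha> n p" by (intro bh_rank_ge)
  then have "\<alpha> * r / n \<le> \<alpha> * bh_rank \<alpha> n p / n"
    using \<alpha> by (intro divide_right_mono mult_left_mono) auto
  then have "0 < count_le n p (\<alpha> * bh_rank \<alpha> n p / n)"
    using count_le_mono[of "\<alpha> * r / n" "\<alpha> * bh_rank \<alpha> n p / n" n p] r by auto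
  then show "BH_reject \<alpha> n p \<noteq> {}"
    by (auto simp: BH_reject_eq[OF assms] count_le_def card_gt_0_iff)
qed

text \<open>Setting one p-value to 0 does not change the outcome of the procedure if that hypothesis is
  rejected, and decouples the threshold from this p-value.\<close>

lemma bh_rank_zero_upd:
  fixes p :: "nat \<Rightarrow> real"
  assumes n: "1 \<le> n" and \<alpha>: "0 < \<alpha>" "\<alpha> \<le> 1" and i: "i < n"
  defines "p' \<equiv> p(i := 0)"
  shows "p i \<le> \<alpha> * bh_rank \<alpha> n p / n \<longleftrightarrow> p i \<le> \<alpha> * bh_rank \<alpha> n p' / n"
    and "p i \<le> \<alpha> * bh_rank \<alpha> n p' / n \<Longrightarrow> bh_rank \<alpha> n p' = bh_rank \<alpha> n p"
proof -
  let ?\<rho> = "bh_rank \<alpha> n p" and ?\<rho>' = "bh_rank \<alpha> n p'"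
  have le: "count_le n p t \<le> count_le n p' t" if "0 \<le> t" for t
    unfolding count_le_def using that by (intro card_mono) (auto simp: p'_def)
  have eq: "count_le n p' t = count_le n p t" if "p i \<le> t" "0 \<le> t" for t
    unfolding count_le_def using that by (intro arg_cong[where f = card]) (auto simp: p'_def)
  have "?\<rho> \<le> ?\<rho>'"
  proof (cases "?\<rho> = 1")
    case True
    then show ?thesis using bh_rank_in(1)[OF n, of \<alpha> p'] by simp
  next
    case False
    then have "?\<rho> \<le> count_le n p (\<alpha> * ?\<rho> / n)" using bh_rank_in(2)[OF n, of \<alpha> p] by auto
    also have "\<dots> \<le> count_le n p' (\<alpha> * ?\<rho> / n)" using \<alpha> by (intro le) auto
    finally show ?thesis using bh_rank_in(1)[OF n, of \<alpha> p] by (intro bh_rank_ge)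
  qed
  then have mono: "\<alpha> * ?\<rho> / n \<le> \<alpha> * ?\<rho>' / n"
    using \<alpha> by (intro divide_right_mono mult_left_mono) auto
  show *: "?\<rho>' = ?\<rho>" if "p i \<le> \<alpha> * ?\<rho>' / n"
  proof (rule antisym[OF _ \<open>?\<rho> \<le> ?\<rho>'\<close>])
    show "?\<rho>' \<le> ?\<rho>"
    proof (cases "?\<rho>' = 1")
      case True
      then show ?thesis using bh_rank_in(1)[OF n, of \<alpha> p] by simp
    next
      case False
      then have "?\<rho>' \<le> count_le n p' (\<alpha> * ?\<rho>' / n)" using bh_rank_in(2)[OF n, of \<alpha> p'] by auto
      also have "\<dots> = count_le n p (\<alpha> * ?\<rho>' / n)" using \<alpha> that by (intro eq) auto
      finally show ?thesis using bh_rank_in(1)[OF n, of \<alpha> p'] by (intro bh_rank_ge)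
    qed
  qed
  show "p i \<le> \<alpha> * ?\<rho> / n \<longleftrightarrow> p i \<le> \<alpha> * ?\<rho>' / n"
    using mono * by auto
qed

section \<open>Measurability and exact FDR of the BH procedure\<close>

lemma count_le_measurable [measurable (raw)]:
  assumes [measurable]: "\<And>j. p j \<in> borel_measurable N"
  shows "(\<lambda>\<omega>. count_le n (\<lambda>j. p j \<omega>) t) \<in> measurable N (count_space UNIV)"
  unfolding count_le_def by measurable

lemma bh_rank_measurable [measurable (raw)]:
  assumes [measurable]: "\<And>j. p j \<in> borel_measurable N"
  shows "(\<lambda>\<omega>. bh_rank \<alpha> n (\<lambda>j. p j \<omega>)) \<in> measurable N (count_space UNIV)"
  unfolding bh_rank_def by measurable

lemma BH_reject_subset: "BH_reject \<alpha> n p \<subseteq> {..<n}"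
  by (auto simp: BH_reject_def)

lemma BH_reject_cong:
  assumes "\<And>i. i < n \<Longrightarrow> p i = p' i"
  shows "BH_reject \<alpha> n p = BH_reject \<alpha> n p'"
proof -
  have "{j \<in> {..<n}. p j \<le> t} = {j \<in> {..<n}. p' j \<le> t}" for t using assms by auto
  then show ?thesis using assms by (auto simp: BH_reject_def)
qed

lemma BH_reject_measurable:
  assumes n: "1 \<le> n" and \<alpha>: "0 < \<alpha>" "\<alpha> \<le> 1"
    and p: "\<And>j. j < n \<Longrightarrow> p j \<in> borel_measurable N"
  shows "(\<lambda>\<omega>. BH_reject \<alpha> n (\<lambda>j. p j \<omega>)) \<in> N \<rightarrow>\<^sub>M count_space (Pow {..<n})"
proof -
  \<comment> \<open>\<open>bh_rank_measurable\<close> asks for measurability in every index, so the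
    entries from \<open>n\<close> on are replaced by a constant.\<close>
  define p' where "p' j \<omega> = (if j < n then p j \<omega> else 0)" for j \<omega>
  have [measurable]: "p' j \<in> borel_measurable N" for j
    using p by (cases "j < n") (simp_all add: p'_def[abs_def])
  have "(\<lambda>\<omega>. BH_reject \<alpha> n (\<lambda>j. p j \<omega>)) = (\<lambda>\<omega>. BH_reject \<alpha> n (\<lambda>j. p' j \<omega>))"
    by (intro ext BH_reject_cong) (simp add: p'_def)
  moreover have "(\<lambda>\<omega>. BH_reject \<alpha> n (\<lambda>j. p' j \<omega>)) \<in> N \<rightarrow>\<^sub>M count_space (Pow {..<n})"
  proof (subst measurable_count_space_eq2, simp, intro conjI ballI)
    show "(\<lambda>\<omega>. BH_reject \<alpha> n (\<lambda>j. p' j \<omega>)) \<in> space N \<rightarrow> Pow {..<n}"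
      using BH_reject_subset by auto
    fix D assume "D \<in> Pow {..<n}"
    then have "(\<lambda>\<omega>. BH_reject \<alpha> n (\<lambda>j. p' j \<omega>)) -` {D} \<inter> space N
       = {\<omega> \<in> space N. \<forall>i<n. (p' i \<omega> \<le> \<alpha> * bh_rank \<alpha> n (\<lambda>j. p' j \<omega>) / n) \<longleftrightarrow> i \<in> D}"
      by (auto simp: BH_reject_eq[OF n \<alpha>] set_eq_iff)
    also have "\<dots> \<in> sets N" by measurable
    finally show "(\<lambda>\<omega>. BH_reject \<alpha> n (\<lambda>j. p' j \<omega>)) -` {D} \<inter> space N \<in> sets N" .
  qed
  ultimately show ?thesis by simp
qed

text \<open>The leave-one-out identity: \<open>V / (R \<or> 1)\<close> is the sum over
  \<open>i\<close> and \<open>r\<close> of \<open>1 / r\<close> times the indicators that null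
  \<open>i\<close> is true with p-value at most \<open>\<alpha> * r / n\<close> and that the rank
  computed with that p-value set to 0 is \<open>r\<close>. The two events are independent, the
  factor \<open>r\<close> cancels, and the probabilities of the ranks sum to 1. The law of the
  p-values of false nulls is arbitrary; the constant \<open>c\<close> lets the lemma serve the
  mixture as well as the case of all nulls true.\<close>

lemma (in prob_space) BH_FDR:
  fixes b :: "nat \<Rightarrow> 'a \<Rightarrow> bool" and p :: "nat \<Rightarrow> 'a \<Rightarrow> real"
  assumes indep: "indep_vars (\<lambda>_. count_space UNIV \<Otimes>\<^sub>M borel) (\<lambda>i \<omega>. (b i \<omega>, p i \<omega>)) UNIV"
    and null: "\<And>i t. 0 \<le> t \<Longrightarrow> t \<le> 1 \<Longrightarrow> prob {\<omega> \<in> space M. \<not> b i \<omega> \<and> p i \<omega> \<le> t} = c * t"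
    and n: "1 \<le> n" and \<alpha>: "0 < \<alpha>" "\<alpha> \<le> 1"
  shows "expectation (\<lambda>\<omega>. real (card {i \<in> BH_reject \<alpha> n (\<lambda>i. p i \<omega>). \<not> b i \<omega>})
      / max (real (card (BH_reject \<alpha> n (\<lambda>i. p i \<omega>)))) 1) = c * \<alpha>"
proof -
  have Y: "(\<lambda>\<omega>. (b i \<omega>, p i \<omega>)) \<in> M \<rightarrow>\<^sub>M count_space UNIV \<Otimes>\<^sub>M borel" for i
    using indep by (auto simp: indep_vars_def)
  have [measurable]: "b i \<in> M \<rightarrow>\<^sub>M count_space UNIV" "p i \<in> borel_measurable M" for i
    using measurable_fst'[OF Y[of i]] measurable_snd'[OF Y[of i]] by simp_all
  define p0 where "p0 i \<omega> = (\<lambda>j. p j \<omega>)(i := 0)" for i \<omega>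
  define B where "B i r = {\<omega> \<in> space M. bh_rank \<alpha> n (p0 i \<omega>) = r}" for i r
  define A where "A i r = {\<omega> \<in> space M. \<not> b i \<omega> \<and> p i \<omega> \<le> \<alpha> * real r / n}" for i and r :: nat
  have p0_meas [measurable]: "(\<lambda>\<omega>. p0 i \<omega> j) \<in> borel_measurable M" for i j
    by (cases "i = j") (simp_all add: p0_def)
  have rk [measurable]: "(\<lambda>\<omega>. bh_rank \<alpha> n (p0 i \<omega>)) \<in> M \<rightarrow>\<^sub>M count_space UNIV" for i
    using bh_rank_measurable[of "\<lambda>j \<omega>. p0 i \<omega> j", OF p0_meas] by simp
  have [measurable]: "B i r \<in> events" "A i r \<in> events" for i r
    unfolding B_def A_def by measurable
  have ind: "prob (A i r \<inter> B i r) = prob (A i r) * prob (B i r)" if i: "i < n" for i r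
  proof -
    have iv: "indep_var (PiM {i} (\<lambda>_. count_space UNIV \<Otimes>\<^sub>M borel)) (\<lambda>\<omega>. restrict (\<lambda>j. (b j \<omega>, p j \<omega>)) {i})
       (PiM (- {i}) (\<lambda>_. count_space UNIV \<Otimes>\<^sub>M borel)) (\<lambda>\<omega>. restrict (\<lambda>j. (b j \<omega>, p j \<omega>)) (- {i}))"
      by (rule indep_var_restrict[OF indep]) auto
    have m1: "{y \<in> space (PiM {i} (\<lambda>_. count_space UNIV \<Otimes>\<^sub>M borel)). \<not> fst (y i) \<and> snd (y i) \<le> \<alpha> * real r / n}
        \<in> sets (PiM {i} (\<lambda>_. (count_space UNIV :: bool measure) \<Otimes>\<^sub>M borel))" by measurable
    have "(\<lambda>y. (if j = i then 0 else snd (y j))) \<in> borel_measurable (PiM (- {i}) (\<lambda>_. (count_space UNIV :: bool measure) \<Otimes>\<^sub>M borel))"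
      for j by (cases "j = i") auto
    from bh_rank_measurable[of "\<lambda>j y. if j = i then 0 else snd (y j)", OF this]
    have [measurable]: "(\<lambda>y. bh_rank \<alpha> n (\<lambda>j. if j = i then 0 else snd (y j)))
         \<in> measurable (PiM (- {i}) (\<lambda>_. (count_space UNIV :: bool measure) \<Otimes>\<^sub>M borel)) (count_space UNIV)" by simp
    have m2: "{y \<in> space (PiM (- {i}) (\<lambda>_. count_space UNIV \<Otimes>\<^sub>M borel)). bh_rank \<alpha> n (\<lambda>j. if j = i then 0 else snd (y j)) = r}
        \<in> sets (PiM (- {i}) (\<lambda>_. (count_space UNIV :: bool measure) \<Otimes>\<^sub>M borel))" by measurable
    have eqA: "(\<lambda>\<omega>. restrict (\<lambda>j. (b j \<omega>, p j \<omega>)) {i}) -`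
        {y \<in> space (PiM {i} (\<lambda>_. count_space UNIV \<Otimes>\<^sub>M borel)). \<not> fst (y i) \<and> snd (y i) \<le> \<alpha> * real r / n} \<inter> space M = A i r"
      by (auto simp: A_def space_PiM space_pair_measure)
    have p0: "(\<lambda>j. if j = i then 0 else snd (restrict (\<lambda>j. (b j \<omega>, p j \<omega>)) (- {i}) j)) = p0 i \<omega>" for \<omega>
      by (auto simp: p0_def)
    have eqB: "(\<lambda>\<omega>. restrict (\<lambda>j. (b j \<omega>, p j \<omega>)) (- {i})) -`
        {y \<in> space (PiM (- {i}) (\<lambda>_. count_space UNIV \<Otimes>\<^sub>M borel)). bh_rank \<alpha> n (\<lambda>j. if j = i then 0 else snd (y j)) = r} \<inter> space M = B i r"
      unfolding B_def using p0 by (auto simp: space_PiM space_pair_measure)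
    have pr: "(\<lambda>\<omega>. (restrict (\<lambda>j. (b j \<omega>, p j \<omega>)) {i}, restrict (\<lambda>j. (b j \<omega>, p j \<omega>)) (- {i}))) -`
       (V \<times> W) \<inter> space M = ((\<lambda>\<omega>. restrict (\<lambda>j. (b j \<omega>, p j \<omega>)) {i}) -` V \<inter> space M) \<inter>
         ((\<lambda>\<omega>. restrict (\<lambda>j. (b j \<omega>, p j \<omega>)) (- {i})) -` W \<inter> space M)" for V W by auto
    from indep_varD[OF iv m1 m2] show ?thesis by (simp only: pr eqA eqB)
  qed
  have PB: "(\<Sum>r\<in>{1..n}. prob (B i r)) = 1" for i
  proof -
    have "(\<Sum>r\<in>{1..n}. prob (B i r)) = prob (\<Union>r\<in>{1..n}. B i r)"
      by (intro finite_measure_finite_Union[symmetric]) (auto simp: disjoint_family_on_def B_def)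
    also have "(\<Union>r\<in>{1..n}. B i r) = space M" using bh_rank_in(1)[OF n] by (auto simp: B_def)
    finally show ?thesis by (simp add: prob_space)
  qed
  have point: "real (card {i \<in> BH_reject \<alpha> n (\<lambda>i. p i \<omega>). \<not> b i \<omega>}) / max (real (card (BH_reject \<alpha> n (\<lambda>i. p i \<omega>)))) 1
      = (\<Sum>i<n. \<Sum>r\<in>{1..n}. (1 / real r) * indicator (A i r \<inter> B i r) \<omega>)" if \<omega>: "\<omega> \<in> space M" for \<omega>
  proof -
    let ?p = "\<lambda>i. p i \<omega>"
    let ?\<rho> = "bh_rank \<alpha> n ?p"
    have "max (real (card (BH_reject \<alpha> n ?p))) 1 = real ?\<rho>"
      unfolding card_BH_reject[OF n \<alpha>, symmetric] by simp
    moreover have c: "real (card {i \<in> BH_reject \<alpha> n ?p. \<not> b i \<omega>})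
        = (\<Sum>i<n. of_bool (\<not> b i \<omega> \<and> ?p i \<le> \<alpha> * ?\<rho> / n))"
      by (simp add: BH_reject_eq[OF n \<alpha>] of_bool_def sum.If_cases Int_def conj_ac)
    moreover have "of_bool (\<not> b i \<omega> \<and> ?p i \<le> \<alpha> * ?\<rho> / n) / real ?\<rho>
       = (\<Sum>r\<in>{1..n}. (1 / real r) * indicator (A i r \<inter> B i r) \<omega>)" if i: "i < n" for i
    proof -
      let ?\<rho>' = "bh_rank \<alpha> n (p0 i \<omega>)"
      have "(\<Sum>r\<in>{1..n}. (1 / real r) * indicator (A i r \<inter> B i r) \<omega>)
          = (\<Sum>r\<in>{1..n}. if r = ?\<rho>' then (1 / real r) * indicator (A i r) \<omega> else 0)"
        using \<omega> by (intro sum.cong refl) (auto simp: B_def indicator_def)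
      also have "\<dots> = (1 / real ?\<rho>') * indicator (A i ?\<rho>') \<omega>"
        using bh_rank_in(1)[OF n, of \<alpha> "p0 i \<omega>"] by (subst sum.delta) auto
      \<comment> \<open>If hypothesis \<open>i\<close> is rejected, the modified and the true rank
        agree; otherwise both sides are 0.\<close>
      also have "\<dots> = of_bool (\<not> b i \<omega> \<and> ?p i \<le> \<alpha> * ?\<rho> / n) / real ?\<rho>"
        using bh_rank_zero_upd[OF n \<alpha> i, of ?p] \<omega> unfolding p0_def[symmetric]
        by (auto simp: A_def indicator_def)
      finally show ?thesis by simp
    qed
    ultimately show ?thesis
      unfolding c by (simp only: sum_divide_distrib) (intro sum.cong refl, simp)
  qed
  have "expectation (\<lambda>\<omega>. real (card {i \<in> BH_reject \<alpha> n (\<lambda>i. p i \<omega>). \<not> b i \<omega>})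
      / max (real (card (BH_reject \<alpha> n (\<lambda>i. p i \<omega>)))) 1)
     = expectation (\<lambda>\<omega>. \<Sum>i<n. \<Sum>r\<in>{1..n}. (1 / real r) * indicator (A i r \<inter> B i r) \<omega>)"
    by (intro Bochner_Integration.integral_cong refl point)
  also have "\<dots> = (\<Sum>i<n. \<Sum>r\<in>{1..n}. (1 / real r) * prob (A i r \<inter> B i r))"
    by (subst Bochner_Integration.integral_sum)
       (auto intro!: sum.cong Bochner_Integration.integral_sum[THEN trans] simp: integrable_real_indicator emeasure_eq_measure)
  also have "\<dots> = (\<Sum>i<n. \<Sum>r\<in>{1..n}. (c * \<alpha> / n) * prob (B i r))"
  proof (intro sum.cong refl)
    fix i r assume i: "i \<in> {..<n}" and r: "r \<in> {1..n}"
    have "\<alpha> * real r \<le> 1 * real n" using r \<alpha> by (intro mult_mono) auto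
    then have "prob (A i r) = c * (\<alpha> * real r / n)"
      unfolding A_def using n \<alpha> by (intro null) (auto simp: divide_le_eq_1)
    then show "(1 / real r) * prob (A i r \<inter> B i r) = (c * \<alpha> / n) * prob (B i r)"
      using ind[of i r] i r by simp
  qed
  also have "\<dots> = c * \<alpha>"
    using n by (simp only: sum_distrib_left[symmetric] PB) simp
  finally show ?thesis .
qed

context cube_density
begin

lemma D_reject_eq:
  assumes n: "1 \<le> n" and \<alpha>: "0 < \<alpha>" "\<alpha> \<le> 1"
  shows "D_reject g \<alpha> n S = BH_reject \<alpha> n (\<lambda>i. pval (S i))"
proof -
  have eq: "{t \<in> {0..1}. t / \<alpha> \<le> max (real (card {j \<in> {..<n}. S j \<in> Dset g t})) 1 / real n}
      = {t \<in> {0..1}. t / \<alpha> \<le> max (real (count_le n (\<lambda>i. pval (S i)) t)) 1 / real n}"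
    using Dset_iff by (auto simp: count_le_def)
  let ?\<rho> = "bh_rank \<alpha> n (\<lambda>i. pval (S i))"
  have "?\<rho> \<in> {1..n}" by (rule bh_rank_in(1)[OF n])
  then have "\<alpha> * ?\<rho> \<le> 1 * real n" using \<alpha> by (intro mult_mono) auto
  then have "0 \<le> \<alpha> * ?\<rho> / n" "\<alpha> * ?\<rho> / n \<le> 1" using n \<alpha> by (auto simp: divide_le_eq_1)
  then show ?thesis
    unfolding D_reject_def eq bh_threshold[OF n \<alpha>] BH_reject_eq[OF n \<alpha>] by (simp add: Dset_iff)
qed

end

section \<open>Limit theorems\<close>

text \<open>Hoeffding's inequality gives geometrically decaying tails, and Borel--Cantelli finishes.
  Only the probability of the one set \<open>A\<close> has to be the same for all indices.\<close>

lemma (in prob_space) slln_frequency: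
  fixes Y :: "nat \<Rightarrow> 'a \<Rightarrow> 'b"
  assumes indep: "indep_vars (\<lambda>_. N) Y UNIV" and A: "A \<in> sets N"
    and p: "\<And>i. prob {\<omega> \<in> space M. Y i \<omega> \<in> A} = p"
  shows "AE \<omega> in M. (\<lambda>n. real (card {i \<in> {..<n}. Y i \<omega> \<in> A}) / n) \<longlonglongrightarrow> p"
proof -
  have Y [measurable]: "Y i \<in> M \<rightarrow>\<^sub>M N" for i using indep by (auto simp: indep_vars_def)
  define X where "X i \<omega> = (indicator A (Y i \<omega>) :: real)" for i \<omega>
  have "indep_vars (\<lambda>_. borel) (\<lambda>i \<omega>. indicator A (Y i \<omega>) :: real) UNIV"
    using A by (intro indep_vars_compose2[OF indep]) auto
  then have iX: "indep_vars (\<lambda>_. borel) X UNIV" by (simp add: X_def[abs_def])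
  have [measurable]: "X i \<in> borel_measurable M" for i using iX by (auto simp: indep_vars_def)
  have EX: "expectation (X i) = p" for i
  proof -
    have "{\<omega> \<in> space M. Y i \<omega> \<in> A} = Y i -` A \<inter> space M" by auto
    moreover have "expectation (X i) = expectation (indicator (Y i -` A \<inter> space M))"
      unfolding X_def[abs_def] by (intro Bochner_Integration.integral_cong) (auto simp: indicator_def)
    ultimately show ?thesis using p[of i] by simp
  qed
  have sumX: "(\<Sum>i<n. X i \<omega>) = card {i \<in> {..<n}. Y i \<omega> \<in> A}" for n \<omega>
    by (simp add: X_def indicator_def sum.If_cases Int_def)
  have bound: "prob {\<omega> \<in> space M. \<epsilon> * n \<le> \<bar>(\<Sum>i<n. X i \<omega>) - n * p\<bar>} \<le> 2 * exp (- 2 * \<epsilon>\<^sup>2) ^ n"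
    if \<epsilon>: "0 < \<epsilon>" for \<epsilon> :: real and n :: nat
  proof (cases "n = 0")
    case True
    then show ?thesis by (auto intro: order_trans[OF prob_le_1])
  next
    case False
    interpret Hoeffding_ineq M "{..<n}" X "\<lambda>_. 0" "\<lambda>_. 1" "\<Sum>i<n. expectation (X i)"
      by unfold_locales (auto intro!: indep_vars_subset[OF iX] simp: X_def indicator_def)
    have "prob {\<omega> \<in> space M. \<epsilon> * n \<le> \<bar>(\<Sum>i<n. X i \<omega>) - n * p\<bar>} \<le> 2 * exp (- 2 * (\<epsilon> * n)\<^sup>2 / n)"
      using Hoeffding_ineq_abs_ge[of "\<epsilon> * n"] \<epsilon> False by (simp add: EX)
    also have "- 2 * (\<epsilon> * n)\<^sup>2 / n = real n * (- 2 * \<epsilon>\<^sup>2)"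
      using False by (simp add: power2_eq_square)
    finally show ?thesis by (simp only: exp_of_nat_mult)
  qed
  have ev: "AE \<omega> in M. \<forall>\<^sub>F n in sequentially. \<omega> \<in> space M - {\<omega> \<in> space M. \<epsilon> * n \<le> \<bar>(\<Sum>i<n. X i \<omega>) - n * p\<bar>}"
    if \<epsilon>: "0 < \<epsilon>" for \<epsilon> :: real
  proof (rule borel_cantelli_AE1)
    have "summable (\<lambda>n. 2 * exp (- 2 * \<epsilon>\<^sup>2) ^ n)"
      using \<epsilon> by (intro summable_mult summable_geometric) simp
    then show "summable (\<lambda>n. prob {\<omega> \<in> space M. \<epsilon> * n \<le> \<bar>(\<Sum>i<n. X i \<omega>) - n * p\<bar>})"
      by (rule summable_comparison_test'[where N = 0]) (use bound[OF \<epsilon>] in \<open>simp add: measure_nonneg\<close>)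
  qed (auto simp: less_top[symmetric])
  have "AE \<omega> in M. \<forall>k. \<forall>\<^sub>F n in sequentially. \<omega> \<in> space M - {\<omega> \<in> space M. 1 / Suc k * n \<le> \<bar>(\<Sum>i<n. X i \<omega>) - n * p\<bar>}"
    unfolding AE_all_countable by (intro allI ev) simp
  then show ?thesis
  proof eventually_elim
    case (elim \<omega>)
    show ?case
    proof (rule tendstoI)
      fix e :: real assume "0 < e"
      then obtain k where k: "inverse (Suc k) < e" using reals_Archimedean by blast
      have "\<forall>\<^sub>F n in sequentially. \<omega> \<in> space M - {\<omega> \<in> space M. 1 / Suc k * n \<le> \<bar>(\<Sum>i<n. X i \<omega>) - n * p\<bar>}"
        using elim by blast
      then show "\<forall>\<^sub>F n in sequentially. dist (real (card {i \<in> {..<n}. Y i \<omega> \<in> A}) / n) p < e"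
        using eventually_gt_at_top[of "0::nat"]
      proof eventually_elim
        case (elim n)
        have "\<bar>(\<Sum>i<n. X i \<omega>) - n * p\<bar> < 1 / Suc k * n" using elim by (auto simp: not_le)
        also have "\<dots> \<le> e * n" using k by (intro mult_right_mono) (auto simp: inverse_eq_divide)
        finally have "\<bar>(\<Sum>i<n. X i \<omega>) - n * p\<bar> / n < e" using elim by (simp add: divide_less_eq)
        moreover have "(\<Sum>i<n. X i \<omega>) / n - p = ((\<Sum>i<n. X i \<omega>) - n * p) / n"
          using elim by (simp add: field_simps)
        ultimately show ?case by (simp add: dist_real_def sumX abs_divide)
      qed
    qed
  qed
qed

text \<open>Polya's theorem: for monotone functions with a continuous limit, control on a finite
  grid of small mesh is control everywhere. Convergence is demanded at rational points only, so that
  an almost sure statement involves countably many of them. It is used for distribution functions of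
  vectors and, in dimension 1, for counts of p-values.\<close>

lemma polya_cube:
  fixes e :: "nat \<Rightarrow> real ^ 'k::finite \<Rightarrow> real"
  assumes mono_e: "\<And>n x y. x \<le> y \<Longrightarrow> e n x \<le> e n y"
    and mono_F: "\<And>x y. x \<le> y \<Longrightarrow> F x \<le> F y"
    and cont: "continuous_on unit_cube F"
    and conv: "\<And>x. (\<forall>k. x $ k \<in> \<rat> \<inter> {0..1}) \<Longrightarrow> (\<lambda>n. e n x) \<longlonglongrightarrow> F x"
    and \<epsilon>: "0 < \<epsilon>"
  shows "\<forall>\<^sub>F n in sequentially. \<forall>x\<in>unit_cube. \<bar>e n x - F x\<bar> < \<epsilon>"
proof -
  have "uniformly_continuous_on unit_cube F"
    using cont by (intro compact_uniformly_continuous) auto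
  then obtain \<delta> where \<delta>: "\<delta> > 0"
    "\<And>x y. x \<in> unit_cube \<Longrightarrow> y \<in> unit_cube \<Longrightarrow> dist y x < \<delta> \<Longrightarrow> dist (F y) (F x) < \<epsilon> / 2"
    using \<epsilon> unfolding uniformly_continuous_on_def by (metis half_gt_zero)
  \<comment> \<open>With mesh \<open>1 / N\<close> the corners of the cell of a point are within
    \<open>CARD('k) / N\<close> of it, by the l1 bound on the norm.\<close>
  obtain N :: nat where N: "N > 0" "CARD('k) / real N < \<delta>"
  proof -
    obtain m :: nat where m: "CARD('k) / \<delta> < m" using reals_Archimedean2 by blast
    then have "0 < m" using \<delta>(1) by (metis divide_nonneg_pos not_le of_nat_0 of_nat_0_le_iff gr0I)
    with m \<delta>(1) show thesis by (intro that[of m]) (auto simp: field_simps)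
  qed
  define P :: "(real, 'k) vec set" where "P = {v. \<forall>k. v $ k \<in> (\<lambda>i. real i / N) ` {..N}}"
  have "finite P"
  proof -
    have "P \<subseteq> (\<lambda>f. \<chi> k. f k) ` (\<Pi>\<^sub>E k\<in>UNIV. (\<lambda>i. real i / N) ` {..N})"
    proof
      fix v assume "v \<in> P"
      then have "(\<lambda>k. v $ k) \<in> (\<Pi>\<^sub>E k\<in>UNIV. (\<lambda>i. real i / N) ` {..N})" by (auto simp: P_def)
      then show "v \<in> (\<lambda>f. \<chi> k. f k) ` (\<Pi>\<^sub>E k\<in>UNIV. (\<lambda>i. real i / N) ` {..N})"
        by (rule rev_image_eqI) simp
    qed
    then show ?thesis by (rule finite_subset) (intro finite_imageI finite_PiE, auto)
  qed
  have P01: "v $ k \<in> \<rat> \<inter> {0..1}" if v: "v \<in> P" for v k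
  proof -
    obtain i where "v $ k = real i / N" "i \<le> N" using v unfolding P_def by blast
    then show ?thesis using N by (auto simp: divide_le_eq_1)
  qed
  then have P_cube: "P \<subseteq> unit_cube" by (auto simp: mem_box_cart)
  have "\<forall>\<^sub>F n in sequentially. \<forall>v\<in>P. dist (e n v) (F v) < \<epsilon> / 2"
    using \<open>finite P\<close>
  proof (rule eventually_ball_finite, intro ballI)
    fix v assume "v \<in> P"
    then have "(\<lambda>n. e n v) \<longlonglongrightarrow> F v" using P01 by (intro conv) blast
    then show "\<forall>\<^sub>F n in sequentially. dist (e n v) (F v) < \<epsilon> / 2"
      using \<epsilon> by (intro tendstoD) auto
  qed
  then show ?thesis
  proof eventually_elim
    case (elim n)
    show ?case
    proof
      fix x :: "(real, 'k) vec" assume x: "x \<in> unit_cube"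
      then have x01: "0 \<le> x $ k" "x $ k \<le> 1" for k by (auto simp: mem_box_cart)
      define l :: "(real, 'k) vec" where "l = (\<chi> k. real (nat \<lfloor>N * x $ k\<rfloor>) / N)"
      define u :: "(real, 'k) vec" where "u = (\<chi> k. real (nat \<lceil>N * x $ k\<rceil>) / N)"
      have lk: "real (nat \<lfloor>N * x $ k\<rfloor>) = of_int \<lfloor>N * x $ k\<rfloor>"
        and uk: "real (nat \<lceil>N * x $ k\<rceil>) = of_int \<lceil>N * x $ k\<rceil>" for k
        using x01[of k] N by (auto intro!: of_nat_nat)
      have le_N: "N * x $ k \<le> N" for k using x01[of k] N by (simp add: mult_le_cancel_left1)
      have "l \<in> P"
        unfolding P_def l_def using le_N by (auto intro!: imageI simp: nat_le_iff floor_le_iff le_less_trans[OF le_N])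
      moreover have "u \<in> P"
        unfolding P_def u_def using le_N by (auto intro!: imageI simp: nat_le_iff ceiling_le_iff)
      moreover have lx: "l $ k \<le> x $ k" and xu: "x $ k \<le> u $ k"
        and ul: "u $ k \<le> x $ k + 1 / N" "x $ k \<le> l $ k + 1 / N" for k
        using N of_int_floor_le[of "N * x $ k"] le_of_int_ceiling[of "N * x $ k"]
          of_int_ceiling_le_add_one[of "N * x $ k"] real_of_int_floor_add_one_ge[of "N * x $ k"]
        by (auto simp: l_def u_def lk uk field_simps)
      moreover have "dist y x < \<delta>" if "\<And>k. \<bar>y $ k - x $ k\<bar> \<le> 1 / N" for y
      proof -
        have "dist y x \<le> (\<Sum>k\<in>UNIV. \<bar>(y - x) $ k\<bar>)" unfolding dist_norm by (rule norm_le_l1_cart)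
        also have "\<dots> \<le> (\<Sum>k\<in>(UNIV::'k set). 1 / N)" using that by (intro sum_mono) simp
        also have "\<dots> < \<delta>" using N by simp
        finally show ?thesis .
      qed
      then have "dist l x < \<delta>" "dist u x < \<delta>"
        using lx xu ul by (auto simp: abs_le_iff) (smt (verit))+
      moreover have "e n l \<le> e n x" "e n x \<le> e n u"
        using lx xu by (auto intro!: mono_e simp: less_eq_vec_def)
      ultimately show "\<bar>e n x - F x\<bar> < \<epsilon>"
        using elim \<delta>(2)[OF x, of l] \<delta>(2)[OF x, of u] P_cube
        by (auto simp: dist_real_def subset_iff) (smt (verit) field_sum_of_halves)
    qed
  qed
qed

text \<open>Inclusion-exclusion for the last set: stability under intersections puts the sets
  \<open>B i \<inter> B m\<close> back in \<open>C\<close>, so the induction hypothesis covers the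
  overlap.\<close>

lemma measure_Union_Int_stable_convergence:
  fixes \<nu> :: "nat \<Rightarrow> 'a measure"
  assumes fin: "finite_measure \<mu>" "\<And>n. finite_measure (\<nu> n)"
    and sets: "\<And>n. sets (\<nu> n) = sets \<mu>"
    and C: "C \<subseteq> sets \<mu>" and stable: "\<And>A B. A \<in> C \<Longrightarrow> B \<in> C \<Longrightarrow> A \<inter> B \<in> C"
    and conv: "\<And>A. A \<in> C \<Longrightarrow> (\<lambda>n. measure (\<nu> n) A) \<longlonglongrightarrow> measure \<mu> A"
    and B: "\<And>i :: nat. B i \<in> C"
  shows "(\<lambda>n. measure (\<nu> n) (\<Union>i<m. B i)) \<longlonglongrightarrow> measure \<mu> (\<Union>i<m. B i)"
  using B
proof (induction m arbitrary: B)
  case 0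
  show ?case by simp
next
  case (Suc m)
  have eq: "measure \<rho> (\<Union>i<Suc m. B i) = measure \<rho> (\<Union>i<m. B i) + measure \<rho> (B m) - measure \<rho> (\<Union>i<m. B i \<inter> B m)"
    if \<rho>: "finite_measure \<rho>" "sets \<rho> = sets \<mu>" for \<rho>
  proof -
    interpret finite_measure \<rho> by (rule \<rho>)
    have s: "B i \<in> sets \<rho>" for i using Suc.prems C \<rho>(2) by auto
    have "(\<Union>i<Suc m. B i) = (\<Union>i<m. B i) \<union> B m" "(\<Union>i<m. B i \<inter> B m) = (\<Union>i<m. B i) \<inter> B m"
      by (auto simp: less_Suc_eq)
    then show ?thesis using s by (simp add: measure_Un3 fmeasurable_eq_sets)
  qed
  have "(\<lambda>n. measure (\<nu> n) (\<Union>i<m. B i) + measure (\<nu> n) (B m) - measure (\<nu> n) (\<Union>i<m. B i \<inter> B m))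
      \<longlonglongrightarrow> measure \<mu> (\<Union>i<m. B i) + measure \<mu> (B m) - measure \<mu> (\<Union>i<m. B i \<inter> B m)"
    using Suc.prems stable by (intro tendsto_intros Suc.IH conv) auto
  then show ?case using eq[of "\<nu> _"] eq[of \<mu>] fin sets by simp
qed

text \<open>The lower bound of the portmanteau theorem: an open set is a countable union of half-open
  boxes, and their measures are determined by the distribution function.\<close>

lemma portmanteau_open:
  fixes \<mu> :: "(real ^ 'k::finite) measure" and \<nu> :: "nat \<Rightarrow> (real ^ 'k) measure"
  assumes fin: "finite_measure \<mu>" "\<And>n. finite_measure (\<nu> n)"
    and sets: "sets \<mu> = sets borel" "\<And>n. sets (\<nu> n) = sets borel"
    and conv: "\<And>x. (\<lambda>n. measure (\<nu> n) {y. \<forall>k. y $ k \<le> x $ k}) \<longlonglongrightarrow> measure \<mu> {y. \<forall>k. y $ k \<le> x $ k}"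
    and U: "open U" and c: "c < measure \<mu> U"
  shows "\<forall>\<^sub>F n in sequentially. c < measure (\<nu> n) U"
proof -
  \<comment> \<open>\<open>J\<close> collects the coordinates that already carry a lower bound.
    Starting from orthants, each further coordinate costs one difference of two sets of the same
    kind.\<close>
  define bx where "bx J x z = {y :: (real, 'k) vec. (\<forall>k. y $ k \<le> z $ k) \<and> (\<forall>k\<in>J. x $ k < y $ k)}" for J and x z :: "(real, 'k) vec"
  have bx_sets: "bx J x z \<in> sets borel" for J x z
    unfolding bx_def by measurable
  have conv_bx: "(\<lambda>n. measure (\<nu> n) (bx J x z)) \<longlonglongrightarrow> measure \<mu> (bx J x z)" for J x z
  proof -
    have "finite J" by simp
    then show ?thesis
    proof (induction J arbitrary: z)
      case empty
      then show ?case using conv[of z] by (simp add: bx_def)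
    next
      case (insert j J)
      define z' :: "(real, 'k) vec" where "z' = (\<chi> k. if k = j then min (z $ j) (x $ j) else z $ k)"
      have z': "(\<forall>k. y $ k \<le> z' $ k) \<longleftrightarrow> (\<forall>k. y $ k \<le> z $ k) \<and> y $ j \<le> x $ j" for y
        by (auto simp: z'_def)
      have "bx (insert j J) x z = bx J x z - bx J x z'" "bx J x z' \<subseteq> bx J x z"
        unfolding bx_def z' by (auto simp: not_less[symmetric])
      then have "measure \<rho> (bx (insert j J) x z) = measure \<rho> (bx J x z) - measure \<rho> (bx J x z')"
        if "finite_measure \<rho>" "sets \<rho> = sets borel" for \<rho>
        using finite_measure.finite_measure_Diff[OF that(1)] bx_sets that(2) by simp
      then show ?case using fin sets insert.IH by (auto intro!: tendsto_diff)
    qed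
  qed
  have bx_Int: "bx UNIV x z \<inter> bx UNIV x' z' = bx UNIV (\<chi> k. max (x $ k) (x' $ k)) (\<chi> k. min (z $ k) (z' $ k))"
    for x z x' z' by (auto simp: bx_def)
  have bx_range: "bx UNIV x z \<in> range (case_prod (bx UNIV))" for x z
    by (rule range_eqI[of _ _ "(x, z)"]) simp
  define FF where "FF = {box x z | x z. bx UNIV x z \<subseteq> U}"
  have "\<Union>FF = U"
  proof (intro equalityI subsetI)
    fix y assume "y \<in> \<Union>FF"
    then obtain x z where "y \<in> box x z" "bx UNIV x z \<subseteq> U" by (auto simp: FF_def)
    moreover have "box x z \<subseteq> bx UNIV x z" by (auto simp: bx_def mem_box_cart less_imp_le)
    ultimately show "y \<in> U" by auto
  next
    fix y assume "y \<in> U"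
    then obtain x z where xz: "cbox x z \<subseteq> U" "y \<in> box x z" using open_contains_cbox[OF U] by metis
    have "bx UNIV x z \<subseteq> cbox x z" by (auto simp: bx_def mem_box_cart less_imp_le)
    then have "box x z \<in> FF" using xz by (auto simp: FF_def)
    with xz show "y \<in> \<Union>FF" by blast
  qed
  moreover obtain FF' where FF': "FF' \<subseteq> FF" "countable FF'" "\<Union>FF' = \<Union>FF"
    by (rule Lindelof[of FF]) (auto simp: FF_def)
  ultimately have U_eq: "\<Union>FF' = U" by simp
  define S where "S = from_nat_into (insert {} FF')"
  have rS: "range S = insert {} FF'" unfolding S_def using FF'(2) by (intro range_from_nat_into) auto
  have "\<exists>B. B \<in> range (case_prod (bx UNIV)) \<and> S i \<subseteq> B \<and> B \<subseteq> U" for i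
  proof (cases "S i = {}")
    case True
    have "bx UNIV 0 0 = {}" by (auto simp: bx_def not_less)
    then show ?thesis using True by (intro exI[of _ "{}"]) (auto intro!: image_eqI[of _ _ "(0, 0)"])
  next
    case False
    then have "S i \<in> FF" using rS FF'(1) by (metis insertE rangeI subsetD)
    then obtain x z where xz: "S i = box x z" "bx UNIV x z \<subseteq> U" by (auto simp: FF_def)
    note bx_range[of x z]
    moreover have "box x z \<subseteq> bx UNIV x z" by (auto simp: bx_def mem_box_cart less_imp_le)
    ultimately show ?thesis using xz by metis
  qed
  then obtain B where B: "\<And>i. B i \<in> range (case_prod (bx UNIV))" "\<And>i. S i \<subseteq> B i" "\<And>i. B i \<subseteq> U" by metis
  have B_sets: "B i \<in> sets borel" for i using B(1)[of i] bx_sets by auto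
  have UB: "(\<Union>i. B i) = U"
  proof
    have "U = (\<Union>i. S i)" using rS U_eq by auto
    also have "\<dots> \<subseteq> (\<Union>i. B i)" using B(2) by blast
    finally show "U \<subseteq> (\<Union>i. B i)" .
  qed (use B(3) in auto)
  interpret M: finite_measure \<mu> by (rule fin)
  have "(\<lambda>m. measure \<mu> (\<Union>i<m. B i)) \<longlonglongrightarrow> measure \<mu> (\<Union>m. \<Union>i<m. B i)"
    using B_sets by (intro M.finite_Lim_measure_incseq) (auto simp: sets incseq_def intro: less_le_trans)
  also have "(\<Union>m. \<Union>i<m. B i) = U" using UB by auto
  finally have "\<forall>\<^sub>F m in sequentially. c < measure \<mu> (\<Union>i<m. B i)"
    using c by (rule order_tendstoD(1))
  then obtain m where m: "c < measure \<mu> (\<Union>i<m. B i)"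
    by (auto simp: eventually_sequentially)
  have "(\<lambda>n. measure (\<nu> n) (\<Union>i<m. B i)) \<longlonglongrightarrow> measure \<mu> (\<Union>i<m. B i)"
    by (rule measure_Union_Int_stable_convergence[where C = "range (case_prod (bx UNIV))"])
       (use fin sets B(1) bx_sets conv_bx in \<open>auto simp: bx_Int bx_range\<close>)
  then have "\<forall>\<^sub>F n in sequentially. c < measure (\<nu> n) (\<Union>i<m. B i)"
    using m by (rule order_tendstoD)
  then show ?thesis
  proof eventually_elim
    case (elim n)
    interpret N: finite_measure "\<nu> n" by (rule fin)
    have "measure (\<nu> n) (\<Union>i<m. B i) \<le> measure (\<nu> n) U"
      using B(3) U by (intro N.finite_measure_mono) (auto simp: sets)
    with elim show ?case by simp
  qed
qed

lemma Fhat_mono: "x \<le> y \<Longrightarrow> Fhat n S x \<le> Fhat n S y"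
  unfolding Fhat_def
  by (intro divide_right_mono of_nat_mono card_mono) (auto simp: less_eq_vec_def intro: order_trans)

lemma Fhat_cong: "(\<And>i. i < n \<Longrightarrow> S i = S' i) \<Longrightarrow> Fhat n S x = Fhat n S' x"
  unfolding Fhat_def by (intro arg_cong2[where f = "(/)"] arg_cong[where f = real] arg_cong[where f = card]) auto

lemma decision_sets:
  assumes "\<delta> \<in> M \<rightarrow>\<^sub>M count_space (Pow {..<n})"
  shows "{\<omega> \<in> space M. P (\<delta> \<omega>)} \<in> sets M"
proof -
  have "\<delta> -` ({D. P D} \<inter> Pow {..<n}) \<inter> space M \<in> sets M"
    by (rule measurable_sets[OF assms]) simp
  also have "\<delta> -` ({D. P D} \<inter> Pow {..<n}) \<inter> space M = {\<omega> \<in> space M. P (\<delta> \<omega>)}"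
    using measurable_space[OF assms] by auto
  finally show ?thesis .
qed

lemma decision_subset: "\<delta> \<in> M \<rightarrow>\<^sub>M count_space (Pow {..<n}) \<Longrightarrow> \<omega> \<in> space M \<Longrightarrow> \<delta> \<omega> \<subseteq> {..<n}"
  using measurable_space[of \<delta> M "count_space (Pow {..<n})" \<omega>] by simp

lemma (in finite_measure) bounded_integrable:
  assumes "f \<in> borel_measurable M" "\<And>\<omega>. \<omega> \<in> space M \<Longrightarrow> \<bar>f \<omega>\<bar> \<le> (c :: real)"
  shows "integrable M f"
  using assms by (intro integrable_const_bound[where B = c]) auto

lemma fraction_mult_le_abs:
  fixes q y :: real
  assumes "0 \<le> q" "q \<le> 1"
  shows "q * y \<le> \<bar>y\<bar>"
proof -
  have "q * y \<le> q * \<bar>y\<bar>" using assms by (intro mult_left_mono) auto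
  also have "\<dots> \<le> 1 * \<bar>y\<bar>" using assms by (intro mult_right_mono) auto
  finally show ?thesis by simp
qed

text \<open>With \<open>\<epsilon>\<close> a third of the distance between the limits, no value is
  within \<open>\<epsilon>\<close> of both, so the two exceptional events cover everything.\<close>

lemma pmf_concentration_unique:
  fixes p :: "nat \<Rightarrow> 'b pmf" and X :: "nat \<Rightarrow> 'b \<Rightarrow> real"
  assumes c: "\<And>\<epsilon>. 0 < \<epsilon> \<Longrightarrow> (\<lambda>n. measure_pmf.prob (p n) {D. \<epsilon> < \<bar>X n D - c\<bar>}) \<longlonglongrightarrow> 0"
    and c': "\<And>\<epsilon>. 0 < \<epsilon> \<Longrightarrow> (\<lambda>n. measure_pmf.prob (p n) {D. \<epsilon> < \<bar>X n D - c'\<bar>}) \<longlonglongrightarrow> 0"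
  shows "c = c'"
proof (rule ccontr)
  assume ne: "c \<noteq> c'"
  define \<epsilon> where "\<epsilon> = \<bar>c - c'\<bar> / 3"
  have \<epsilon>: "0 < \<epsilon>" using ne by (simp add: \<epsilon>_def)
  have "(\<lambda>n. measure_pmf.prob (p n) {D. \<epsilon> < \<bar>X n D - c\<bar>} + measure_pmf.prob (p n) {D. \<epsilon> < \<bar>X n D - c'\<bar>}) \<longlonglongrightarrow> 0 + 0"
    by (intro tendsto_add c c' \<epsilon>)
  moreover have "1 \<le> measure_pmf.prob (p n) {D. \<epsilon> < \<bar>X n D - c\<bar>} + measure_pmf.prob (p n) {D. \<epsilon> < \<bar>X n D - c'\<bar>}" for n
  proof -
    have "{D. \<epsilon> < \<bar>X n D - c\<bar>} \<union> {D. \<epsilon> < \<bar>X n D - c'\<bar>} = UNIV"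
      using \<epsilon> by (auto simp: \<epsilon>_def not_less abs_le_iff abs_if split: if_splits)
    then have "1 = measure_pmf.prob (p n) ({D. \<epsilon> < \<bar>X n D - c\<bar>} \<union> {D. \<epsilon> < \<bar>X n D - c'\<bar>})"
      by simp
    also have "\<dots> \<le> measure_pmf.prob (p n) {D. \<epsilon> < \<bar>X n D - c\<bar>} + measure_pmf.prob (p n) {D. \<epsilon> < \<bar>X n D - c'\<bar>}"
      by (intro measure_Un_le) auto
    finally show ?thesis .
  qed
  ultimately have "1 \<le> (0 + 0 :: real)" by (intro LIMSEQ_le_const) auto
  then show False by simp
qed

section \<open>The two-groups model\<close>

text \<open>The model after the transform. Laws are stated as joint probabilities with
  \<open>\<theta>\<close>, which replaces conditioning on an event by a plain factor. Of the
  transform only an open set \<open>E\<close> of full measure with \<open>g\<close> continuous on it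
  survives: the regularity that weak convergence can use.\<close>

locale mt_model = mixture g a + prob_space M
  for g :: "(real, 'k::finite) vec \<Rightarrow> real" and a :: real and M :: "'w measure" +
  fixes \<theta> :: "nat \<Rightarrow> 'w \<Rightarrow> bool" and \<xi> :: "nat \<Rightarrow> 'w \<Rightarrow> (real, 'k) vec" and E :: "(real, 'k) vec set"
  assumes xi_cube: "\<And>i \<omega>. \<xi> i \<omega> \<in> unit_cube"
    and indep: "indep_vars (\<lambda>_. count_space UNIV \<Otimes>\<^sub>M borel) (\<lambda>i \<omega>. (\<theta> i \<omega>, \<xi> i \<omega>)) UNIV"
    and null_law: "\<And>i B. B \<in> sets borel \<Longrightarrow> prob {\<omega> \<in> space M. \<not> \<theta> i \<omega> \<and> \<xi> i \<omega> \<in> B} = (1 - a) * U.prob B"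
    and alt_law: "\<And>i B. B \<in> sets borel \<Longrightarrow>
      prob {\<omega> \<in> space M. \<theta> i \<omega> \<and> \<xi> i \<omega> \<in> B} = a * (\<integral>x. g x * indicator B x \<partial>unif_cube)"
    and E_open: "open E" and g_cont: "continuous_on E g" and E_full: "U.prob E = 1"
begin

lemma theta_xi_pair_measurable: "(\<lambda>\<omega>. (\<theta> i \<omega>, \<xi> i \<omega>)) \<in> M \<rightarrow>\<^sub>M count_space UNIV \<Otimes>\<^sub>M borel"
  using indep by (auto simp: indep_vars_def)

lemma theta_measurable [measurable]: "\<theta> i \<in> M \<rightarrow>\<^sub>M count_space UNIV"
  and xi_measurable [measurable]: "\<xi> i \<in> borel_measurable M"
  using measurable_fst'[OF theta_xi_pair_measurable[of i]] measurable_snd'[OF theta_xi_pair_measurable[of i]]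
  by simp_all

lemma xi_law:
  assumes [measurable]: "B \<in> sets borel"
  shows "prob {\<omega> \<in> space M. \<xi> i \<omega> \<in> B} = (1 - a) * U.prob B + a * (\<integral>x. g x * indicator B x \<partial>unif_cube)"
proof -
  have "{\<omega> \<in> space M. \<xi> i \<omega> \<in> B} = {\<omega> \<in> space M. \<not> \<theta> i \<omega> \<and> \<xi> i \<omega> \<in> B} \<union> {\<omega> \<in> space M. \<theta> i \<omega> \<and> \<xi> i \<omega> \<in> B}"
    by auto
  then show ?thesis
    by (subst null_law[OF assms, symmetric], subst alt_law[OF assms, symmetric])
       (simp, subst finite_measure_Union, auto)
qed

lemma xi_null:
  assumes B [measurable]: "B \<in> sets borel" and 0: "U.prob B = 0"
  shows "prob {\<omega> \<in> space M. \<xi> i \<omega> \<in> B} = 0"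
proof -
  have "AE x in unif_cube. x \<notin> B"
    using 0 by (subst AE_iff_null_sets[symmetric]) (auto simp: null_sets_def U.emeasure_eq_measure)
  then have "(\<integral>x. g x * indicator B x \<partial>unif_cube) = (\<integral>x. 0 \<partial>(unif_cube :: (real, 'k) vec measure))"
    by (intro integral_cong_AE) auto
  then show ?thesis using xi_law[OF B, of i] 0 by simp
qed

lemma pval_law:
  assumes t: "0 \<le> t" "t \<le> 1"
  shows "prob {\<omega> \<in> space M. \<not> \<theta> i \<omega> \<and> pval (\<xi> i \<omega>) \<le> t} = (1 - a) * t"
    and "prob {\<omega> \<in> space M. \<theta> i \<omega> \<and> pval (\<xi> i \<omega>) \<le> t} = a * G t"
    and "prob {\<omega> \<in> space M. pval (\<xi> i \<omega>) \<le> t} = H t"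
  using null_law[OF pval_sets, of i t] alt_law[OF pval_sets, of i t] xi_law[OF pval_sets, of i t]
  by (simp_all add: prob_pval_le[OF t] G_def H_def)

lemma theta_prob: "prob {\<omega> \<in> space M. \<theta> i \<omega>} = a"
  using alt_law[of UNIV i] by (simp add: g_integral)

lemma pval_indep: "indep_vars (\<lambda>_. count_space UNIV \<Otimes>\<^sub>M borel) (\<lambda>i \<omega>. (\<theta> i \<omega>, pval (\<xi> i \<omega>))) UNIV"
  using indep_vars_compose2[OF indep, of "\<lambda>_ z. (fst z, pval (snd z))" "\<lambda>_. count_space UNIV \<Otimes>\<^sub>M borel"]
  by simp

lemma xi_indep: "indep_vars (\<lambda>_. borel) \<xi> UNIV"
  using indep_vars_compose2[OF indep, of "\<lambda>_ z. snd z" "\<lambda>_. borel"] by simp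

definition F :: "(real, 'k) vec \<Rightarrow> real" where
  "F = distr_fun M (\<xi> 0)"

lemma xi_orthant: "prob {\<omega> \<in> space M. \<forall>k. \<xi> i \<omega> $ k \<le> x $ k} = F x"
  using xi_law[of "{y. \<forall>k. y $ k \<le> x $ k}" i] xi_law[of "{y. \<forall>k. y $ k \<le> x $ k}" 0]
  by (simp add: F_def distr_fun_def)

lemma F_mono: "x \<le> y \<Longrightarrow> F x \<le> F y"
  unfolding xi_orthant[of 0, symmetric]
  by (intro finite_measure_mono) (auto simp: less_eq_vec_def intro: order_trans)

lemma hyperplane_null: "prob {\<omega> \<in> space M. \<xi> i \<omega> $ k = c} = 0"
proof -
  have s: "{x :: (real, 'k) vec. x $ k = c} \<in> sets borel" by measurable
  have "{x :: (real, 'k) vec. x $ k = c} \<in> null_sets lebesgue"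
    using negligible_standard_hyperplane[of "axis k 1 :: (real, 'k) vec" c]
    by (simp add: negligible_iff_null_sets inner_axis Basis_vec_real)
  then have n: "emeasure lborel {x :: (real, 'k) vec. x $ k = c} = 0"
    using s by (simp add: null_sets_def)
  have "emeasure lborel ({x :: (real, 'k) vec. x $ k = c} \<inter> unit_cube) \<le> emeasure lborel {x :: (real, 'k) vec. x $ k = c}"
    using s by (intro emeasure_mono) auto
  then have "U.prob {x. x $ k = c} = 0"
    using s n by (simp add: measure_def emeasure_unif_cube)
  from xi_null[OF s this, of i] show ?thesis by simp
qed

text \<open>Coordinate hyperplanes are null, so almost surely the indicator of an orthant is
  eventually constant as its corner converges.\<close>

lemma F_cont: "continuous_on UNIV F"
  unfolding continuous_on_sequentially
proof safe
  fix X :: "nat \<Rightarrow> (real, 'k) vec" and x assume X: "X \<longlonglongrightarrow> x"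
  have F_eq: "F z = expectation (\<lambda>\<omega>. indicator {y. \<forall>k. y $ k \<le> z $ k} (\<xi> 0 \<omega>) :: real)" for z
  proof -
    have "expectation (\<lambda>\<omega>. indicator {y. \<forall>k. y $ k \<le> z $ k} (\<xi> 0 \<omega>) :: real)
        = expectation (indicator {\<omega> \<in> space M. \<forall>k. \<xi> 0 \<omega> $ k \<le> z $ k})"
      by (intro Bochner_Integration.integral_cong) (auto simp: indicator_def)
    then show ?thesis by (simp add: xi_orthant)
  qed
  have ae: "AE \<omega> in M. \<forall>k\<in>UNIV. \<xi> 0 \<omega> $ k \<noteq> x $ k"
  proof (rule AE_finite_allI)
    fix k
    have "{\<omega> \<in> space M. \<xi> 0 \<omega> $ k = x $ k} \<in> null_sets M"
      using hyperplane_null[of 0 k "x $ k"] by (auto simp: null_sets_def emeasure_eq_measure)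
    from AE_not_in[OF this] AE_space show "AE \<omega> in M. \<xi> 0 \<omega> $ k \<noteq> x $ k" by eventually_elim auto
  qed simp
  have "(\<lambda>n. expectation (\<lambda>\<omega>. indicator {y. \<forall>k. y $ k \<le> X n $ k} (\<xi> 0 \<omega>)) :: real)
      \<longlonglongrightarrow> expectation (\<lambda>\<omega>. indicator {y. \<forall>k. y $ k \<le> x $ k} (\<xi> 0 \<omega>))"
  proof (rule integral_dominated_convergence[where w = "\<lambda>_. 1"])
    show "AE \<omega> in M. (\<lambda>n. indicator {y. \<forall>k. y $ k \<le> X n $ k} (\<xi> 0 \<omega>) :: real)
        \<longlonglongrightarrow> indicator {y. \<forall>k. y $ k \<le> x $ k} (\<xi> 0 \<omega>)"
      using ae
    proof eventually_elim
      case (elim \<omega>)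
      have "\<forall>\<^sub>F n in sequentially. \<forall>k\<in>UNIV. (\<xi> 0 \<omega> $ k \<le> X n $ k \<longleftrightarrow> \<xi> 0 \<omega> $ k \<le> x $ k)"
      proof (rule eventually_ball_finite, simp, rule ballI)
        fix k
        have Xk: "(\<lambda>n. X n $ k) \<longlonglongrightarrow> x $ k" using X by (intro tendsto_vec_nth)
        show "\<forall>\<^sub>F n in sequentially. (\<xi> 0 \<omega> $ k \<le> X n $ k \<longleftrightarrow> \<xi> 0 \<omega> $ k \<le> x $ k)"
        proof (cases "\<xi> 0 \<omega> $ k < x $ k")
          case True
          then show ?thesis using order_tendstoD(1)[OF Xk True] by (auto elim!: eventually_mono)
        next
          case False
          then have "x $ k < \<xi> 0 \<omega> $ k" using elim[THEN bspec, OF UNIV_I, of k] False by linarith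
          then show ?thesis using order_tendstoD(2)[OF Xk, of "\<xi> 0 \<omega> $ k"] by (auto elim!: eventually_mono)
        qed
      qed
      then have "\<forall>\<^sub>F n in sequentially. (indicator {y. \<forall>k. y $ k \<le> X n $ k} (\<xi> 0 \<omega>) :: real) = indicator {y. \<forall>k. y $ k \<le> x $ k} (\<xi> 0 \<omega>)"
        by eventually_elim (simp add: indicator_def)
      then show ?case by (rule tendsto_eventually)
    qed
  qed auto
  then show "(F \<circ> X) \<longlonglongrightarrow> F x" by (simp add: F_eq comp_def)
qed

lemma glivenko_cantelli:
  "AE \<omega> in M. (\<lambda>n. SUP x. \<bar>Fhat n (\<lambda>i. \<xi> i \<omega>) x - F x\<bar>) \<longlonglongrightarrow> 0"
proof -
  define Q where "Q = {x :: (real, 'k) vec. \<forall>k. x $ k \<in> \<rat>}"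
  have "countable Q"
  proof -
    have "Q \<subseteq> (\<lambda>f. \<chi> k. f k) ` (\<Pi>\<^sub>E k\<in>UNIV. \<rat>)"
    proof
      fix v assume "v \<in> Q"
      then have "(\<lambda>k. v $ k) \<in> (\<Pi>\<^sub>E k\<in>UNIV. \<rat>)" by (auto simp: Q_def)
      then show "v \<in> (\<lambda>f. \<chi> k. f k) ` (\<Pi>\<^sub>E k\<in>UNIV. \<rat>)" by (rule rev_image_eqI) simp
    qed
    then show ?thesis by (rule countable_subset) (intro countable_image countable_PiE countable_rat, auto)
  qed
  then have "AE \<omega> in M. \<forall>x\<in>Q. (\<lambda>n. Fhat n (\<lambda>i. \<xi> i \<omega>) x) \<longlonglongrightarrow> F x"
  proof (subst AE_ball_countable, assumption, intro ballI)
    fix x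
    show "AE \<omega> in M. (\<lambda>n. Fhat n (\<lambda>i. \<xi> i \<omega>) x) \<longlonglongrightarrow> F x"
      using slln_frequency[OF xi_indep, of "{y. \<forall>k. y $ k \<le> x $ k}" "F x"]
      by (simp add: Fhat_def xi_orthant)
  qed
  then show ?thesis
  proof eventually_elim
    case (elim \<omega>)
    let ?e = "\<lambda>n. Fhat n (\<lambda>i. \<xi> i \<omega>)"
    \<comment> \<open>Both functions are unchanged when coordinates are clamped at 1 and vanish if
      some coordinate is negative, so the supremum over the whole space is governed by the
      cube.\<close>
    define cl :: "(real, 'k) vec \<Rightarrow> (real, 'k) vec" where "cl x = (\<chi> k. min 1 (x $ k))" for x
    have x01: "0 \<le> \<xi> i \<omega> $ k" "\<xi> i \<omega> $ k \<le> 1" for i \<omega> k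
      using xi_cube[of i \<omega>] by (auto simp: mem_box_cart)
    have cl: "?e n (cl x) = ?e n x" "F (cl x) = F x" for n x
      using x01 by (auto simp: Fhat_def cl_def xi_orthant[of 0, symmetric])
    have out: "?e n x = 0" "F x = 0" if "x $ k < 0" for n x k
    proof -
      have *: "\<not> (\<forall>k. \<xi> i \<omega> $ k \<le> x $ k)" for i \<omega>
        using x01(1)[of i \<omega> k] that by (meson leD order_trans)
      show "?e n x = 0" "F x = 0" by (simp_all add: Fhat_def xi_orthant[of 0, symmetric] *)
    qed
    show ?case
    proof (rule tendstoI)
      fix \<epsilon> :: real assume \<epsilon>: "0 < \<epsilon>"
      have "\<forall>\<^sub>F n in sequentially. \<forall>x\<in>unit_cube. \<bar>?e n x - F x\<bar> < \<epsilon> / 2"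
        by (rule polya_cube) (use elim \<epsilon> in \<open>auto intro: Fhat_mono F_mono continuous_on_subset[OF F_cont] simp: Q_def\<close>)
      then show "\<forall>\<^sub>F n in sequentially. dist (SUP x. \<bar>?e n x - F x\<bar>) 0 < \<epsilon>"
      proof eventually_elim
        case (elim n)
        have b: "\<bar>?e n x - F x\<bar> \<le> \<epsilon> / 2" for x
        proof (cases "\<exists>k. x $ k < 0")
          case True
          then show ?thesis using out \<epsilon> by auto
        next
          case False
          then have "cl x \<in> unit_cube" by (auto simp: mem_box_cart cl_def not_less)
          then have "\<bar>?e n (cl x) - F (cl x)\<bar> < \<epsilon> / 2" using elim by blast
          then show ?thesis by (simp add: cl)
        qed
        have bdd: "bdd_above (range (\<lambda>x. \<bar>?e n x - F x\<bar>))"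
          by (rule bdd_aboveI2, rule b)
        have "(SUP x. \<bar>?e n x - F x\<bar>) \<le> \<epsilon> / 2" by (rule cSUP_least[OF UNIV_not_empty b])
        moreover have "0 \<le> (SUP x. \<bar>?e n x - F x\<bar>)"
          by (rule order_trans[OF abs_ge_zero cSUP_upper[OF UNIV_I[of 0] bdd]])
        ultimately show ?case using \<epsilon> by (simp add: dist_real_def)
      qed
    qed
  qed
qed

section \<open>Counts of p-values and the BH threshold along convergent samples\<close>

lemma sup_Fhat_tendsto:
  assumes "(\<lambda>j. SUP x. \<bar>Fhat (m j) (S j) x - F x\<bar>) \<longlonglongrightarrow> 0"
  shows "(\<lambda>j. Fhat (m j) (S j) x) \<longlonglongrightarrow> F x"
proof (rule LIM_zero_cancel, rule Lim_null_comparison[OF _ assms])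
  have "\<bar>Fhat (m j) (S j) x - F x\<bar> \<le> (SUP x. \<bar>Fhat (m j) (S j) x - F x\<bar>)" for j
  proof (rule cSUP_upper)
    \<comment> \<open>Boundedness makes \<open>SUP\<close> a genuine upper bound; the supremum of an
      unbounded set of reals is unspecified.\<close>
    have "0 \<le> F y \<and> F y \<le> 1" for y unfolding xi_orthant[of 0, symmetric] by simp
    moreover have "0 \<le> Fhat (m j) (S j) y \<and> Fhat (m j) (S j) y \<le> 1" for y
    proof -
      have "card {i \<in> {..<m j}. \<forall>k. S j i $ k \<le> y $ k} \<le> m j"
        by (rule order_trans[OF card_mono[of "{..<m j}"]]) auto
      then show ?thesis by (auto simp: Fhat_def divide_le_eq_1)
    qed
    ultimately show "bdd_above (range (\<lambda>x. \<bar>Fhat (m j) (S j) x - F x\<bar>))"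
      by (intro bdd_aboveI[of _ 1]) (auto simp: abs_le_iff, (smt (verit))+)
  qed simp
  then show "\<forall>\<^sub>F j in sequentially. norm (Fhat (m j) (S j) x - F x) \<le> (SUP x. \<bar>Fhat (m j) (S j) x - F x\<bar>)"
    by simp
qed

text \<open>Inside \<open>E\<close> the sets where \<open>g\<close> is above and below
  \<open>lev t\<close> are open, so \<open>portmanteau_open\<close> bounds both frequencies from
  below. The limiting probabilities \<open>H t\<close> and \<open>1 - H t\<close> add up to 1, hence
  each lower bound is an upper bound for the other count. The tuples are deterministic: this serves
  condition (B) for the procedure and, along almost every realisation, the limit theorems.\<close>

lemma empirical_pval:
  assumes m: "filterlim m at_top sequentially"
    and S: "\<And>j i. i < m j \<Longrightarrow> S j i \<in> unit_cube"
    and conv: "\<And>x. (\<lambda>j. Fhat (m j) (S j) x) \<longlonglongrightarrow> F x"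
    and t: "0 \<le> t" "t \<le> 1"
  shows "(\<lambda>j. real (count_le (m j) (\<lambda>i. pval (S j i)) t) / m j) \<longlonglongrightarrow> H t"
proof -
  define \<mu> where "\<mu> = distr M borel (\<xi> 0)"
  define \<nu> where "\<nu> j = distr (uniform_count_measure {..<m j}) borel (S j)" for j
  have S_meas: "S j \<in> measurable (uniform_count_measure {..<m j}) borel" for j
    by (auto simp: measurable_def sets_uniform_count_measure space_uniform_count_measure)
  have \<mu>: "measure \<mu> B = prob {\<omega> \<in> space M. \<xi> 0 \<omega> \<in> B}" if "B \<in> sets borel" for B
    unfolding \<mu>_def using that by (subst measure_distr) (auto intro!: arg_cong[where f = prob])
  have \<nu>: "measure (\<nu> j) B = card {i \<in> {..<m j}. S j i \<in> B} / m j" if "B \<in> sets borel" for B j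
  proof -
    have "S j -` B \<inter> space (uniform_count_measure {..<m j}) = {i \<in> {..<m j}. S j i \<in> B}"
      by (auto simp: space_uniform_count_measure)
    then show ?thesis
      unfolding \<nu>_def using that S_meas by (subst measure_distr, simp_all, subst measure_uniform_count_measure, auto)
  qed
  have fin: "finite_measure \<mu>" "finite_measure (\<nu> j)" for j
  proof -
    show "finite_measure \<mu>" unfolding \<mu>_def by (intro finite_measure_distr) simp
    have "finite_measure (uniform_count_measure {..<m j})"
      by (rule finite_measureI) (simp add: space_uniform_count_measure emeasure_uniform_count_measure)
    then show "finite_measure (\<nu> j)" unfolding \<nu>_def by (intro finite_measure.finite_measure_distr S_meas)
  qed
  have open_lower: "\<forall>\<^sub>F j in sequentially. c < card {i \<in> {..<m j}. S j i \<in> V} / m j"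
    if V: "open V" and c: "c < prob {\<omega> \<in> space M. \<xi> 0 \<omega> \<in> V}" for V c
  proof -
    have [measurable]: "V \<in> sets borel" using V by simp
    have "\<forall>\<^sub>F j in sequentially. c < measure (\<nu> j) V"
    proof (rule portmanteau_open[OF fin _ _ _ V])
      show "(\<lambda>j. measure (\<nu> j) {y. \<forall>k. y $ k \<le> x $ k}) \<longlonglongrightarrow> measure \<mu> {y. \<forall>k. y $ k \<le> x $ k}" for x
        using conv[of x] by (simp add: \<mu> \<nu> xi_orthant Fhat_def)
    qed (use c in \<open>auto simp: \<mu>\<close>, simp_all add: \<mu>_def \<nu>_def)
    then show ?thesis by (simp add: \<nu>)
  qed
  have E_sets [measurable]: "E \<in> sets borel" using E_open by simp
  have E_xi: "prob {\<omega> \<in> space M. \<xi> 0 \<omega> \<notin> E} = 0"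
  proof -
    have "U.prob (- E) = 0" using U.prob_compl[of E] E_full by (simp add: Compl_eq_Diff_UNIV)
    from xi_null[OF _ this] show ?thesis by simp
  qed
  have m_pos: "\<forall>\<^sub>F j in sequentially. 0 < m j"
    by (rule eventually_compose_filterlim[OF eventually_gt_at_top m])
  have upper: "\<forall>\<^sub>F j in sequentially. real (count_le (m j) (\<lambda>i. pval (S j i)) t) / m j < c"
    and lower: "\<And>c. c < H t \<Longrightarrow> \<forall>\<^sub>F j in sequentially. c < real (count_le (m j) (\<lambda>i. pval (S j i)) t) / m j"
    if t: "0 < t" "t \<le> 1" and c: "H t < c" for t c
  proof -
    note l = lev_pos[OF t]
    have lv: "lev t \<le> g x \<longleftrightarrow> pval x \<le> t" if "x \<in> unit_cube" for x
      using l(3)[of "g x"] g_nonneg[of x] hfun_antimono[of "lev t" "g x"] l(2) that by (auto simp: pval_def)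
    have level: "prob {\<omega> \<in> space M. g (\<xi> 0 \<omega>) = lev t} = 0"
      using xi_null[of "{x. g x = lev t}" 0] prob_level_set[OF l(1)] by simp
    have "{x \<in> E. lev t < g x} = E \<inter> g -` {lev t<..}" "{x \<in> E. g x < lev t} = E \<inter> g -` {..<lev t}" by auto
    then have op: "open {x \<in> E. lev t < g x}" "open {x \<in> E. g x < lev t}"
      using continuous_open_preimage[OF g_cont E_open] by simp_all
    have ae: "AE \<omega> in M. \<xi> 0 \<omega> \<in> E \<and> g (\<xi> 0 \<omega>) \<noteq> lev t"
    proof -
      have "{\<omega> \<in> space M. \<xi> 0 \<omega> \<notin> E} \<in> null_sets M" "{\<omega> \<in> space M. g (\<xi> 0 \<omega>) = lev t} \<in> null_sets M"
        using E_xi level by (auto simp: null_sets_def emeasure_eq_measure)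
      from this[THEN AE_not_in] AE_space show ?thesis by eventually_elim auto
    qed
    have p1: "prob {\<omega> \<in> space M. \<xi> 0 \<omega> \<in> {x \<in> E. lev t < g x}} = H t"
      unfolding pval_law(3)[of t 0, OF less_imp_le[OF t(1)] t(2), symmetric]
      using ae by (intro finite_measure_eq_AE) (auto simp: lv[OF xi_cube, symmetric])
    have p2: "prob {\<omega> \<in> space M. \<xi> 0 \<omega> \<in> {x \<in> E. g x < lev t}} = 1 - H t"
    proof -
      have "prob {\<omega> \<in> space M. \<xi> 0 \<omega> \<in> {x \<in> E. g x < lev t}} = prob (space M - {\<omega> \<in> space M. pval (\<xi> 0 \<omega>) \<le> t})"
        using ae by (intro finite_measure_eq_AE) (auto simp: lv[OF xi_cube, symmetric] not_le)
      then show ?thesis using pval_law(3)[of t 0] t by (subst (asm) prob_compl) auto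
    qed
    show "\<forall>\<^sub>F j in sequentially. c < real (count_le (m j) (\<lambda>i. pval (S j i)) t) / m j" if "c < H t" for c
      using open_lower[OF op(1), of c, unfolded p1, OF that]
    proof eventually_elim
      case (elim j)
      have "card {i \<in> {..<m j}. S j i \<in> {x \<in> E. lev t < g x}} \<le> count_le (m j) (\<lambda>i. pval (S j i)) t"
        unfolding count_le_def using S by (intro card_mono) (auto simp: lv[symmetric])
      then have "card {i \<in> {..<m j}. S j i \<in> {x \<in> E. lev t < g x}} / m j \<le> real (count_le (m j) (\<lambda>i. pval (S j i)) t) / m j"
        by (intro divide_right_mono) auto
      with elim show ?case by linarith
    qed
    have "1 - c < 1 - H t" using c by simp
    from open_lower[OF op(2), of "1 - c", unfolded p2, OF this] m_pos
    show "\<forall>\<^sub>F j in sequentially. real (count_le (m j) (\<lambda>i. pval (S j i)) t) / m j < c"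
    proof eventually_elim
      case (elim j)
      have "card {i \<in> {..<m j}. S j i \<in> {x \<in> E. g x < lev t}} + count_le (m j) (\<lambda>i. pval (S j i)) t
          = card ({i \<in> {..<m j}. S j i \<in> {x \<in> E. g x < lev t}} \<union> {i \<in> {..<m j}. pval (S j i) \<le> t})"
        unfolding count_le_def using S by (subst card_Un_disjoint) (auto simp: lv[symmetric])
      also have "\<dots> \<le> m j" by (rule order_trans[OF card_mono[of "{..<m j}"]]) auto
      finally have "real (card {i \<in> {..<m j}. S j i \<in> {x \<in> E. g x < lev t}}) / m j + real (count_le (m j) (\<lambda>i. pval (S j i)) t) / m j \<le> 1"
        using elim(2) by (simp add: add_divide_distrib[symmetric] divide_le_eq_1)
      with elim(1) show ?case by linarith
    qed
  qed
  show ?thesis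
  proof (cases "t = 0")
    case False
    then show ?thesis using t by (intro order_tendstoI) (auto intro: upper lower[of t "H t + 1"])
  next
    case True
    show ?thesis
    proof (rule order_tendstoI)
      fix c assume "c < H t"
      then have "c < 0" using True by (simp add: H_0)
      then show "\<forall>\<^sub>F j in sequentially. c < real (count_le (m j) (\<lambda>i. pval (S j i)) t) / m j"
        by (intro always_eventually allI) (rule less_le_trans, auto)
    next
      fix c assume "H t < c"
      then have c: "0 < c" using True by (simp add: H_0)
      \<comment> \<open>At \<open>t = 0\<close> there may be no finite level, so the count is
        bounded by that at a small positive point, and \<open>H\<close> is continuous at 0.\<close>
      have "(\<lambda>n. H (1 / Suc n)) \<longlonglongrightarrow> H 0"
        by (rule continuous_on_tendsto_compose[OF H_cont LIMSEQ_inverse_real_of_nat[unfolded inverse_eq_divide]]) auto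
      then have "\<forall>\<^sub>F n in sequentially. H (1 / Suc n) < c" using c by (intro order_tendstoD(2)) (auto simp: H_0)
      then obtain n where n: "H (1 / Suc n) < c" by (auto simp: eventually_sequentially)
      have "\<forall>\<^sub>F j in sequentially. real (count_le (m j) (\<lambda>i. pval (S j i)) (1 / Suc n)) / m j < c"
        using n by (intro upper) auto
      then show "\<forall>\<^sub>F j in sequentially. real (count_le (m j) (\<lambda>i. pval (S j i)) t) / m j < c"
      proof eventually_elim
        case (elim j)
        have "count_le (m j) (\<lambda>i. pval (S j i)) t \<le> count_le (m j) (\<lambda>i. pval (S j i)) (1 / Suc n)"
          using True by (intro count_le_mono) auto
        then have "real (count_le (m j) (\<lambda>i. pval (S j i)) t) / m j \<le> real (count_le (m j) (\<lambda>i. pval (S j i)) (1 / Suc n)) / m j"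
          by (intro divide_right_mono) auto
        with elim show ?case by linarith
      qed
    qed
  qed
qed

text \<open>Polya's theorem in dimension 1, with \<open>real ^ 1\<close> standing for the
  line.\<close>

lemma empirical_pval_uniform:
  assumes m: "filterlim m at_top sequentially"
    and S: "\<And>j i. i < m j \<Longrightarrow> S j i \<in> unit_cube"
    and conv: "\<And>x. (\<lambda>j. Fhat (m j) (S j) x) \<longlonglongrightarrow> F x" and \<epsilon>: "0 < \<epsilon>"
  shows "\<forall>\<^sub>F j in sequentially. \<forall>t\<in>{0..1}. \<bar>real (count_le (m j) (\<lambda>i. pval (S j i)) t) / m j - H t\<bar> < \<epsilon>"
proof -
  let ?e = "\<lambda>j x. real (count_le (m j) (\<lambda>i. pval (S j i)) (x $ 1)) / m j" and ?F = "\<lambda>x. H (x $ 1)"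
  have "\<forall>\<^sub>F j in sequentially. \<forall>x\<in>(unit_cube :: (real, 1) vec set). \<bar>?e j x - ?F x\<bar> < \<epsilon>"
  proof (rule polya_cube[OF _ _ _ _ \<epsilon>])
    show "x \<le> y \<Longrightarrow> ?e j x \<le> ?e j y" for x y :: "(real, 1) vec" and j
      by (intro divide_right_mono of_nat_mono count_le_mono) (auto simp: less_eq_vec_def)
    show "x \<le> y \<Longrightarrow> ?F x \<le> ?F y" for x y :: "(real, 1) vec"
      by (intro H_mono) (auto simp: less_eq_vec_def)
    show "continuous_on unit_cube (?F :: (real, 1) vec \<Rightarrow> real)"
      by (rule continuous_on_compose2[OF H_cont]) (auto intro!: continuous_intros simp: mem_box_cart)
    show "(\<lambda>j. ?e j x) \<longlonglongrightarrow> ?F x" if "\<forall>k. x $ k \<in> \<rat> \<inter> {0..1}" for x :: "(real, 1) vec"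
      using that by (intro empirical_pval[OF m S conv]) auto
  qed
  then show ?thesis
  proof eventually_elim
    case (elim j)
    show ?case
    proof
      fix t :: real assume "t \<in> {0..1}"
      then have "(\<chi> i. t) \<in> (unit_cube :: (real, 1) vec set)" by (auto simp: mem_box_cart)
      from elim[rule_format, OF this]
      show "\<bar>real (count_le (m j) (\<lambda>i. pval (S j i)) t) / m j - H t\<bar> < \<epsilon>" by simp
    qed
  qed
qed

text \<open>A fixed \<open>t\<close> slightly below \<open>tstar \<alpha>\<close> is eventually
  admissible. Above it, \<open>s / \<alpha> - H s\<close> has a positive minimum \<open>d\<close> on
  a compact interval, and a uniform error smaller than \<open>d\<close> excludes all thresholds
  there.\<close>

lemma bh_threshold_tendsto:
  assumes m: "filterlim m at_top sequentially"
    and S: "\<And>j i. i < m j \<Longrightarrow> S j i \<in> unit_cube"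
    and conv: "\<And>x. (\<lambda>j. Fhat (m j) (S j) x) \<longlonglongrightarrow> F x"
    and \<alpha>: "0 < \<alpha>" "\<alpha> < 1"
  shows "(\<lambda>j. \<alpha> * bh_rank \<alpha> (m j) (\<lambda>i. pval (S j i)) / m j) \<longlonglongrightarrow> tstar \<alpha>"
proof (rule order_tendstoI)
  let ?c = "\<lambda>j t. count_le (m j) (\<lambda>i. pval (S j i)) t"
  let ?\<rho> = "\<lambda>j. bh_rank \<alpha> (m j) (\<lambda>i. pval (S j i))"
  note ts = tstar[OF \<alpha>]
  have m_pos: "\<forall>\<^sub>F j in sequentially. 1 \<le> m j"
    by (rule eventually_compose_filterlim[OF eventually_ge_at_top m])
  fix b assume b: "b < tstar \<alpha>"
  show "\<forall>\<^sub>F j in sequentially. b < \<alpha> * ?\<rho> j / m j"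
  proof (cases "b < 0")
    case True
    then show ?thesis using \<alpha> by (intro always_eventually allI less_le_trans[OF True]) auto
  next
    case False
    define t where "t = (b + tstar \<alpha>) / 2"
    have t: "b < t" "0 < t" "t < tstar \<alpha>" "t \<le> 1" using b False ts(2) by (auto simp: t_def)
    have "t / \<alpha> < H t" using ts(5)[OF t(2,3)] \<alpha> by (simp add: field_simps)
    then have "\<forall>\<^sub>F j in sequentially. t / \<alpha> < real (?c j t) / m j"
      using t by (intro order_tendstoD(1)[OF empirical_pval[OF m S conv]]) auto
    then show ?thesis using m_pos
    proof eventually_elim
      case (elim j)
      have "real (?c j t) / m j \<le> max (real (?c j t)) 1 / m j" by (intro divide_right_mono) auto
      with elim have "t \<le> \<alpha> * ?\<rho> j / m j" by (intro bh_level \<alpha>(1)) auto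
      with t show ?case by simp
    qed
  qed
next
  let ?c = "\<lambda>j t. count_le (m j) (\<lambda>i. pval (S j i)) t"
  let ?\<rho> = "\<lambda>j. bh_rank \<alpha> (m j) (\<lambda>i. pval (S j i))"
  note ts = tstar[OF \<alpha>]
  have m_pos: "\<forall>\<^sub>F j in sequentially. 1 \<le> m j"
    by (rule eventually_compose_filterlim[OF eventually_ge_at_top m])
  fix b assume b: "tstar \<alpha> < b"
  define t where "t = min b 1"
  have t: "tstar \<alpha> < t" "t \<le> b" "t \<le> 1" "0 < t" using b ts(1,2) by (auto simp: t_def)
  have "continuous_on {t..1} (\<lambda>s. s / \<alpha> - H s)"
    using \<alpha> t by (intro continuous_intros continuous_on_subset[OF H_cont]) auto
  then obtain s0 where s0: "s0 \<in> {t..1}" "\<And>s. s \<in> {t..1} \<Longrightarrow> s0 / \<alpha> - H s0 \<le> s / \<alpha> - H s"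
    using continuous_attains_inf[of "{t..1}" "\<lambda>s. s / \<alpha> - H s"] t by auto
  define d where "d = s0 / \<alpha> - H s0"
  have d: "0 < d" using ts(4)[of s0] s0(1) t \<alpha> by (simp add: d_def field_simps)
  have inv: "(\<lambda>j. 1 / real (m j)) \<longlonglongrightarrow> 0"
    using filterlim_compose[OF lim_1_over_n m] by simp
  \<comment> \<open>Rank 1 need not be supported by any p-value, so the comparison with the counts
    says nothing about it; its threshold \<open>\<alpha> / m j\<close> is small enough on its
    own.\<close>
  have "\<forall>\<^sub>F j in sequentially. 1 / real (m j) < t / \<alpha>"
    using t \<alpha> by (intro order_tendstoD(2)[OF inv]) auto
  moreover have "\<forall>\<^sub>F j in sequentially. \<forall>t\<in>{0..1}. \<bar>real (?c j t) / m j - H t\<bar> < d"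
    by (rule empirical_pval_uniform[OF m S conv d])
  ultimately
  show "\<forall>\<^sub>F j in sequentially. \<alpha> * ?\<rho> j / m j < b"
    using m_pos
  proof eventually_elim
    case (elim j)
    have \<rho>: "?\<rho> j \<in> {1..m j}" by (rule bh_rank_in(1)[OF elim(3)])
    define s where "s = \<alpha> * ?\<rho> j / m j"
    have "\<alpha> * ?\<rho> j \<le> 1 * real (m j)" using \<rho> \<alpha> by (intro mult_mono) auto
    then have s1: "s \<le> 1" using elim by (simp add: s_def divide_le_eq_1)
    have s_\<alpha>: "s / \<alpha> = real (?\<rho> j) / m j" using \<alpha> by (simp add: s_def)
    show ?case
    proof (rule ccontr)
      assume "\<not> ?case"
      then have "t \<le> s" using t by (simp add: s_def)
      then have s: "s \<in> {t..1}" using s1 by simp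
      have "?\<rho> j = 1 \<or> ?\<rho> j \<le> ?c j s" using bh_rank_in(2)[OF elim(3)] unfolding s_def by blast
      then show False
      proof
        assume "?\<rho> j = 1"
        then have "s / \<alpha> < t / \<alpha>" using elim(1) s_\<alpha> by simp
        then show False using s \<alpha> by (simp add: divide_less_cancel)
      next
        assume "?\<rho> j \<le> ?c j s"
        then have "s / \<alpha> \<le> real (?c j s) / m j" unfolding s_\<alpha> by (intro divide_right_mono) auto
        moreover have "\<bar>real (?c j s) / m j - H s\<bar> < d" using elim(2) s t by auto
        moreover have "d \<le> s / \<alpha> - H s" unfolding d_def by (rule s0(2)[OF s])
        ultimately show False by linarith
      qed
    qed
  qed
qed

lemma bh_rejections_tendsto:
  assumes m: "filterlim m at_top sequentially"
    and S: "\<And>j i. i < m j \<Longrightarrow> S j i \<in> unit_cube"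
    and conv: "\<And>x. (\<lambda>j. Fhat (m j) (S j) x) \<longlonglongrightarrow> F x"
    and \<alpha>: "0 < \<alpha>" "\<alpha> < 1"
  shows "(\<lambda>j. real (card (BH_reject \<alpha> (m j) (\<lambda>i. pval (S j i)))) / m j) \<longlonglongrightarrow> tstar \<alpha> / \<alpha>"
proof -
  let ?\<rho> = "\<lambda>j. bh_rank \<alpha> (m j) (\<lambda>i. pval (S j i))"
  have m_pos: "\<forall>\<^sub>F j in sequentially. 1 \<le> m j"
    by (rule eventually_compose_filterlim[OF eventually_ge_at_top m])
  have 1: "(\<lambda>j. \<alpha> * ?\<rho> j / m j / \<alpha>) \<longlonglongrightarrow> tstar \<alpha> / \<alpha>"
    using \<alpha> by (intro tendsto_divide bh_threshold_tendsto[OF assms] tendsto_const) auto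
  have inv: "(\<lambda>j. 1 / real (m j)) \<longlonglongrightarrow> 0"
    using filterlim_compose[OF lim_1_over_n m] by simp
  have "\<forall>\<^sub>F j in sequentially. norm (real (card (BH_reject \<alpha> (m j) (\<lambda>i. pval (S j i)))) / m j - \<alpha> * ?\<rho> j / m j / \<alpha>) \<le> 1 / m j"
    using m_pos
  proof eventually_elim
    case (elim j)
    have "max (card (BH_reject \<alpha> (m j) (\<lambda>i. pval (S j i)))) 1 = ?\<rho> j"
      using \<alpha> by (intro card_BH_reject[OF elim]) auto
    then have "\<bar>real (card (BH_reject \<alpha> (m j) (\<lambda>i. pval (S j i)))) - real (?\<rho> j)\<bar> \<le> 1" by auto
    then have "\<bar>(real (card (BH_reject \<alpha> (m j) (\<lambda>i. pval (S j i)))) - real (?\<rho> j)) / m j\<bar> \<le> 1 / m j"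
      by (simp add: abs_divide divide_right_mono)
    then show ?case using \<alpha> by (simp add: diff_divide_distrib)
  qed
  from tendsto_add[OF Lim_null_comparison[OF this inv] 1] show ?thesis by simp
qed

lemma xi_empirical:
  "AE \<omega> in M. \<forall>x. (\<lambda>n. Fhat n (\<lambda>i. \<xi> i \<omega>) x) \<longlonglongrightarrow> F x"
  using glivenko_cantelli
proof eventually_elim
  case (elim \<omega>)
  show ?case using sup_Fhat_tendsto[of "\<lambda>j. j" "\<lambda>j i. \<xi> i \<omega>", OF elim] by simp
qed

abbreviation BH_xi :: "real \<Rightarrow> nat \<Rightarrow> 'w \<Rightarrow> nat set" where
  "BH_xi \<alpha> n \<omega> \<equiv> BH_reject \<alpha> n (\<lambda>i. pval (\<xi> i \<omega>))"

section \<open>The procedure satisfies (A), (B) and the FDR bound\<close>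

lemma subalgebra_xi: "subalgebra M (sigma_xi M \<xi> n)"
proof -
  have "(\<lambda>\<omega>. \<lambda>i\<in>{..<n}. \<xi> i \<omega>) \<in> M \<rightarrow>\<^sub>M (\<Pi>\<^sub>M i\<in>{..<n}. borel)" by measurable
  from sets_image_in_sets[OF refl this] show ?thesis by (simp add: subalgebra_def sigma_xi_def)
qed

lemma subalgebra_xi_theta: "subalgebra M (sigma_xi_theta M \<xi> \<theta> n)"
proof -
  have "(\<lambda>\<omega>. \<lambda>i\<in>{..<n}. (\<xi> i \<omega>, \<theta> i \<omega>)) \<in> M \<rightarrow>\<^sub>M (\<Pi>\<^sub>M i\<in>{..<n}. borel \<Otimes>\<^sub>M count_space UNIV)"
    by measurable
  from sets_image_in_sets[OF refl this] show ?thesis by (simp add: subalgebra_def sigma_xi_theta_def)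
qed

lemma finite_measure_subalgebra_xi: "finite_measure_subalgebra M (sigma_xi M \<xi> n)"
  and finite_measure_subalgebra_xi_theta: "finite_measure_subalgebra M (sigma_xi_theta M \<xi> \<theta> n)"
  using subalgebra_xi subalgebra_xi_theta
  by (auto simp: finite_measure_subalgebra_def finite_measure_subalgebra_axioms_def finite_measure_axioms)

lemma xi_measurable_sigma_xi:
  assumes "i < n"
  shows "\<xi> i \<in> borel_measurable (sigma_xi M \<xi> n)"
proof -
  have "(\<lambda>\<omega>. \<lambda>i\<in>{..<n}. \<xi> i \<omega>) \<in> sigma_xi M \<xi> n \<rightarrow>\<^sub>M (\<Pi>\<^sub>M i\<in>{..<n}. borel)"
    unfolding sigma_xi_def by (rule measurable_vimage_algebra1) (auto simp: space_PiM)
  from measurable_compose[OF this measurable_component_singleton[of i]] show ?thesis using assms by simp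
qed

lemma xi_theta_measurable_sigma_xi_theta:
  assumes "i < n"
  shows "\<xi> i \<in> borel_measurable (sigma_xi_theta M \<xi> \<theta> n)"
    and "\<theta> i \<in> sigma_xi_theta M \<xi> \<theta> n \<rightarrow>\<^sub>M count_space UNIV"
proof -
  have "(\<lambda>\<omega>. \<lambda>i\<in>{..<n}. (\<xi> i \<omega>, \<theta> i \<omega>)) \<in> sigma_xi_theta M \<xi> \<theta> n
      \<rightarrow>\<^sub>M (\<Pi>\<^sub>M i\<in>{..<n}. borel \<Otimes>\<^sub>M count_space UNIV)"
    unfolding sigma_xi_theta_def by (rule measurable_vimage_algebra1) (auto simp: space_PiM space_pair_measure)
  from measurable_compose[OF this measurable_component_singleton[of i]]
  have "(\<lambda>\<omega>. (\<xi> i \<omega>, \<theta> i \<omega>)) \<in> sigma_xi_theta M \<xi> \<theta> n \<rightarrow>\<^sub>M borel \<Otimes>\<^sub>M count_space UNIV"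
    using assms by simp
  from measurable_fst'[OF this] measurable_snd'[OF this]
  show "\<xi> i \<in> borel_measurable (sigma_xi_theta M \<xi> \<theta> n)"
    "\<theta> i \<in> sigma_xi_theta M \<xi> \<theta> n \<rightarrow>\<^sub>M count_space UNIV" by simp_all
qed

text \<open>The decision is a function of the p-values, so its indicator is its own conditional
  expectation given any \<open>N\<close> that sees them. Leaving \<open>N\<close> general covers
  both sigma-algebras of condition (A).\<close>

lemma BH_xi_cond_exp:
  assumes n: "1 \<le> n" and \<alpha>: "0 < \<alpha>" "\<alpha> \<le> 1"
    and F: "finite_measure_subalgebra M N" and xi: "\<And>i. i < n \<Longrightarrow> \<xi> i \<in> borel_measurable N"
  shows "AE \<omega> in M. real_cond_exp M N (indicator {\<omega> \<in> space M. BH_xi \<alpha> n \<omega> = D}) \<omega> = indicator {\<omega> \<in> space M. BH_xi \<alpha> n \<omega> = D} \<omega>"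
proof -
  interpret F: finite_measure_subalgebra M N by (rule F)
  have sp: "space N = space M" using F.subalg by (simp add: subalgebra_def)
  have "(\<lambda>\<omega>. BH_xi \<alpha> n \<omega>) \<in> N \<rightarrow>\<^sub>M count_space (Pow {..<n})"
    using xi by (intro BH_reject_measurable[OF n \<alpha>]) simp
  then have "(\<lambda>\<omega>. BH_xi \<alpha> n \<omega>) -` ({D} \<inter> Pow {..<n}) \<inter> space N \<in> sets N"
    by (rule measurable_sets) simp
  also have "(\<lambda>\<omega>. BH_xi \<alpha> n \<omega>) -` ({D} \<inter> Pow {..<n}) \<inter> space N = {\<omega> \<in> space M. BH_xi \<alpha> n \<omega> = D}"
    using BH_reject_subset[of \<alpha> n] by (auto simp: sp)
  finally have D: "{\<omega> \<in> space M. BH_xi \<alpha> n \<omega> = D} \<in> sets N" .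
  moreover have "{\<omega> \<in> space M. BH_xi \<alpha> n \<omega> = D} \<in> events"
    using D F.subalg by (auto simp: subalgebra_def)
  ultimately show ?thesis
    by (intro F.real_cond_exp_F_meas) (auto simp: emeasure_eq_measure)
qed

lemma testing_procedure_BH:
  assumes \<alpha>: "0 < \<alpha>" "\<alpha> < 1"
  shows "testing_procedure M \<xi> (\<lambda>n S. return_pmf (BH_reject \<alpha> n (\<lambda>i. pval (S i)))) (BH_xi \<alpha>)"
  unfolding testing_procedure_def
proof (intro allI impI conjI ballI)
  fix n :: nat assume n: "1 \<le> n"
  note BHm = BH_reject_measurable[OF n \<alpha>(1) less_imp_le[OF \<alpha>(2)]]
  show "set_pmf (return_pmf (BH_reject \<alpha> n (\<lambda>i. pval (S i)))) \<subseteq> Pow {..<n}" for S :: "nat \<Rightarrow> (real, 'k) vec"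
    using BH_reject_subset by auto
  show "BH_xi \<alpha> n \<in> M \<rightarrow>\<^sub>M count_space (Pow {..<n})"
    by (rule BHm) simp
  show "AE \<omega> in M. real_cond_exp M (sigma_xi M \<xi> n) (indicator {\<omega> \<in> space M. BH_xi \<alpha> n \<omega> = D}) \<omega>
      = pmf (return_pmf (BH_reject \<alpha> n (\<lambda>i. pval ((\<lambda>i\<in>{..<n}. \<xi> i \<omega>) i)))) D" for D
  proof -
    have "AE \<omega> in M. real_cond_exp M (sigma_xi M \<xi> n) (indicator {\<omega> \<in> space M. BH_xi \<alpha> n \<omega> = D}) \<omega>
        = indicator {\<omega> \<in> space M. BH_xi \<alpha> n \<omega> = D} \<omega>"
      using \<alpha> by (intro BH_xi_cond_exp n finite_measure_subalgebra_xi xi_measurable_sigma_xi) auto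
    then show ?thesis
      using AE_space
    proof eventually_elim
      case (elim \<omega>)
      have "BH_reject \<alpha> n (\<lambda>i. pval ((\<lambda>i\<in>{..<n}. \<xi> i \<omega>) i)) = BH_xi \<alpha> n \<omega>"
        by (rule BH_reject_cong) simp
      then show ?case using elim by (simp add: indicator_def)
    qed
  qed
  show "(\<lambda>S. pmf (return_pmf (BH_reject \<alpha> n (\<lambda>i. pval (S i)))) D)
      \<in> borel_measurable (restrict_space (\<Pi>\<^sub>M i\<in>{..<n}. borel) ({..<n} \<rightarrow>\<^sub>E unit_cube))" for D
  proof (rule measurable_restrict_space1)
    let ?P = "\<Pi>\<^sub>M i\<in>{..<n}. (borel :: (real, 'k) vec measure)"
    have "(\<lambda>S. BH_reject \<alpha> n (\<lambda>i. pval (S i))) \<in> ?P \<rightarrow>\<^sub>M count_space (Pow {..<n})"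
      by (rule BHm) (auto intro!: measurable_compose[OF measurable_component_singleton])
    then have "(\<lambda>S. indicator {D} (BH_reject \<alpha> n (\<lambda>i. pval (S i))) :: real) \<in> borel_measurable ?P"
      by (rule measurable_compose) simp
    then show "(\<lambda>S. pmf (return_pmf (BH_reject \<alpha> n (\<lambda>i. pval (S i)))) D) \<in> borel_measurable ?P"
      by (rule measurable_cong[THEN iffD1, rotated]) (simp add: indicator_def)
  qed
qed

lemma condition_A_BH:
  assumes \<alpha>: "0 < \<alpha>" "\<alpha> < 1"
  shows "condition_A M \<xi> \<theta> (BH_xi \<alpha>)"
  unfolding condition_A_def
proof (intro allI impI)
  fix n :: nat and D assume n: "1 \<le> n"
  have "AE \<omega> in M. real_cond_exp M (sigma_xi M \<xi> n) (indicator {\<omega> \<in> space M. BH_xi \<alpha> n \<omega> = D}) \<omega>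
        = indicator {\<omega> \<in> space M. BH_xi \<alpha> n \<omega> = D} \<omega>"
    using \<alpha> by (intro BH_xi_cond_exp n finite_measure_subalgebra_xi xi_measurable_sigma_xi) auto
  moreover have "AE \<omega> in M. real_cond_exp M (sigma_xi_theta M \<xi> \<theta> n) (indicator {\<omega> \<in> space M. BH_xi \<alpha> n \<omega> = D}) \<omega>
        = indicator {\<omega> \<in> space M. BH_xi \<alpha> n \<omega> = D} \<omega>"
    using \<alpha> by (intro BH_xi_cond_exp n finite_measure_subalgebra_xi_theta xi_theta_measurable_sigma_xi_theta) auto
  ultimately show "AE \<omega> in M. real_cond_exp M (sigma_xi_theta M \<xi> \<theta> n) (indicator {\<omega> \<in> space M. BH_xi \<alpha> n \<omega> = D}) \<omega>
      = real_cond_exp M (sigma_xi M \<xi> n) (indicator {\<omega> \<in> space M. BH_xi \<alpha> n \<omega> = D}) \<omega>"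
    by eventually_elim simp
qed

lemma condition_B_BH:
  assumes \<alpha>: "0 < \<alpha>" "\<alpha> < 1"
  shows "condition_B F (\<lambda>n S. return_pmf (BH_reject \<alpha> n (\<lambda>i. pval (S i))))"
  unfolding condition_B_def
proof (intro allI impI exI[of _ "tstar \<alpha> / \<alpha>"])
  fix m :: "nat \<Rightarrow> nat" and S :: "nat \<Rightarrow> nat \<Rightarrow> (real, 'k) vec" and \<epsilon> :: real
  assume m: "filterlim m at_top sequentially" and S: "\<forall>j. S j \<in> {..<m j} \<rightarrow>\<^sub>E unit_cube"
    and lim: "(\<lambda>j. SUP x. \<bar>Fhat (m j) (S j) x - F x\<bar>) \<longlonglongrightarrow> 0" and \<epsilon>: "0 < \<epsilon>"
  have "(\<lambda>j. real (card (BH_reject \<alpha> (m j) (\<lambda>i. pval (S j i)))) / m j) \<longlonglongrightarrow> tstar \<alpha> / \<alpha>"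
    using S by (intro bh_rejections_tendsto[OF m] sup_Fhat_tendsto[OF lim] \<alpha>) (auto simp: PiE_iff)
  from tendstoD[OF this \<epsilon>]
  show "(\<lambda>j. measure_pmf.prob (return_pmf (BH_reject \<alpha> (m j) (\<lambda>i. pval (S j i))))
      {D. \<epsilon> < \<bar>real (card D) / real (m j) - tstar \<alpha> / \<alpha>\<bar>}) \<longlonglongrightarrow> 0"
    by (intro tendsto_eventually) (auto elim!: eventually_mono simp: dist_real_def)
qed

lemma FDR_BH:
  assumes n: "1 \<le> n" and \<alpha>: "0 < \<alpha>" "\<alpha> < 1"
  shows "FDR M \<theta> (BH_xi \<alpha>) n = (1 - a) * \<alpha>"
  unfolding FDR_def using \<alpha>
  by (intro BH_FDR[OF pval_indep _ n]) (auto intro: pval_law(1))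

section \<open>Power and pFDR of the procedure\<close>

definition nonnull :: "nat \<Rightarrow> 'w \<Rightarrow> real" where
  "nonnull n \<omega> = max (real n - real (card {i \<in> {..<n}. \<not> \<theta> i \<omega>})) 1"

lemma card_theta: "real n - real (card {i \<in> {..<n}. \<not> \<theta> i \<omega>}) = real (card {i \<in> {..<n}. \<theta> i \<omega>})"
proof -
  have "card {i \<in> {..<n}. \<not> \<theta> i \<omega>} + card {i \<in> {..<n}. \<theta> i \<omega>} = card {..<n}"
    by (subst card_Un_disjoint[symmetric]) (auto intro!: arg_cong[where f = card] simp del: card_lessThan)
  then show ?thesis by simp
qed

lemma nonnull_eq: "nonnull n \<omega> = max (real (card {i \<in> {..<n}. \<theta> i \<omega>})) 1"
  by (simp only: nonnull_def card_theta)

lemma nonnull_pos: "1 \<le> nonnull n \<omega>"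
  by (simp add: nonnull_def)

lemma nonnull_le: "1 \<le> n \<Longrightarrow> nonnull n \<omega> \<le> n"
  by (auto simp: nonnull_def)

lemma nonnull_measurable [measurable]: "nonnull n \<in> borel_measurable M"
  unfolding nonnull_def by measurable

lemma nonnull_tendsto: "AE \<omega> in M. (\<lambda>n. nonnull n \<omega> / n) \<longlonglongrightarrow> a"
proof -
  have A: "{z :: bool \<times> (real, 'k) vec. fst z} \<in> sets (count_space UNIV \<Otimes>\<^sub>M borel)"
  proof -
    have "{z \<in> space (count_space UNIV \<Otimes>\<^sub>M (borel :: (real, 'k) vec measure)). fst z} \<in> sets (count_space UNIV \<Otimes>\<^sub>M borel)"
      by measurable
    then show ?thesis by (simp add: space_pair_measure)
  qed
  have "AE \<omega> in M. (\<lambda>n. real (card {i \<in> {..<n}. (\<theta> i \<omega>, \<xi> i \<omega>) \<in> {z. fst z}}) / n) \<longlonglongrightarrow> a"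
    by (rule slln_frequency[OF indep A]) (simp add: theta_prob)
  then show ?thesis
  proof eventually_elim
    case (elim \<omega>)
    have "(\<lambda>n. max (real (card {i \<in> {..<n}. (\<theta> i \<omega>, \<xi> i \<omega>) \<in> {z. fst z}}) / n) (1 / n)) \<longlonglongrightarrow> max a 0"
      by (intro tendsto_max elim lim_1_over_n)
    moreover have "max (real (card {i \<in> {..<n}. (\<theta> i \<omega>, \<xi> i \<omega>) \<in> {z. fst z}}) / n) (1 / n) = nonnull n \<omega> / n" for n
      by (simp add: nonnull_eq max_divide_distrib_right)
    ultimately show ?case using a by simp
  qed
qed

lemma card_reject_bounds:
  assumes D: "D \<subseteq> {..<n}"
  shows "card D \<le> n" "card {i \<in> D. \<not> \<theta> i \<omega>} \<le> card D"
    and "real (card D) - real (card {i \<in> D. \<not> \<theta> i \<omega>}) = real (card {i \<in> D. \<theta> i \<omega>})"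
    and "real (card {i \<in> D. \<theta> i \<omega>}) \<le> nonnull n \<omega>"
proof -
  have fin: "finite D" using D by (rule finite_subset) simp
  show "card D \<le> n" using card_mono[OF _ D] by simp
  show "card {i \<in> D. \<not> \<theta> i \<omega>} \<le> card D" using fin by (intro card_mono) auto
  have "card {i \<in> D. \<not> \<theta> i \<omega>} + card {i \<in> D. \<theta> i \<omega>} = card D"
    using fin by (subst card_Un_disjoint[symmetric]) (auto intro!: arg_cong[where f = card])
  then show "real (card D) - real (card {i \<in> D. \<not> \<theta> i \<omega>}) = real (card {i \<in> D. \<theta> i \<omega>})" by simp
  have "card {i \<in> D. \<theta> i \<omega>} \<le> card {i \<in> {..<n}. \<theta> i \<omega>}" using D by (intro card_mono) auto
  then show "real (card {i \<in> D. \<theta> i \<omega>}) \<le> nonnull n \<omega>" by (simp add: nonnull_eq)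
qed

lemma decision_card_measurable:
  assumes D: "\<delta> \<in> M \<rightarrow>\<^sub>M count_space (Pow {..<n})"
  shows "(\<lambda>\<omega>. real (card (\<delta> \<omega>))) \<in> borel_measurable M"
    and "(\<lambda>\<omega>. real (card {i \<in> \<delta> \<omega>. \<not> \<theta> i \<omega>})) \<in> borel_measurable M"
    and "(\<lambda>\<omega>. real (card {i \<in> \<delta> \<omega>. \<theta> i \<omega>})) \<in> borel_measurable M"
proof -
  have [measurable]: "{\<omega> \<in> space M. i \<in> \<delta> \<omega>} \<in> events" for i
    by (rule decision_sets[OF D])
  show "(\<lambda>\<omega>. real (card (\<delta> \<omega>))) \<in> borel_measurable M"
    and "(\<lambda>\<omega>. real (card {i \<in> \<delta> \<omega>. \<not> \<theta> i \<omega>})) \<in> borel_measurable M"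
    and "(\<lambda>\<omega>. real (card {i \<in> \<delta> \<omega>. \<theta> i \<omega>})) \<in> borel_measurable M"
    by measurable
qed

lemma mt_power_eq:
  assumes D: "\<Delta> n \<in> M \<rightarrow>\<^sub>M count_space (Pow {..<n})"
  shows "mt_power M \<theta> \<Delta> n = expectation (\<lambda>\<omega>. real (card {i \<in> \<Delta> n \<omega>. \<theta> i \<omega>}) / nonnull n \<omega>)"
  unfolding mt_power_def nonnull_def
  using card_reject_bounds(3)[OF decision_subset[OF D]]
  by (intro Bochner_Integration.integral_cong) auto

lemma power_integrable:
  assumes D: "\<delta> \<in> M \<rightarrow>\<^sub>M count_space (Pow {..<n})"
  shows "integrable M (\<lambda>\<omega>. real (card {i \<in> \<delta> \<omega>. \<theta> i \<omega>}) / nonnull n \<omega>)"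
proof (rule bounded_integrable[where c = 1])
  note [measurable] = decision_card_measurable[OF D]
  show "(\<lambda>\<omega>. real (card {i \<in> \<delta> \<omega>. \<theta> i \<omega>}) / nonnull n \<omega>) \<in> borel_measurable M" by measurable
  fix \<omega> assume "\<omega> \<in> space M"
  then show "\<bar>real (card {i \<in> \<delta> \<omega>. \<theta> i \<omega>}) / nonnull n \<omega>\<bar> \<le> 1"
    using card_reject_bounds(4)[OF decision_subset[OF D]] nonnull_pos[of n \<omega>]
    by (auto simp: divide_le_eq_1)
qed

lemma mt_power_nonneg:
  assumes D: "\<Delta> n \<in> M \<rightarrow>\<^sub>M count_space (Pow {..<n})"
  shows "0 \<le> mt_power M \<theta> \<Delta> n"
  unfolding mt_power_eq[of \<Delta>, OF D] using nonnull_pos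
  by (intro integral_nonneg_AE AE_I2 divide_nonneg_nonneg) (auto intro: order_trans[of 0 1])

lemma BH_xi_measurable:
  assumes "1 \<le> n" "0 < \<alpha>" "\<alpha> < 1"
  shows "BH_xi \<alpha> n \<in> M \<rightarrow>\<^sub>M count_space (Pow {..<n})"
  using assms by (intro BH_reject_measurable) auto

lemma xi_threshold_tendsto:
  assumes \<alpha>: "0 < \<alpha>" "\<alpha> < 1"
  shows "AE \<omega> in M. (\<lambda>n. \<alpha> * bh_rank \<alpha> n (\<lambda>i. pval (\<xi> i \<omega>)) / n) \<longlonglongrightarrow> tstar \<alpha>"
  using xi_empirical
proof eventually_elim
  case (elim \<omega>)
  then show ?case
    using bh_threshold_tendsto[of "\<lambda>j. j" "\<lambda>j i. \<xi> i \<omega>", OF filterlim_ident xi_cube _ \<alpha>] by blast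
qed

text \<open>The random threshold is replaced by a fixed \<open>t\<close> below its limit: once the
  threshold has passed \<open>t\<close>, all false nulls with p-value at most \<open>t\<close> are
  rejected, and their number obeys the law of large numbers.\<close>

lemma power_BH_lower:
  assumes \<alpha>: "0 < \<alpha>" "\<alpha> < 1" and t: "0 < t" "t < tstar \<alpha>" and c: "c < G t"
  shows "\<forall>\<^sub>F n in sequentially. c < mt_power M \<theta> (BH_xi \<alpha>) n"
proof -
  let ?th = "\<lambda>n \<omega>. \<alpha> * bh_rank \<alpha> n (\<lambda>i. pval (\<xi> i \<omega>)) / n"
  let ?C = "\<lambda>n \<omega>. real (card {i \<in> {..<n}. \<theta> i \<omega> \<and> pval (\<xi> i \<omega>) \<le> t})"
  have t1: "0 \<le> t" "t \<le> 1" using t tstar(2)[OF \<alpha>] by auto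
  \<comment> \<open>Set to 0 while the threshold is below \<open>t\<close>, so that it is a lower
    bound for the rejected proportion of false nulls at every sample size and still converges almost
    surely.\<close>
  define W where "W n \<omega> = (if t \<le> ?th n \<omega> then ?C n \<omega> else 0) / nonnull n \<omega>" for n \<omega>
  have [measurable]: "W n \<in> borel_measurable M" for n
    unfolding W_def[abs_def] by measurable
  have C_le: "?C n \<omega> \<le> nonnull n \<omega>" for n \<omega>
  proof -
    have "card {i \<in> {..<n}. \<theta> i \<omega> \<and> pval (\<xi> i \<omega>) \<le> t} \<le> card {i \<in> {..<n}. \<theta> i \<omega>}"
      by (intro card_mono) auto
    then show ?thesis by (simp add: nonnull_eq)
  qed
  have W1: "\<bar>W n \<omega>\<bar> \<le> 1" for n \<omega>
    using C_le[of n \<omega>] nonnull_pos[of n \<omega>] by (auto simp: W_def divide_le_eq_1)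
  have A: "{z :: bool \<times> real. fst z \<and> snd z \<le> t} \<in> sets (count_space UNIV \<Otimes>\<^sub>M borel)"
  proof -
    have "{z \<in> space (count_space UNIV \<Otimes>\<^sub>M (borel :: real measure)). fst z \<and> snd z \<le> t} \<in> sets (count_space UNIV \<Otimes>\<^sub>M borel)"
      by measurable
    then show ?thesis by (simp add: space_pair_measure)
  qed
  have "AE \<omega> in M. (\<lambda>n. real (card {i \<in> {..<n}. (\<theta> i \<omega>, pval (\<xi> i \<omega>)) \<in> {z. fst z \<and> snd z \<le> t}}) / n) \<longlonglongrightarrow> a * G t"
    by (rule slln_frequency[OF pval_indep A]) (use pval_law(2)[OF t1] in simp)
  with nonnull_tendsto xi_threshold_tendsto[OF \<alpha>]
  have "AE \<omega> in M. (\<lambda>n. W n \<omega>) \<longlonglongrightarrow> G t"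
  proof eventually_elim
    case (elim \<omega>)
    have "(\<lambda>n. (?C n \<omega> / n) / (nonnull n \<omega> / n)) \<longlonglongrightarrow> (a * G t) / a"
      using a elim by (intro tendsto_divide) auto
    then have 1: "(\<lambda>n. (?C n \<omega> / n) / (nonnull n \<omega> / n)) \<longlonglongrightarrow> G t" using a by simp
    have "\<forall>\<^sub>F n in sequentially. t < ?th n \<omega>"
      using t by (intro order_tendstoD(1)[OF elim(2)])
    then have "\<forall>\<^sub>F n in sequentially. (?C n \<omega> / n) / (nonnull n \<omega> / n) = W n \<omega>"
      using eventually_gt_at_top[of "0::nat"] by eventually_elim (simp add: W_def)
    with 1 show ?case by (rule Lim_transform_eventually)
  qed
  then have "(\<lambda>n. expectation (W n)) \<longlonglongrightarrow> expectation (\<lambda>_. G t)"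
    using W1 by (intro integral_dominated_convergence[where w = "\<lambda>_. 1"]) auto
  then have "\<forall>\<^sub>F n in sequentially. c < expectation (W n)"
    using c by (intro order_tendstoD(1)) (auto simp: prob_space)
  then show ?thesis
    using eventually_ge_at_top[of 1]
  proof eventually_elim
    case (elim n)
    note D = BH_xi_measurable[OF elim(2) \<alpha>]
    have "expectation (W n) \<le> mt_power M \<theta> (BH_xi \<alpha>) n"
      unfolding mt_power_eq[of "BH_xi \<alpha>", OF D]
    proof (intro integral_mono power_integrable[OF D])
      show "integrable M (W n)" by (rule bounded_integrable[where c = 1]) (auto simp: W1)
      fix \<omega> assume "\<omega> \<in> space M"
      have "?C n \<omega> \<le> real (card {i \<in> BH_xi \<alpha> n \<omega>. \<theta> i \<omega>})" if "t \<le> ?th n \<omega>"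
        using that \<alpha> elim(2) by (intro of_nat_mono card_mono) (auto simp: BH_reject_eq)
      then show "W n \<omega> \<le> real (card {i \<in> BH_xi \<alpha> n \<omega>. \<theta> i \<omega>}) / nonnull n \<omega>"
        unfolding W_def using nonnull_pos[of n \<omega>] by (intro divide_right_mono) auto
    qed
    with elim show ?case by simp
  qed
qed

lemma power_BH_lower_limit:
  assumes \<alpha>: "0 < \<alpha>" "\<alpha> < 1" and \<eta>: "0 < \<eta>"
  shows "\<forall>\<^sub>F n in sequentially. G (tstar \<alpha>) - \<eta> < mt_power M \<theta> (BH_xi \<alpha>) n"
proof (cases "tstar \<alpha> = 0")
  case True
  show ?thesis
    using eventually_ge_at_top[of 1]
  proof eventually_elim
    case (elim n)
    then show ?case using mt_power_nonneg[of "BH_xi \<alpha>", OF BH_xi_measurable[OF elim \<alpha>]] \<eta> by (simp add: True G_0)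
  qed
next
  case False
  note ts = tstar[OF \<alpha>]
  have pos: "0 < tstar \<alpha>" using False ts(1) by simp
  \<comment> \<open>The shift by two keeps the approximating points strictly between 0 and
    \<open>tstar \<alpha>\<close>.\<close>
  have "(\<lambda>n. tstar \<alpha> - tstar \<alpha> * (1 / real (Suc (Suc n)))) \<longlonglongrightarrow> tstar \<alpha> - tstar \<alpha> * 0"
    by (intro tendsto_intros LIMSEQ_Suc[OF LIMSEQ_inverse_real_of_nat[unfolded inverse_eq_divide]])
  moreover have *: "0 < 1 / real (Suc (Suc n))" "1 / real (Suc (Suc n)) < 1" for n by auto
  then have in01: "tstar \<alpha> * (1 / real (Suc (Suc n))) < tstar \<alpha> * 1" "0 < tstar \<alpha> * (1 / real (Suc (Suc n)))" for n
    using pos by (intro mult_strict_left_mono mult_pos_pos; blast)+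
  ultimately have "(\<lambda>n. G (tstar \<alpha> - tstar \<alpha> * (1 / real (Suc (Suc n))))) \<longlonglongrightarrow> G (tstar \<alpha>)"
    using ts in01 by (intro continuous_on_tendsto_compose[OF G_cont]) (auto intro!: always_eventually less_imp_le, (smt (verit))+)
  then have "\<forall>\<^sub>F n in sequentially. G (tstar \<alpha>) - \<eta> < G (tstar \<alpha> - tstar \<alpha> * (1 / real (Suc (Suc n))))"
    using \<eta> by (intro order_tendstoD(1)) auto
  then obtain n where "G (tstar \<alpha>) - \<eta> < G (tstar \<alpha> - tstar \<alpha> * (1 / real (Suc (Suc n))))"
    by (auto simp: eventually_sequentially)
  then show ?thesis using in01[of n] by (intro power_BH_lower[OF \<alpha>]) auto
qed

text \<open>The integrand of the FDR vanishes when nothing is rejected, so FDR and pFDR differ only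
  by the normalisation.\<close>

lemma pFDR_eq:
  assumes D: "\<Delta> n \<in> M \<rightarrow>\<^sub>M count_space (Pow {..<n})"
  shows "pFDR M \<theta> \<Delta> n = FDR M \<theta> \<Delta> n / prob {\<omega> \<in> space M. 0 < card (\<Delta> n \<omega>)}"
proof -
  have "(LINT \<omega>:{\<omega> \<in> space M. 0 < card (\<Delta> n \<omega>)}|M. real (card {i \<in> \<Delta> n \<omega>. \<not> \<theta> i \<omega>}) / real (card (\<Delta> n \<omega>)))
      = FDR M \<theta> \<Delta> n"
    unfolding FDR_def set_lebesgue_integral_def
  proof (intro Bochner_Integration.integral_cong refl)
    fix \<omega> assume w: "\<omega> \<in> space M"
    note b = card_reject_bounds(2)[OF decision_subset[OF D w], of \<omega>]
    show "indicator {\<omega> \<in> space M. 0 < card (\<Delta> n \<omega>)} \<omega> *\<^sub>R (real (card {i \<in> \<Delta> n \<omega>. \<not> \<theta> i \<omega>}) / real (card (\<Delta> n \<omega>)))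
        = real (card {i \<in> \<Delta> n \<omega>. \<not> \<theta> i \<omega>}) / max (real (card (\<Delta> n \<omega>))) 1"
      using w b by (cases "card (\<Delta> n \<omega>) = 0") (auto simp: indicator_def max_def)
  qed
  then show ?thesis by (simp add: pFDR_def)
qed

section \<open>The pFDR through the probability of rejecting anything\<close>

lemma pFDR_BH_limit:
  assumes \<alpha>: "0 < \<alpha>" "\<alpha> < 1" and r: "0 < r"
    and lim: "(\<lambda>n. prob {\<omega> \<in> space M. BH_xi \<alpha> n \<omega> \<noteq> {}}) \<longlonglongrightarrow> r"
  shows "pFDR M \<theta> (BH_xi \<alpha>) \<longlonglongrightarrow> (1 - a) * \<alpha> / r"
proof (rule Lim_transform_eventually)
  show "(\<lambda>n. (1 - a) * \<alpha> / prob {\<omega> \<in> space M. BH_xi \<alpha> n \<omega> \<noteq> {}}) \<longlonglongrightarrow> (1 - a) * \<alpha> / r"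
    using r by (intro tendsto_divide lim tendsto_const) auto
  show "\<forall>\<^sub>F n in sequentially. (1 - a) * \<alpha> / prob {\<omega> \<in> space M. BH_xi \<alpha> n \<omega> \<noteq> {}} = pFDR M \<theta> (BH_xi \<alpha>) n"
    using eventually_ge_at_top[of 1]
  proof eventually_elim
    case (elim n)
    have "0 < card (BH_xi \<alpha> n \<omega>) \<longleftrightarrow> BH_xi \<alpha> n \<omega> \<noteq> {}" for \<omega>
      by (subst card_gt_0_iff) (auto simp: BH_reject_def)
    then show ?case
      using pFDR_eq[of "BH_xi \<alpha>" n, OF BH_xi_measurable[OF elim \<alpha>]] FDR_BH[OF elim \<alpha>] by simp
  qed
qed

lemma prob_reject_supercritical:
  assumes \<alpha>: "0 < \<alpha>" "\<alpha> < 1" and ts: "0 < tstar \<alpha>"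
  shows "(\<lambda>n. prob {\<omega> \<in> space M. BH_xi \<alpha> n \<omega> \<noteq> {}}) \<longlonglongrightarrow> 1"
proof -
  have ev: "{\<omega> \<in> space M. BH_xi \<alpha> n \<omega> \<noteq> {}} \<in> events" if "1 \<le> n" for n
    by (rule decision_sets[OF BH_xi_measurable[OF that \<alpha>]])
  \<comment> \<open>Shifted to \<open>Suc n\<close> because the decision is known to be measurable
    for \<open>1 \<le> n\<close>.\<close>
  have "(\<lambda>n. expectation (indicator {\<omega> \<in> space M. BH_xi \<alpha> (Suc n) \<omega> \<noteq> {}}) :: real) \<longlonglongrightarrow> expectation (\<lambda>_. 1)"
  proof (rule integral_dominated_convergence[where w = "\<lambda>_. 1"])
    show "AE \<omega> in M. (\<lambda>n. indicator {\<omega> \<in> space M. BH_xi \<alpha> (Suc n) \<omega> \<noteq> {}} \<omega> :: real) \<longlonglongrightarrow> 1"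
      using xi_empirical AE_space
    proof eventually_elim
      case (elim \<omega>)
      have "(\<lambda>n. real (card (BH_xi \<alpha> n \<omega>)) / n) \<longlonglongrightarrow> tstar \<alpha> / \<alpha>"
        using elim bh_rejections_tendsto[of "\<lambda>j. j" "\<lambda>j i. \<xi> i \<omega>", OF filterlim_ident xi_cube _ \<alpha>] by blast
      then have "\<forall>\<^sub>F n in sequentially. 0 < real (card (BH_xi \<alpha> n \<omega>)) / n"
        by (rule order_tendstoD(1)) (use ts \<alpha> in simp)
      then have "\<forall>\<^sub>F n in sequentially. 0 < real (card (BH_xi \<alpha> (Suc n) \<omega>)) / Suc n"
        by (subst (asm) eventually_sequentially_Suc[symmetric])
      then have "\<forall>\<^sub>F n in sequentially. indicator {\<omega> \<in> space M. BH_xi \<alpha> (Suc n) \<omega> \<noteq> {}} \<omega> = (1::real)"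
        using elim by (auto elim!: eventually_mono simp: indicator_def zero_less_divide_iff)
      then show ?case by (rule tendsto_eventually)
    qed
    show "indicator {\<omega> \<in> space M. BH_xi \<alpha> (Suc n) \<omega> \<noteq> {}} \<in> borel_measurable M" for n
      using ev[of "Suc n"] by simp
  qed (auto simp: indicator_def)
  then have "(\<lambda>n. prob {\<omega> \<in> space M. BH_xi \<alpha> (Suc n) \<omega> \<noteq> {}}) \<longlonglongrightarrow> 1"
    using ev by (simp add: prob_space)
  then show ?thesis by (rule LIMSEQ_imp_Suc)
qed

text \<open>\<open>H\<close> maps the mixture p-values to uniform ones, for which the probability that the BH
  procedure rejects something equals its level.\<close>

lemma H_pval_reject_prob:
  assumes n: "1 \<le> n" and \<beta>: "0 < \<beta>" "\<beta> \<le> 1"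
  shows "prob {\<omega> \<in> space M. BH_reject \<beta> n (\<lambda>i. H (pval (\<xi> i \<omega>))) \<noteq> {}} = \<beta>"
proof -
  have Hm [measurable]: "H \<in> borel_measurable borel"
    by (intro borel_measurable_mono monoI H_mono)
  \<comment> \<open>The label \<open>False\<close> declares every null true, so the false discovery
    proportion becomes the indicator of rejecting something.\<close>
  have ind: "indep_vars (\<lambda>_. count_space UNIV \<Otimes>\<^sub>M borel) (\<lambda>i \<omega>. (False, H (pval (\<xi> i \<omega>)))) UNIV"
    using indep_vars_compose2[OF pval_indep, of "\<lambda>_ z. (False, H (snd z))" "\<lambda>_. count_space UNIV \<Otimes>\<^sub>M borel"]
    by simp
  have law: "prob {\<omega> \<in> space M. \<not> False \<and> H (pval (\<xi> i \<omega>)) \<le> s} = 1 * s" if s: "0 \<le> s" "s \<le> 1" for i s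
  proof -
    obtain t where "0 \<le> t" "t \<le> 1" "H t = s"
      using IVT'[of H 0 s 1] s H_cont by (auto simp: H_0 H_1)
    then show ?thesis using pval_law(3)[of t i] by (auto simp: H_le_iff)
  qed
  let ?B = "\<lambda>\<omega>. BH_reject \<beta> n (\<lambda>i. H (pval (\<xi> i \<omega>)))"
  have "?B \<in> M \<rightarrow>\<^sub>M count_space (Pow {..<n})" using n \<beta> by (intro BH_reject_measurable) auto
  from decision_sets[of ?B M n "\<lambda>D. D \<noteq> {}", OF this]
  have ev: "{\<omega> \<in> space M. ?B \<omega> \<noteq> {}} \<in> events" .
  have "1 * \<beta> = expectation (\<lambda>\<omega>. real (card {i \<in> ?B \<omega>. \<not> False}) / max (real (card (?B \<omega>))) 1)"
    by (rule BH_FDR[OF ind law n \<beta>, symmetric])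
  also have "\<dots> = expectation (indicator {\<omega> \<in> space M. ?B \<omega> \<noteq> {}})"
  proof (intro Bochner_Integration.integral_cong refl)
    fix \<omega> assume w: "\<omega> \<in> space M"
    have "finite (?B \<omega>)" by (simp add: BH_reject_def)
    then have "card (?B \<omega>) \<ge> 1 \<longleftrightarrow> ?B \<omega> \<noteq> {}" by (simp add: Suc_le_eq card_gt_0_iff)
    then show "real (card {i \<in> ?B \<omega>. \<not> False}) / max (real (card (?B \<omega>))) 1 = indicator {\<omega> \<in> space M. ?B \<omega> \<noteq> {}} \<omega>"
      using w by (cases "?B \<omega> = {}") (auto simp: indicator_def max_def)
  qed
  also have "\<dots> = prob {\<omega> \<in> space M. ?B \<omega> \<noteq> {}}" using ev by simp
  finally show ?thesis by simp
qed

text \<open>Both bounds compare, rank by rank, the threshold \<open>H (\<alpha> * r / n)\<close> on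
  the uniform scale with a BH threshold. From above, \<open>H t \<le> L * t\<close> gives level
  \<open>\<alpha> * L\<close> for every \<open>n\<close>. From below, \<open>H\<close> is nearly
  linear only near 0, which covers ranks with \<open>\<alpha> * r / n \<le> t0\<close>; larger ranks
  are collected in \<open>bad\<close>, which almost surely stops occurring because uniform counts
  stay near the diagonal while \<open>\<beta> < 1\<close>.\<close>

lemma prob_reject_subcritical:
  assumes \<alpha>: "0 < \<alpha>" "\<alpha> < 1" and L: "0 < L" "\<alpha> * L < 1"
    and H_le: "\<And>t. 0 \<le> t \<Longrightarrow> t \<le> 1 \<Longrightarrow> H t \<le> L * t"
    and H_ge: "\<And>\<epsilon>. 0 < \<epsilon> \<Longrightarrow> \<exists>t0>0. t0 \<le> 1 \<and> (\<forall>t. 0 \<le> t \<longrightarrow> t \<le> t0 \<longrightarrow> (L - \<epsilon>) * t \<le> H t)"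
  shows "(\<lambda>n. prob {\<omega> \<in> space M. BH_xi \<alpha> n \<omega> \<noteq> {}}) \<longlonglongrightarrow> \<alpha> * L"
proof (rule order_tendstoI)
  let ?P = "\<lambda>\<omega> i. pval (\<xi> i \<omega>)" and ?H = "\<lambda>\<omega> i. H (pval (\<xi> i \<omega>))"
  have Hm [measurable]: "H \<in> borel_measurable borel"
    by (intro borel_measurable_mono monoI H_mono)
  have ev: "{\<omega> \<in> space M. BH_xi \<alpha> n \<omega> \<noteq> {}} \<in> events" if "1 \<le> n" for n
    by (rule decision_sets[OF BH_xi_measurable[OF that \<alpha>]])
  have evH: "{\<omega> \<in> space M. BH_reject \<beta> n (?H \<omega>) \<noteq> {}} \<in> events" if "1 \<le> n" "0 < \<beta>" "\<beta> \<le> 1" for n \<beta>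
  proof -
    have "(\<lambda>\<omega>. BH_reject \<beta> n (?H \<omega>)) \<in> M \<rightarrow>\<^sub>M count_space (Pow {..<n})" using that by (intro BH_reject_measurable) auto
    from decision_sets[of "\<lambda>\<omega>. BH_reject \<beta> n (?H \<omega>)" M n "\<lambda>D. D \<noteq> {}", OF this] show ?thesis .
  qed
  have ratio: "0 \<le> \<alpha> * real r / n" "\<alpha> * real r / n \<le> 1" if "r \<in> {1..n}" for r n
  proof -
    have "\<alpha> * real r \<le> 1 * real n" using that \<alpha> by (intro mult_mono) auto
    then show "0 \<le> \<alpha> * real r / n" "\<alpha> * real r / n \<le> 1" using that \<alpha> by (auto simp: divide_le_eq_1)
  qed
  show "\<forall>\<^sub>F n in sequentially. prob {\<omega> \<in> space M. BH_xi \<alpha> n \<omega> \<noteq> {}} < c" if c: "\<alpha> * L < c" for c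
    using eventually_ge_at_top[of 1]
  proof eventually_elim
    case (elim n)
    have "{\<omega> \<in> space M. BH_xi \<alpha> n \<omega> \<noteq> {}} \<subseteq> {\<omega> \<in> space M. BH_reject (\<alpha> * L) n (?H \<omega>) \<noteq> {}}"
    proof
      fix \<omega> assume w: "\<omega> \<in> {\<omega> \<in> space M. BH_xi \<alpha> n \<omega> \<noteq> {}}"
      then have "\<exists>r\<in>{1..n}. r \<le> count_le n (?P \<omega>) (\<alpha> * real r / n)"
        using \<alpha> BH_reject_nonempty_iff[OF elim, of \<alpha> "?P \<omega>"] by simp
      then obtain r where r: "r \<in> {1..n}" "r \<le> count_le n (?P \<omega>) (\<alpha> * real r / n)" by blast
      have "H (\<alpha> * real r / n) \<le> (\<alpha> * L) * real r / n"
        using H_le[OF ratio[OF r(1)]] by (simp add: mult_ac)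
      then have "count_le n (?P \<omega>) (\<alpha> * real r / n) \<le> count_le n (?H \<omega>) ((\<alpha> * L) * real r / n)"
        unfolding count_le_def
        by (intro card_mono, simp) (use order_trans[OF H_mono \<open>H (\<alpha> * real r / n) \<le> (\<alpha> * L) * real r / n\<close>] in blast)
      then have "BH_reject (\<alpha> * L) n (?H \<omega>) \<noteq> {}"
        using r \<alpha> L by (subst BH_reject_nonempty_iff[OF elim]) (auto intro!: bexI[of _ r])
      then show "\<omega> \<in> {\<omega> \<in> space M. BH_reject (\<alpha> * L) n (?H \<omega>) \<noteq> {}}" using w by simp
    qed
    then have "prob {\<omega> \<in> space M. BH_xi \<alpha> n \<omega> \<noteq> {}} \<le> prob {\<omega> \<in> space M. BH_reject (\<alpha> * L) n (?H \<omega>) \<noteq> {}}"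
      using evH[OF elim, of "\<alpha> * L"] \<alpha> L by (intro finite_measure_mono) auto
    also have "\<dots> = \<alpha> * L" using \<alpha> L by (intro H_pval_reject_prob[OF elim]) auto
    finally show ?case using c by simp
  qed
  fix c assume c: "c < \<alpha> * L"
  \<comment> \<open>The first bound keeps \<open>\<beta> = \<alpha> * (L - \<epsilon>)\<close>
    positive, the second keeps it above \<open>c\<close>.\<close>
  define \<epsilon> where "\<epsilon> = min (L / 2) ((\<alpha> * L - c) / (2 * \<alpha>))"
  have "\<epsilon> \<le> L / 2" unfolding \<epsilon>_def by (rule min.cobounded1)
  then have \<epsilon>: "0 < \<epsilon>" "\<epsilon> < L" using L c \<alpha> by (simp_all add: \<epsilon>_def)
  have "\<alpha> * \<epsilon> \<le> \<alpha> * ((\<alpha> * L - c) / (2 * \<alpha>))" using \<alpha> by (intro mult_left_mono) (auto simp: \<epsilon>_def)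
  also have "\<dots> = (\<alpha> * L - c) / 2" using \<alpha> by simp
  finally have \<alpha>\<epsilon>: "\<alpha> * \<epsilon> < \<alpha> * L - c" using c by simp
  define \<beta> where "\<beta> = \<alpha> * (L - \<epsilon>)"
  have "0 < \<alpha> * (L - \<epsilon>)" "0 < \<alpha> * \<epsilon>" using \<alpha> \<epsilon> by simp_all
  moreover have "\<beta> = \<alpha> * L - \<alpha> * \<epsilon>" by (simp add: \<beta>_def right_diff_distrib)
  ultimately have \<beta>: "0 < \<beta>" "\<beta> < 1" "c < \<beta>" using L(2) \<alpha>\<epsilon> by (auto simp: \<beta>_def)
  obtain t0 where t0: "0 < t0" "t0 \<le> 1" "\<And>t. 0 \<le> t \<Longrightarrow> t \<le> t0 \<Longrightarrow> (L - \<epsilon>) * t \<le> H t"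
    using H_ge[OF \<epsilon>(1)] by auto
  define bad where "bad n = {\<omega> \<in> space M. \<exists>r\<in>{1..n}. t0 / \<alpha> \<le> real r / n \<and> r \<le> count_le n (?H \<omega>) (\<beta> * real r / n)}" for n
  have bad_ev [measurable]: "bad n \<in> events" for n unfolding bad_def by measurable
  have "AE \<omega> in M. \<forall>\<^sub>F n in sequentially. \<omega> \<notin> bad n"
    using xi_empirical
  proof eventually_elim
    case (elim \<omega>)
    \<comment> \<open>For ranks in \<open>bad\<close>, at least \<open>r / n\<close> of the mass
      lies below a point of uniform probability \<open>\<beta> * r / n\<close>; the discrepancy is
      at least \<open>(1 - \<beta>) * (t0 / \<alpha>)\<close>.\<close>
    define d where "d = (1 - \<beta>) * (t0 / \<alpha>)"
    have d: "0 < d" using \<beta> t0 \<alpha> by (simp add: d_def)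
    have "\<forall>\<^sub>F n in sequentially. \<forall>t\<in>{0..1}. \<bar>real (count_le n (?P \<omega>) t) / n - H t\<bar> < d"
      using elim empirical_pval_uniform[of "\<lambda>j. j" "\<lambda>j i. \<xi> i \<omega>", OF filterlim_ident xi_cube _ d] by blast
    then show ?case
    proof eventually_elim
      case (elim n)
      show ?case
      proof
        assume "\<omega> \<in> bad n"
        then obtain r where r: "r \<in> {1..n}" "t0 / \<alpha> \<le> real r / n" "r \<le> count_le n (?H \<omega>) (\<beta> * real r / n)"
          by (auto simp: bad_def)
        have "\<beta> * real r \<le> 1 * real n" using r \<beta> by (intro mult_mono) auto
        then have "0 \<le> \<beta> * real r / n" "\<beta> * real r / n \<le> 1" using r \<beta> by (auto simp: divide_le_eq_1)
        then obtain t where t: "0 \<le> t" "t \<le> 1" "H t = \<beta> * real r / n"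
          using IVT'[of H 0 "\<beta> * real r / n" 1] H_cont by (auto simp: H_0 H_1)
        have "count_le n (?H \<omega>) (\<beta> * real r / n) = count_le n (?P \<omega>) t"
          unfolding t(3)[symmetric] count_le_def H_le_iff ..
        then have "real r / n \<le> real (count_le n (?P \<omega>) t) / n" using r by (intro divide_right_mono) auto
        also have "\<dots> < \<beta> * (real r / n) + d" using elim[rule_format, of t] t by (simp add: abs_less_iff)
        finally have "(1 - \<beta>) * (real r / n) < (1 - \<beta>) * (t0 / \<alpha>)"
          unfolding d_def left_diff_distrib by linarith
        then show False using mult_left_mono[OF r(2), of "1 - \<beta>"] \<beta> by linarith
      qed
    qed
  qed
  then have "AE \<omega> in M. (\<lambda>n. indicator (bad n) \<omega> :: real) \<longlonglongrightarrow> 0"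
    by eventually_elim (auto intro!: tendsto_eventually elim!: eventually_mono)
  then have "(\<lambda>n. expectation (indicator (bad n)) :: real) \<longlonglongrightarrow> expectation (\<lambda>_. 0)"
    by (intro integral_dominated_convergence[where w = "\<lambda>_. 1"]) (auto simp: indicator_def)
  then have "(\<lambda>n. prob (bad n)) \<longlonglongrightarrow> 0" by simp
  then have "\<forall>\<^sub>F n in sequentially. prob (bad n) < \<beta> - c" using \<beta> by (intro order_tendstoD(2)) auto
  then show "\<forall>\<^sub>F n in sequentially. c < prob {\<omega> \<in> space M. BH_xi \<alpha> n \<omega> \<noteq> {}}"
    using eventually_ge_at_top[of 1]
  proof eventually_elim
    case (elim n)
    have "{\<omega> \<in> space M. BH_reject \<beta> n (?H \<omega>) \<noteq> {}} \<subseteq> {\<omega> \<in> space M. BH_xi \<alpha> n \<omega> \<noteq> {}} \<union> bad n"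
    proof
      fix \<omega> assume w: "\<omega> \<in> {\<omega> \<in> space M. BH_reject \<beta> n (?H \<omega>) \<noteq> {}}"
      then have "\<exists>r\<in>{1..n}. r \<le> count_le n (?H \<omega>) (\<beta> * real r / n)"
        using \<beta> BH_reject_nonempty_iff[OF elim(2), of \<beta> "?H \<omega>"] by simp
      then obtain r where r: "r \<in> {1..n}" "r \<le> count_le n (?H \<omega>) (\<beta> * real r / n)" by blast
      show "\<omega> \<in> {\<omega> \<in> space M. BH_xi \<alpha> n \<omega> \<noteq> {}} \<union> bad n"
      proof (cases "t0 / \<alpha> \<le> real r / n")
        case True
        then show ?thesis using r w by (auto simp: bad_def)
      next
        case False
        then have "\<alpha> * real r / n \<le> t0" using \<alpha> by (simp add: not_le field_simps)
        then have "\<beta> * real r / n \<le> H (\<alpha> * real r / n)"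
          using t0(3)[OF ratio(1)[OF r(1)]] by (simp add: \<beta>_def mult_ac)
        then have "count_le n (?H \<omega>) (\<beta> * real r / n) \<le> count_le n (?P \<omega>) (\<alpha> * real r / n)"
          unfolding count_le_def
          by (intro card_mono, simp)
            (use H_le_iff[THEN iffD1, OF order_trans[OF _ \<open>\<beta> * real r / n \<le> H (\<alpha> * real r / n)\<close>]] in blast)
        then have "\<exists>r\<in>{1..n}. r \<le> count_le n (?P \<omega>) (\<alpha> * real r / n)"
          using r by (intro bexI[of _ r]) auto
        then have "BH_xi \<alpha> n \<omega> \<noteq> {}"
          using \<alpha> BH_reject_nonempty_iff[OF elim(2), of \<alpha> "?P \<omega>"] by simp
        then show ?thesis using w by auto
      qed
    qed
    then have "prob {\<omega> \<in> space M. BH_reject \<beta> n (?H \<omega>) \<noteq> {}}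
        \<le> prob ({\<omega> \<in> space M. BH_xi \<alpha> n \<omega> \<noteq> {}} \<union> bad n)"
      using ev[OF elim(2)] by (intro finite_measure_mono) auto
    also have "\<dots> \<le> prob {\<omega> \<in> space M. BH_xi \<alpha> n \<omega> \<noteq> {}} + prob (bad n)"
      using ev[OF elim(2)] by (intro measure_Un_le) auto
    finally have "\<beta> \<le> prob {\<omega> \<in> space M. BH_xi \<alpha> n \<omega> \<noteq> {}} + prob (bad n)"
      using H_pval_reject_prob[OF elim(2), of \<beta>] \<beta> by simp
    with elim(1) show ?case by simp
  qed
qed

section \<open>Procedures satisfying condition (A)\<close>

text \<open>The density of a p-value under the mixture. It is at least \<open>1 - a > 0\<close>, so
  the posterior is defined everywhere.\<close>

definition mass :: "(real, 'k) vec \<Rightarrow> real" where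
  "mass x = (1 - a) + a * g x"

text \<open>Bayes' formula for the probability that the null is false given its p-value, one minus
  the local false discovery rate.\<close>

definition post :: "(real, 'k) vec \<Rightarrow> real" where
  "post x = a * g x / mass x"

lemma mass_pos: "0 < mass x"
  unfolding mass_def using a g_nonneg[of x] by (intro add_pos_nonneg mult_nonneg_nonneg) auto

lemma post_bounds: "0 \<le> post x" "post x \<le> 1"
  using a g_nonneg[of x] mass_pos[of x] by (auto simp: post_def divide_le_eq_1 mass_def intro!: divide_nonneg_pos)

lemma mass_measurable [measurable]: "mass \<in> borel_measurable borel"
  and post_measurable [measurable]: "post \<in> borel_measurable borel"
  unfolding mass_def[abs_def] post_def[abs_def] by measurable

lemma mass_integrable: "B \<in> sets borel \<Longrightarrow> integrable unif_cube (\<lambda>x. mass x * indicator B x)"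
  unfolding mass_def using g_integrable U.integrable_const
  by (intro integrable_real_mult_indicator Bochner_Integration.integrable_add integrable_mult_right) auto

lemma xi_distr: "distr M borel (\<xi> i) = density unif_cube (\<lambda>x. ennreal (mass x))"
proof (rule measure_eqI)
  fix B assume "B \<in> sets (distr M borel (\<xi> i))"
  then have B [measurable]: "B \<in> sets borel" by simp
  have "emeasure (distr M borel (\<xi> i)) B = ennreal (prob {\<omega> \<in> space M. \<xi> i \<omega> \<in> B})"
    by (subst emeasure_distr) (auto simp: emeasure_eq_measure intro!: arg_cong[where f = prob])
  also have "prob {\<omega> \<in> space M. \<xi> i \<omega> \<in> B} = (\<integral>x. mass x * indicator B x \<partial>unif_cube)"
  proof -
    have "(\<integral>x. mass x * indicator B x \<partial>unif_cube)
        = (\<integral>x. (1 - a) * indicator B x + a * (g x * indicator B x) \<partial>unif_cube)"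
      by (intro Bochner_Integration.integral_cong) (auto simp: mass_def algebra_simps)
    also have "\<dots> = (1 - a) * U.prob B + a * (\<integral>x. g x * indicator B x \<partial>unif_cube)"
      by (subst Bochner_Integration.integral_add) (auto simp: g_indicator_integrable U.emeasure_eq_measure)
    finally show ?thesis by (simp add: xi_law)
  qed
  also have "ennreal \<dots> = (\<integral>\<^sup>+x. ennreal (mass x * indicator B x) \<partial>unif_cube)"
    using mass_pos by (intro nn_integral_eq_integral[symmetric] mass_integrable) (auto simp: less_imp_le)
  also have "\<dots> = emeasure (density unif_cube (\<lambda>x. ennreal (mass x))) B"
    by (subst emeasure_density) (auto intro!: nn_integral_cong simp: indicator_def)
  finally show "emeasure (distr M borel (\<xi> i)) B = emeasure (density unif_cube (\<lambda>x. ennreal (mass x))) B" .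
qed simp

lemma xi_expectation:
  assumes [measurable]: "f \<in> borel_measurable borel"
  shows "expectation (\<lambda>\<omega>. f (\<xi> i \<omega>)) = (\<integral>x. mass x * f x \<partial>unif_cube)"
proof -
  have "expectation (\<lambda>\<omega>. f (\<xi> i \<omega>)) = (\<integral>x. f x \<partial>distr M borel (\<xi> i))"
    by (subst integral_distr) auto
  also have "\<dots> = (\<integral>x. mass x * f x \<partial>unif_cube)"
    unfolding xi_distr using mass_pos by (subst integral_real_density) (auto simp: less_imp_le)
  finally show ?thesis .
qed

lemma theta_xi_nn_integral:
  assumes [measurable]: "B \<in> sets borel"
  shows "(\<integral>\<^sup>+\<omega>. ennreal (of_bool (\<theta> i \<omega>)) * indicator B (\<xi> i \<omega>) \<partial>M)
       = (\<integral>\<^sup>+\<omega>. ennreal (post (\<xi> i \<omega>)) * indicator B (\<xi> i \<omega>) \<partial>M)"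
proof -
  have "(\<integral>\<^sup>+\<omega>. ennreal (of_bool (\<theta> i \<omega>)) * indicator B (\<xi> i \<omega>) \<partial>M)
      = (\<integral>\<^sup>+\<omega>. indicator {\<omega> \<in> space M. \<theta> i \<omega> \<and> \<xi> i \<omega> \<in> B} \<omega> \<partial>M)"
    by (intro nn_integral_cong) (auto simp: indicator_def)
  also have "\<dots> = ennreal (a * (\<integral>x. g x * indicator B x \<partial>unif_cube))"
    by (subst nn_integral_indicator) (auto simp: emeasure_eq_measure alt_law)
  also have "a * (\<integral>x. g x * indicator B x \<partial>unif_cube) = (\<integral>x. mass x * (post x * indicator B x) \<partial>unif_cube)"
  proof -
    have "mass x * (post x * indicator B x) = a * (g x * indicator B x)" for x
      using mass_pos[of x] by (simp add: post_def)
    then show ?thesis by (simp only: integral_mult_right_zero)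
  qed
  also have "\<dots> = expectation (\<lambda>\<omega>. post (\<xi> i \<omega>) * indicator B (\<xi> i \<omega>))"
    by (rule xi_expectation[symmetric]) measurable
  also have "ennreal \<dots> = (\<integral>\<^sup>+\<omega>. ennreal (post (\<xi> i \<omega>) * indicator B (\<xi> i \<omega>)) \<partial>M)"
    using post_bounds by (intro nn_integral_eq_integral[symmetric] bounded_integrable[where c = 1])
      (auto simp: indicator_def)
  also have "\<dots> = (\<integral>\<^sup>+\<omega>. ennreal (post (\<xi> i \<omega>)) * indicator B (\<xi> i \<omega>) \<partial>M)"
    by (intro nn_integral_cong) (auto simp: indicator_def)
  finally show ?thesis .
qed

section \<open>The posterior given the whole tuple of p-values\<close>

abbreviation xi_tuple :: "nat \<Rightarrow> 'w \<Rightarrow> nat \<Rightarrow> (real, 'k) vec" where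
  "xi_tuple n \<omega> \<equiv> (\<lambda>j\<in>{..<n}. \<xi> j \<omega>)"

lemma xi_tuple_measurable [measurable]: "xi_tuple n \<in> M \<rightarrow>\<^sub>M (\<Pi>\<^sub>M j\<in>{..<n}. borel)"
  by measurable

text \<open>A weight that depends on the pair with index \<open>i\<close> alone leaves the product
  formula for boxes intact and alters only the factor of \<open>i\<close>.\<close>

lemma weighted_tuple_box:
  assumes i: "i < n" and f [measurable]: "f \<in> borel_measurable (count_space UNIV \<Otimes>\<^sub>M borel)"
    and B: "\<And>j. j \<in> {..<n} \<Longrightarrow> B j \<in> sets (borel :: (real, 'k) vec measure)"
  shows "emeasure (distr (density M (\<lambda>\<omega>. f (\<theta> i \<omega>, \<xi> i \<omega>))) (\<Pi>\<^sub>M j\<in>{..<n}. borel) (xi_tuple n)) (Pi\<^sub>E {..<n} B)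
    = (\<integral>\<^sup>+\<omega>. f (\<theta> i \<omega>, \<xi> i \<omega>) * indicator (B i) (\<xi> i \<omega>) \<partial>M) * (\<Prod>j\<in>{..<n} - {i}. \<integral>\<^sup>+\<omega>. indicator (B j) (\<xi> j \<omega>) \<partial>M)"
proof -
  have Bi [measurable]: "B i \<in> sets borel" using B i by simp
  have PB: "Pi\<^sub>E {..<n} B \<in> sets (\<Pi>\<^sub>M j\<in>{..<n}. borel)" using B by (intro sets_PiM_I_finite) auto
  have [measurable]: "(\<lambda>\<omega>. f (\<theta> i \<omega>, \<xi> i \<omega>)) \<in> borel_measurable M"
    by (rule measurable_compose[OF theta_xi_pair_measurable f])
  have tm: "xi_tuple n \<in> density M (\<lambda>\<omega>. f (\<theta> i \<omega>, \<xi> i \<omega>)) \<rightarrow>\<^sub>M (\<Pi>\<^sub>M j\<in>{..<n}. borel)" by simp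
  define Y :: "nat \<Rightarrow> 'w \<Rightarrow> ennreal" where
    "Y j \<omega> = (if j = i then f (\<theta> j \<omega>, \<xi> j \<omega>) * indicator (B j) (\<xi> j \<omega>) else indicator (B j) (\<xi> j \<omega>))" for j \<omega>
  have "indep_vars (\<lambda>_. borel) (\<lambda>j \<omega>. (\<lambda>z. if j = i then f z * indicator (B j) (snd z) else indicator (B j) (snd z)) (\<theta> j \<omega>, \<xi> j \<omega>)) {..<n}"
  proof (rule indep_vars_compose2[OF indep_vars_subset[OF indep]])
    fix j assume "j \<in> {..<n}"
    then have [measurable]: "B j \<in> sets borel" by (rule B)
    show "(\<lambda>z. if j = i then f z * indicator (B j) (snd z) else indicator (B j) (snd z))
        \<in> borel_measurable (count_space UNIV \<Otimes>\<^sub>M borel)"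
      by (cases "j = i") (simp_all, measurable)
  qed simp
  then have iY: "indep_vars (\<lambda>_. borel) Y {..<n}" by (simp add: Y_def[abs_def] cong: if_cong)
  have prod: "f (\<theta> i \<omega>, \<xi> i \<omega>) * indicator (xi_tuple n -` Pi\<^sub>E {..<n} B \<inter> space M) \<omega> = (\<Prod>j\<in>{..<n}. Y j \<omega>)"
    if w: "\<omega> \<in> space M" for \<omega>
  proof -
    have "(\<Prod>j\<in>{..<n}. Y j \<omega>) = Y i \<omega> * (\<Prod>j\<in>{..<n} - {i}. Y j \<omega>)"
      using i by (intro prod.remove) auto
    also have "(\<Prod>j\<in>{..<n} - {i}. Y j \<omega>) = (\<Prod>j\<in>{..<n} - {i}. indicator (B j) (\<xi> j \<omega>))"
      by (intro prod.cong) (auto simp: Y_def)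
    also have "Y i \<omega> * \<dots> = f (\<theta> i \<omega>, \<xi> i \<omega>) * (\<Prod>j\<in>{..<n}. indicator (B j) (\<xi> j \<omega>))"
      using i by (subst prod.remove[of "{..<n}" i "\<lambda>j. indicator (B j) (\<xi> j \<omega>)"]) (auto simp: Y_def mult.assoc)
    also have "(\<Prod>j\<in>{..<n}. indicator (B j) (\<xi> j \<omega>)) = (indicator (xi_tuple n -` Pi\<^sub>E {..<n} B \<inter> space M) \<omega> :: ennreal)"
    proof (cases "\<forall>j<n. \<xi> j \<omega> \<in> B j")
      case True
      then show ?thesis using w by (auto simp: indicator_def PiE_iff)
    next
      case False
      then obtain j where "j < n" "\<xi> j \<omega> \<notin> B j" by auto
      then have "(\<Prod>j\<in>{..<n}. indicator (B j) (\<xi> j \<omega>) :: ennreal) = 0"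
        by (intro prod_zero) (auto intro!: bexI[of _ j])
      then show ?thesis using False by (auto simp: indicator_def PiE_iff)
    qed
    finally show ?thesis by simp
  qed
  have "emeasure (distr (density M (\<lambda>\<omega>. f (\<theta> i \<omega>, \<xi> i \<omega>))) (\<Pi>\<^sub>M j\<in>{..<n}. borel) (xi_tuple n)) (Pi\<^sub>E {..<n} B)
      = (\<integral>\<^sup>+\<omega>. f (\<theta> i \<omega>, \<xi> i \<omega>) * indicator (xi_tuple n -` Pi\<^sub>E {..<n} B \<inter> space M) \<omega> \<partial>M)"
    using PB by (subst emeasure_distr[OF tm PB], subst emeasure_density)
      (auto intro!: measurable_sets[OF xi_tuple_measurable])
  also have "\<dots> = (\<integral>\<^sup>+\<omega>. (\<Prod>j\<in>{..<n}. Y j \<omega>) \<partial>M)"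
    by (intro nn_integral_cong prod)
  also have "\<dots> = (\<Prod>j\<in>{..<n}. \<integral>\<^sup>+\<omega>. Y j \<omega> \<partial>M)"
    by (rule indep_vars_nn_integral[OF _ iY]) auto
  also have "\<dots> = (\<integral>\<^sup>+\<omega>. Y i \<omega> \<partial>M) * (\<Prod>j\<in>{..<n} - {i}. \<integral>\<^sup>+\<omega>. Y j \<omega> \<partial>M)"
    using i by (intro prod.remove) auto
  also have "(\<Prod>j\<in>{..<n} - {i}. \<integral>\<^sup>+\<omega>. Y j \<omega> \<partial>M) = (\<Prod>j\<in>{..<n} - {i}. \<integral>\<^sup>+\<omega>. indicator (B j) (\<xi> j \<omega>) \<partial>M)"
    by (intro prod.cong) (auto simp: Y_def)
  also have "(\<integral>\<^sup>+\<omega>. Y i \<omega> \<partial>M) = (\<integral>\<^sup>+\<omega>. f (\<theta> i \<omega>, \<xi> i \<omega>) * indicator (B i) (\<xi> i \<omega>) \<partial>M)"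
    by (simp add: Y_def)
  finally show ?thesis .
qed

text \<open>On boxes the two weighted laws differ only in factor \<open>i\<close>, where
  \<open>theta_xi_nn_integral\<close> equates them; boxes determine the law of the tuple.\<close>

lemma theta_post_tuple:
  assumes i: "i < n"
  shows "distr (density M (\<lambda>\<omega>. ennreal (of_bool (\<theta> i \<omega>)))) (\<Pi>\<^sub>M j\<in>{..<n}. borel) (xi_tuple n)
    = distr (density M (\<lambda>\<omega>. ennreal (post (\<xi> i \<omega>)))) (\<Pi>\<^sub>M j\<in>{..<n}. borel) (xi_tuple n)" (is "?P = ?Q")
proof (rule measure_eqI_PiM_finite[where I = "{..<n}" and M = "\<lambda>_. borel" and A = "\<lambda>_ :: nat. Pi\<^sub>E {..<n} (\<lambda>_. UNIV)"])
  let ?f = "\<lambda>z :: bool \<times> (real, 'k) vec. ennreal (of_bool (fst z))" and ?h = "\<lambda>z :: bool \<times> (real, 'k) vec. ennreal (post (snd z))"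
  have f: "?f \<in> borel_measurable (count_space UNIV \<Otimes>\<^sub>M borel)" and h: "?h \<in> borel_measurable (count_space UNIV \<Otimes>\<^sub>M borel)"
    by measurable
  show eq: "emeasure ?P (Pi\<^sub>E {..<n} B) = emeasure ?Q (Pi\<^sub>E {..<n} B)"
    if B: "\<And>j. j \<in> {..<n} \<Longrightarrow> B j \<in> sets (borel :: (real, 'k) vec measure)" for B
    using weighted_tuple_box[OF i f B] weighted_tuple_box[OF i h B] theta_xi_nn_integral[of "B i" i] B[of i] i by simp
  show "range (\<lambda>_ :: nat. Pi\<^sub>E {..<n} (\<lambda>_. UNIV)) \<subseteq> prod_algebra {..<n} (\<lambda>_. borel :: (real, 'k) vec measure)"
    by (auto intro!: prod_algebraI_finite)
  show "(\<Union>_ :: nat. Pi\<^sub>E {..<n} (\<lambda>_. UNIV)) = space (\<Pi>\<^sub>M j\<in>{..<n}. (borel :: (real, 'k) vec measure))"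
    by (simp add: space_PiM)
  have "emeasure ?P (space ?P) = emeasure (density M (\<lambda>\<omega>. ennreal (of_bool (\<theta> i \<omega>)))) (space M)"
  proof -
    have "xi_tuple n -` ({..<n} \<rightarrow>\<^sub>E UNIV) \<inter> space M = space M" by auto
    then show ?thesis by (subst emeasure_distr) (auto simp: space_PiM)
  qed
  also have "\<dots> \<le> (\<integral>\<^sup>+\<omega>. 1 \<partial>M)"
  proof -
    have "emeasure (density M (\<lambda>\<omega>. ennreal (of_bool (\<theta> i \<omega>)))) (space M)
        = (\<integral>\<^sup>+\<omega>. ennreal (of_bool (\<theta> i \<omega>)) * indicator (space M) \<omega> \<partial>M)"
      by (rule emeasure_density) auto
    also have "\<dots> \<le> (\<integral>\<^sup>+\<omega>. 1 \<partial>M)" by (rule nn_integral_mono) (auto simp: indicator_def)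
    finally show ?thesis .
  qed
  finally have "emeasure ?P (Pi\<^sub>E {..<n} (\<lambda>_. UNIV)) \<le> 1"
    by (simp add: space_PiM emeasure_space_1)
  then have "emeasure ?P (Pi\<^sub>E {..<n} (\<lambda>_. UNIV)) < \<infinity>" by (rule le_less_trans) simp
  then show "emeasure ?P (Pi\<^sub>E {..<n} (\<lambda>_. UNIV)) \<noteq> \<infinity>" for j :: nat by simp
qed simp_all

text \<open>By independence the other p-values carry no information on \<open>\<theta> i\<close>, so
  the posterior given the tuple is the one given its own p-value.\<close>

lemma theta_cond_exp:
  assumes i: "i < n"
  shows "AE \<omega> in M. real_cond_exp M (sigma_xi M \<xi> n) (\<lambda>\<omega>. of_bool (\<theta> i \<omega>)) \<omega> = post (\<xi> i \<omega>)"
proof -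
  interpret F: finite_measure_subalgebra M "sigma_xi M \<xi> n" by (rule finite_measure_subalgebra_xi)
  show ?thesis
  proof (rule F.real_cond_exp_charact)
    show "integrable M (\<lambda>\<omega>. of_bool (\<theta> i \<omega>) :: real)" by (rule bounded_integrable[where c = 1]) auto
    show "integrable M (\<lambda>\<omega>. post (\<xi> i \<omega>))" using post_bounds by (intro bounded_integrable[where c = 1]) auto
    show "(\<lambda>\<omega>. post (\<xi> i \<omega>)) \<in> borel_measurable (sigma_xi M \<xi> n)"
      by (rule measurable_compose[OF xi_measurable_sigma_xi[OF i]]) simp
    fix A assume "A \<in> sets (sigma_xi M \<xi> n)"
    then obtain B where B: "B \<in> sets (\<Pi>\<^sub>M j\<in>{..<n}. borel)" and A: "A = xi_tuple n -` B \<inter> space M"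
      unfolding sigma_xi_def by (subst (asm) sets_vimage_algebra2) (auto simp: space_PiM)
    have A_ev [measurable]: "A \<in> events" unfolding A by (rule measurable_sets[OF xi_tuple_measurable B])
    have em: "emeasure (distr (density M (\<lambda>\<omega>. ennreal (f \<omega>))) (\<Pi>\<^sub>M j\<in>{..<n}. borel) (xi_tuple n)) B
        = ennreal (LINT \<omega>:A|M. f \<omega>)"
      if [measurable]: "f \<in> borel_measurable M" and f01: "\<And>\<omega>. 0 \<le> f \<omega>" "\<And>\<omega>. f \<omega> \<le> 1" for f
    proof -
      have "emeasure (distr (density M (\<lambda>\<omega>. ennreal (f \<omega>))) (\<Pi>\<^sub>M j\<in>{..<n}. borel) (xi_tuple n)) B
          = emeasure (density M (\<lambda>\<omega>. ennreal (f \<omega>))) A"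
        unfolding A by (subst emeasure_distr[OF _ B]) auto
      also have "\<dots> = (\<integral>\<^sup>+\<omega>. ennreal (indicator A \<omega> * f \<omega>) \<partial>M)"
        by (subst emeasure_density) (auto intro!: nn_integral_cong simp: indicator_def)
      also have "\<dots> = ennreal (LINT \<omega>:A|M. f \<omega>)"
        unfolding set_lebesgue_integral_def using f01
        by (subst nn_integral_eq_integral) (auto intro!: bounded_integrable[where c = 1] simp: indicator_def)
      finally show ?thesis .
    qed
    have "ennreal (LINT \<omega>:A|M. of_bool (\<theta> i \<omega>)) = ennreal (LINT \<omega>:A|M. post (\<xi> i \<omega>))"
      using em[of "\<lambda>\<omega>. of_bool (\<theta> i \<omega>)"] em[of "\<lambda>\<omega>. post (\<xi> i \<omega>)"] post_bounds theta_post_tuple[OF i] by simp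
    then show "(LINT \<omega>:A|M. of_bool (\<theta> i \<omega>)) = (LINT \<omega>:A|M. post (\<xi> i \<omega>))"
      by (subst (asm) ennreal_inj)
         (auto simp: set_lebesgue_integral_def post_bounds intro!: integral_nonneg_AE)
  qed
qed

text \<open>Two conditionings in turn: given p-values and truth, (A) replaces the decision by a
  function of the p-values; given the p-values, \<open>\<theta> i\<close> then becomes its
  posterior, and the decision is restored. Since (A) is stated for whole decision sets, the event of
  rejecting \<open>i\<close> is split over the sets containing it.\<close>

lemma condition_A_expectation:
  assumes n: "1 \<le> n" and D: "\<Delta> n \<in> M \<rightarrow>\<^sub>M count_space (Pow {..<n})"
    and A: "condition_A M \<xi> \<theta> \<Delta>" and i: "i < n"
  shows "expectation (\<lambda>\<omega>. of_bool (i \<in> \<Delta> n \<omega>) * of_bool (\<theta> i \<omega>))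
       = expectation (\<lambda>\<omega>. of_bool (i \<in> \<Delta> n \<omega>) * post (\<xi> i \<omega>))"
proof -
  interpret F: finite_measure_subalgebra M "sigma_xi M \<xi> n" by (rule finite_measure_subalgebra_xi)
  interpret F2: finite_measure_subalgebra M "sigma_xi_theta M \<xi> \<theta> n" by (rule finite_measure_subalgebra_xi_theta)
  let ?I = "\<lambda>D. indicator {\<omega> \<in> space M. \<Delta> n \<omega> = D} :: 'w \<Rightarrow> real"
  let ?th = "\<lambda>\<omega>. of_bool (\<theta> i \<omega>) :: real" and ?w = "\<lambda>\<omega>. post (\<xi> i \<omega>)"
  have ev [measurable]: "{\<omega> \<in> space M. \<Delta> n \<omega> = D} \<in> events" for D by (rule decision_sets[OF D])
  have intI: "integrable M (?I D)" for D by (rule bounded_integrable[where c = 1]) (auto simp: indicator_def)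
  have w01: "\<bar>?w \<omega>\<bar> \<le> 1" for \<omega> using post_bounds[of "\<xi> i \<omega>"] by simp
  have each: "expectation (\<lambda>\<omega>. ?I D \<omega> * ?th \<omega>) = expectation (\<lambda>\<omega>. ?I D \<omega> * ?w \<omega>)" if Dn: "D \<subseteq> {..<n}" for D
  proof -
    let ?c = "real_cond_exp M (sigma_xi M \<xi> n) (?I D)"
    have th_F2: "?th \<in> borel_measurable (sigma_xi_theta M \<xi> \<theta> n)"
      by (rule measurable_compose[OF xi_theta_measurable_sigma_xi_theta(2)[OF i]]) simp
    have w_F: "?w \<in> borel_measurable (sigma_xi M \<xi> n)"
      by (rule measurable_compose[OF xi_measurable_sigma_xi[OF i]]) simp
    have c_F: "?c \<in> borel_measurable (sigma_xi M \<xi> n)" by (rule borel_measurable_cond_exp)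
    have c_M [measurable]: "?c \<in> borel_measurable M" by (rule borel_measurable_cond_exp2)
    have c_int: "integrable M ?c" by (rule F.real_cond_exp_int(1)[OF intI])
    have c_th: "integrable M (\<lambda>\<omega>. ?c \<omega> * ?th \<omega>)"
      by (rule Bochner_Integration.integrable_bound[OF c_int]) auto
    have "expectation (\<lambda>\<omega>. ?I D \<omega> * ?th \<omega>) = expectation (\<lambda>\<omega>. ?th \<omega> * ?I D \<omega>)" by (simp add: mult.commute)
    also have "\<dots> = expectation (\<lambda>\<omega>. ?th \<omega> * real_cond_exp M (sigma_xi_theta M \<xi> \<theta> n) (?I D) \<omega>)"
      by (rule F2.real_cond_exp_intg(2)[OF _ th_F2, symmetric])
         (auto intro!: bounded_integrable[where c = 1] simp: indicator_def)
    also have "\<dots> = expectation (\<lambda>\<omega>. ?c \<omega> * ?th \<omega>)"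
    proof (rule integral_cong_AE)
      have "AE \<omega> in M. real_cond_exp M (sigma_xi_theta M \<xi> \<theta> n) (?I D) \<omega> = ?c \<omega>"
        using A n Dn by (simp add: condition_A_def)
      then show "AE \<omega> in M. ?th \<omega> * real_cond_exp M (sigma_xi_theta M \<xi> \<theta> n) (?I D) \<omega> = ?c \<omega> * ?th \<omega>"
        by eventually_elim simp
    qed (auto intro!: borel_measurable_cond_exp2 borel_measurable_times)
    also have "\<dots> = expectation (\<lambda>\<omega>. ?c \<omega> * real_cond_exp M (sigma_xi M \<xi> n) ?th \<omega>)"
      by (rule F.real_cond_exp_intg(2)[OF c_th c_F, symmetric]) simp
    also have "\<dots> = expectation (\<lambda>\<omega>. ?w \<omega> * ?c \<omega>)"
    proof (rule integral_cong_AE)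
      show "AE \<omega> in M. ?c \<omega> * real_cond_exp M (sigma_xi M \<xi> n) ?th \<omega> = ?w \<omega> * ?c \<omega>"
        using theta_cond_exp[OF i] by eventually_elim simp
    qed (auto intro!: borel_measurable_cond_exp2 borel_measurable_times)
    also have "\<dots> = expectation (\<lambda>\<omega>. ?w \<omega> * ?I D \<omega>)"
      by (rule F.real_cond_exp_intg(2)[OF _ w_F])
         (auto intro!: bounded_integrable[where c = 1] simp: indicator_def w01)
    finally show ?thesis by (simp add: mult.commute)
  qed
  have split: "of_bool (i \<in> \<Delta> n \<omega>) = (\<Sum>D\<in>{D \<in> Pow {..<n}. i \<in> D}. ?I D \<omega>)" if "\<omega> \<in> space M" for \<omega>
  proof -
    have "(\<Sum>D\<in>{D \<in> Pow {..<n}. i \<in> D}. ?I D \<omega>) = (\<Sum>D\<in>{D \<in> Pow {..<n}. i \<in> D}. if D = \<Delta> n \<omega> then 1 else 0)"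
      using that by (intro sum.cong) (auto simp: indicator_def)
    also have "\<dots> = of_bool (i \<in> \<Delta> n \<omega>)"
      using decision_subset[OF D that] by (subst sum.delta) auto
    finally show ?thesis by simp
  qed
  have sum_eq: "expectation (\<lambda>\<omega>. of_bool (i \<in> \<Delta> n \<omega>) * f \<omega>) = (\<Sum>D\<in>{D \<in> Pow {..<n}. i \<in> D}. expectation (\<lambda>\<omega>. ?I D \<omega> * f \<omega>))"
    if [measurable]: "f \<in> borel_measurable M" and f: "\<And>\<omega>. \<bar>f \<omega>\<bar> \<le> 1" for f
  proof -
    have "expectation (\<lambda>\<omega>. of_bool (i \<in> \<Delta> n \<omega>) * f \<omega>)
        = expectation (\<lambda>\<omega>. \<Sum>D\<in>{D \<in> Pow {..<n}. i \<in> D}. ?I D \<omega> * f \<omega>)"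
      by (intro Bochner_Integration.integral_cong refl) (simp add: split sum_distrib_right)
    also have "\<dots> = (\<Sum>D\<in>{D \<in> Pow {..<n}. i \<in> D}. expectation (\<lambda>\<omega>. ?I D \<omega> * f \<omega>))"
      by (rule Bochner_Integration.integral_sum, rule bounded_integrable[where c = 1])
         (auto simp: indicator_def f)
    finally show ?thesis .
  qed
  show ?thesis
    using w01 by (subst (1 2) sum_eq) (auto intro!: sum.cong each)
qed

text \<open>Neyman--Pearson: \<open>D\<^sub>t\<close> is the likelihood ratio region with threshold \<open>lev t\<close>.\<close>

lemma neyman_pearson:
  assumes n: "1 \<le> n" and D: "\<Delta> n \<in> M \<rightarrow>\<^sub>M count_space (Pow {..<n})"
    and A: "condition_A M \<xi> \<theta> \<Delta>" and t: "0 < t" "t \<le> 1"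
  shows "expectation (\<lambda>\<omega>. real (card {i \<in> \<Delta> n \<omega>. \<theta> i \<omega>})) / a
      - lev t * (expectation (\<lambda>\<omega>. real (card {i \<in> \<Delta> n \<omega>. \<not> \<theta> i \<omega>})) / (1 - a)) \<le> n * (G t - lev t * t)"
proof -
  have [measurable]: "{\<omega> \<in> space M. i \<in> \<Delta> n \<omega>} \<in> events" for i by (rule decision_sets[OF D])
  have card_sum: "real (card {i \<in> \<Delta> n \<omega>. Q i}) = (\<Sum>i<n. of_bool (i \<in> \<Delta> n \<omega>) * of_bool (Q i))"
    if "\<omega> \<in> space M" for \<omega> Q
  proof -
    have "{i \<in> \<Delta> n \<omega>. Q i} = {i \<in> {..<n}. i \<in> \<Delta> n \<omega> \<and> Q i}" using decision_subset[OF D that] by auto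
    then have "real (card {i \<in> \<Delta> n \<omega>. Q i}) = (\<Sum>i<n. of_bool (i \<in> \<Delta> n \<omega> \<and> Q i))"
      by (simp add: of_bool_def sum.If_cases Int_def)
    then show ?thesis by (simp add: of_bool_conj)
  qed
  let ?m = "\<lambda>i \<omega>. of_bool (i \<in> \<Delta> n \<omega>) :: real"
  have card_exp: "expectation (\<lambda>\<omega>. real (card {i \<in> \<Delta> n \<omega>. Q i \<omega>})) = (\<Sum>i<n. expectation (\<lambda>\<omega>. ?m i \<omega> * of_bool (Q i \<omega>)))"
    if [measurable]: "\<And>i. Measurable.pred M (Q i)" for Q
  proof -
    have "expectation (\<lambda>\<omega>. real (card {i \<in> \<Delta> n \<omega>. Q i \<omega>})) = expectation (\<lambda>\<omega>. \<Sum>i<n. ?m i \<omega> * of_bool (Q i \<omega>))"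
      by (intro Bochner_Integration.integral_cong refl card_sum)
    also have "\<dots> = (\<Sum>i<n. expectation (\<lambda>\<omega>. ?m i \<omega> * of_bool (Q i \<omega>)))"
      by (rule Bochner_Integration.integral_sum, rule bounded_integrable[where c = 1]) auto
    finally show ?thesis .
  qed
  have each: "expectation (\<lambda>\<omega>. ?m i \<omega> * of_bool (\<theta> i \<omega>)) / a
      - lev t * (expectation (\<lambda>\<omega>. ?m i \<omega> * of_bool (\<not> \<theta> i \<omega>)) / (1 - a)) \<le> G t - lev t * t" if i: "i < n" for i
  proof -
    let ?l = "\<lambda>x. (g x - lev t) / mass x"
    \<comment> \<open>The combination of true and false rejection rates has integrand
      \<open>(g - lev t) / mass\<close>; under the law of the p-values, \<open>mass\<close> cancels
      and the excess integral remains.\<close>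
    have lr: "post x / a - lev t * ((1 - post x) / (1 - a)) = ?l x" for x
    proof -
      have "post x / a = g x / mass x" using a by (simp add: post_def)
      moreover have "1 - post x = (1 - a) / mass x"
        using mass_pos[of x] by (simp add: post_def field_simps) (simp add: mass_def algebra_simps)
      then have "(1 - post x) / (1 - a) = 1 / mass x" using a by simp
      ultimately show ?thesis by (simp add: diff_divide_distrib)
    qed
    have i1: "integrable M (\<lambda>\<omega>. ?m i \<omega>)" by (rule bounded_integrable[where c = 1]) auto
    have i2: "integrable M (\<lambda>\<omega>. ?m i \<omega> * post (\<xi> i \<omega>))"
      using post_bounds by (intro bounded_integrable[where c = 1]) auto
    have i3: "integrable M (\<lambda>\<omega>. ?m i \<omega> * of_bool (\<theta> i \<omega>))" by (rule bounded_integrable[where c = 1]) auto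
    have eq1: "expectation (\<lambda>\<omega>. ?m i \<omega> * of_bool (\<theta> i \<omega>)) = expectation (\<lambda>\<omega>. ?m i \<omega> * post (\<xi> i \<omega>))"
      by (rule condition_A_expectation[OF n D A i])
    have "expectation (\<lambda>\<omega>. ?m i \<omega> * of_bool (\<not> \<theta> i \<omega>)) = expectation (\<lambda>\<omega>. ?m i \<omega> - ?m i \<omega> * of_bool (\<theta> i \<omega>))"
      by (intro Bochner_Integration.integral_cong) auto
    also have "\<dots> = expectation (?m i) - expectation (\<lambda>\<omega>. ?m i \<omega> * post (\<xi> i \<omega>))"
      using i1 i3 eq1 by simp
    finally have eq2: "expectation (\<lambda>\<omega>. ?m i \<omega> * of_bool (\<not> \<theta> i \<omega>)) = expectation (?m i) - expectation (\<lambda>\<omega>. ?m i \<omega> * post (\<xi> i \<omega>))" .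
    have il: "integrable M (\<lambda>\<omega>. ?m i \<omega> * ?l (\<xi> i \<omega>))" and
      eq3: "expectation (\<lambda>\<omega>. ?m i \<omega> * ?l (\<xi> i \<omega>)) = expectation (\<lambda>\<omega>. ?m i \<omega> * post (\<xi> i \<omega>)) / a
        - lev t * ((expectation (?m i) - expectation (\<lambda>\<omega>. ?m i \<omega> * post (\<xi> i \<omega>))) / (1 - a))"
    proof -
      have "(\<lambda>\<omega>. ?m i \<omega> * ?l (\<xi> i \<omega>)) = (\<lambda>\<omega>. ?m i \<omega> * post (\<xi> i \<omega>) / a
          - lev t * ((?m i \<omega> - ?m i \<omega> * post (\<xi> i \<omega>)) / (1 - a)))"
        unfolding lr[symmetric] by (simp add: fun_eq_iff algebra_simps diff_divide_distrib)
      moreover have "integrable M (\<lambda>\<omega>. ?m i \<omega> * post (\<xi> i \<omega>) / a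
          - lev t * ((?m i \<omega> - ?m i \<omega> * post (\<xi> i \<omega>)) / (1 - a)))"
        using i1 i2 by (intro Bochner_Integration.integrable_diff integrable_mult_right integrable_divide)
      moreover have "expectation (\<lambda>\<omega>. ?m i \<omega> * post (\<xi> i \<omega>) / a
          - lev t * ((?m i \<omega> - ?m i \<omega> * post (\<xi> i \<omega>)) / (1 - a)))
         = expectation (\<lambda>\<omega>. ?m i \<omega> * post (\<xi> i \<omega>)) / a
        - lev t * ((expectation (?m i) - expectation (\<lambda>\<omega>. ?m i \<omega> * post (\<xi> i \<omega>))) / (1 - a))"
        using i1 i2 by simp
      ultimately show "integrable M (\<lambda>\<omega>. ?m i \<omega> * ?l (\<xi> i \<omega>))"
        "expectation (\<lambda>\<omega>. ?m i \<omega> * ?l (\<xi> i \<omega>)) = expectation (\<lambda>\<omega>. ?m i \<omega> * post (\<xi> i \<omega>)) / a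
        - lev t * ((expectation (?m i) - expectation (\<lambda>\<omega>. ?m i \<omega> * post (\<xi> i \<omega>))) / (1 - a))"
        by simp_all
    qed
    have "\<bar>max 0 (?l x)\<bar> \<le> 1 / a" for x
    proof -
      have "?l x \<le> g x / mass x"
        using lev_pos(1)[OF t] mass_pos[of x] by (intro divide_right_mono) auto
      also have "\<dots> = post x / a" using a by (simp add: post_def)
      also have "\<dots> \<le> 1 / a" using a post_bounds[of x] by (intro divide_right_mono) auto
      finally show ?thesis using a by simp
    qed
    then have im: "integrable M (\<lambda>\<omega>. max 0 (?l (\<xi> i \<omega>)))" by (intro bounded_integrable[where c = "1 / a"]) auto
    have "expectation (\<lambda>\<omega>. ?m i \<omega> * ?l (\<xi> i \<omega>)) \<le> expectation (\<lambda>\<omega>. max 0 (?l (\<xi> i \<omega>)))"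
      by (intro integral_mono il im) auto
    also have "\<dots> = (\<integral>x. mass x * max 0 (?l x) \<partial>unif_cube)"
      by (rule xi_expectation) measurable
    also have "\<dots> = (\<integral>x. max 0 (g x - lev t) \<partial>unif_cube)"
    proof (intro Bochner_Integration.integral_cong refl)
      fix x
      show "mass x * max 0 (?l x) = max 0 (g x - lev t)"
        using max_mult_distrib_left[of "mass x" 0 "?l x"] mass_pos[of x] by simp
    qed
    also have "\<dots> = G t - lev t * t" by (rule excess_integral[OF t])
    finally show ?thesis unfolding eq1 eq2 eq3 .
  qed
  have "expectation (\<lambda>\<omega>. real (card {i \<in> \<Delta> n \<omega>. \<theta> i \<omega>})) / a
      - lev t * (expectation (\<lambda>\<omega>. real (card {i \<in> \<Delta> n \<omega>. \<not> \<theta> i \<omega>})) / (1 - a))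
     = (\<Sum>i<n. expectation (\<lambda>\<omega>. ?m i \<omega> * of_bool (\<theta> i \<omega>)) / a
      - lev t * (expectation (\<lambda>\<omega>. ?m i \<omega> * of_bool (\<not> \<theta> i \<omega>)) / (1 - a)))"
    by (subst card_exp, simp, subst card_exp, simp) (simp add: sum_divide_distrib sum_distrib_left sum_subtractf)
  also have "\<dots> \<le> (\<Sum>i<n. G t - lev t * t)" by (intro sum_mono each) simp
  finally show ?thesis by simp
qed

section \<open>Procedures satisfying condition (B)\<close>

lemma xi_tuple_cube: "xi_tuple n \<omega> \<in> {..<n} \<rightarrow>\<^sub>E unit_cube"
  using xi_cube by simp

lemma kernel_measurable:
  assumes tp: "testing_procedure M \<xi> \<kappa> \<Delta>" and n: "1 \<le> n"
  shows "(\<lambda>\<omega>. pmf (\<kappa> n (xi_tuple n \<omega>)) D) \<in> borel_measurable M"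
proof -
  have "(\<lambda>S. pmf (\<kappa> n S) D) \<in> borel_measurable (restrict_space (\<Pi>\<^sub>M i\<in>{..<n}. borel) ({..<n} \<rightarrow>\<^sub>E unit_cube))"
    using tp n by (simp add: testing_procedure_def)
  moreover have "xi_tuple n \<in> M \<rightarrow>\<^sub>M restrict_space (\<Pi>\<^sub>M i\<in>{..<n}. borel) ({..<n} \<rightarrow>\<^sub>E unit_cube)"
    using xi_tuple_cube by (intro measurable_restrict_space2 xi_tuple_measurable) simp
  ultimately show ?thesis by (rule measurable_compose[rotated])
qed

lemma kernel_prob_sum:
  assumes tp: "testing_procedure M \<xi> \<kappa> \<Delta>" and n: "1 \<le> n"
  shows "measure_pmf.prob (\<kappa> n (xi_tuple n \<omega>)) {D. P D}
    = (\<Sum>D\<in>{D \<in> Pow {..<n}. P D}. pmf (\<kappa> n (xi_tuple n \<omega>)) D)"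
proof -
  let ?p = "\<kappa> n (xi_tuple n \<omega>)"
  have "set_pmf ?p \<subseteq> Pow {..<n}"
    using tp n xi_tuple_cube by (simp add: testing_procedure_def)
  then have "{D. P D} \<inter> set_pmf ?p = {D \<in> Pow {..<n}. P D} \<inter> set_pmf ?p" by auto
  then have "measure_pmf.prob ?p {D. P D} = measure_pmf.prob ?p {D \<in> Pow {..<n}. P D}"
    by (metis measure_Int_set_pmf)
  then show ?thesis by (simp add: measure_measure_pmf_finite)
qed

lemma decision_law:
  assumes tp: "testing_procedure M \<xi> \<kappa> \<Delta>" and n: "1 \<le> n"
  shows "prob {\<omega> \<in> space M. P (\<Delta> n \<omega>)} = expectation (\<lambda>\<omega>. measure_pmf.prob (\<kappa> n (xi_tuple n \<omega>)) {D. P D})"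
proof -
  have D: "\<Delta> n \<in> M \<rightarrow>\<^sub>M count_space (Pow {..<n})" using tp n by (simp add: testing_procedure_def)
  interpret F: finite_measure_subalgebra M "sigma_xi M \<xi> n" by (rule finite_measure_subalgebra_xi)
  have ev [measurable]: "{\<omega> \<in> space M. \<Delta> n \<omega> = D} \<in> events" for D by (rule decision_sets[OF D])
  note [measurable] = kernel_measurable[OF tp n]
  have each: "prob {\<omega> \<in> space M. \<Delta> n \<omega> = D} = expectation (\<lambda>\<omega>. pmf (\<kappa> n (xi_tuple n \<omega>)) D)" for D
  proof -
    let ?I = "indicator {\<omega> \<in> space M. \<Delta> n \<omega> = D} :: 'w \<Rightarrow> real"
    have i: "integrable M ?I" by (rule bounded_integrable[where c = 1]) (auto simp: indicator_def)
    have "prob {\<omega> \<in> space M. \<Delta> n \<omega> = D} = expectation ?I" by simp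
    also have "\<dots> = expectation (real_cond_exp M (sigma_xi M \<xi> n) ?I)"
      by (rule F.real_cond_exp_int(2)[OF i, symmetric])
    also have "\<dots> = expectation (\<lambda>\<omega>. pmf (\<kappa> n (xi_tuple n \<omega>)) D)"
      using tp n by (intro integral_cong_AE borel_measurable_cond_exp2) (auto simp: testing_procedure_def)
    finally show ?thesis .
  qed
  have "{\<omega> \<in> space M. P (\<Delta> n \<omega>)} = (\<Union>D\<in>{D \<in> Pow {..<n}. P D}. {\<omega> \<in> space M. \<Delta> n \<omega> = D})"
    using decision_subset[OF D] by auto
  then have "prob {\<omega> \<in> space M. P (\<Delta> n \<omega>)} = (\<Sum>D\<in>{D \<in> Pow {..<n}. P D}. prob {\<omega> \<in> space M. \<Delta> n \<omega> = D})"
    by (simp only:) (intro finite_measure_finite_Union, auto simp: disjoint_family_on_def)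
  also have "\<dots> = expectation (\<lambda>\<omega>. \<Sum>D\<in>{D \<in> Pow {..<n}. P D}. pmf (\<kappa> n (xi_tuple n \<omega>)) D)"
    unfolding each
    by (rule Bochner_Integration.integral_sum[symmetric], rule bounded_integrable[where c = 1]) (auto simp: pmf_le_1)
  also have "\<dots> = expectation (\<lambda>\<omega>. measure_pmf.prob (\<kappa> n (xi_tuple n \<omega>)) {D. P D})"
    by (simp only: kernel_prob_sum[OF tp n])
  finally show ?thesis .
qed

text \<open>The limit in condition (B) does not depend on the realisation: interleave two of them.\<close>

lemma rejection_limit:
  assumes tp: "testing_procedure M \<xi> \<kappa> \<Delta>" and B: "condition_B F \<kappa>"
  obtains c where "\<And>\<epsilon>. 0 < \<epsilon> \<Longrightarrow>
    (\<lambda>n. prob {\<omega> \<in> space M. \<epsilon> < \<bar>real (card (\<Delta> n \<omega>)) / n - c\<bar>}) \<longlonglongrightarrow> 0"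
proof -
  define good where "good \<omega> \<longleftrightarrow> (\<lambda>n. SUP x. \<bar>Fhat n (xi_tuple n \<omega>) x - F x\<bar>) \<longlonglongrightarrow> 0" for \<omega>
  have "Fhat n (xi_tuple n \<omega>) x = Fhat n (\<lambda>i. \<xi> i \<omega>) x" for n \<omega> x
    by (rule Fhat_cong) simp
  then have ae: "AE \<omega> in M. good \<omega>" using glivenko_cantelli by (simp add: good_def)
  then obtain \<omega>0 where g0: "good \<omega>0" using AE_False by (metis (mono_tags, lifting) eventually_mono)
  let ?p = "\<lambda>n \<omega> \<epsilon> c. measure_pmf.prob (\<kappa> n (xi_tuple n \<omega>)) {D. \<epsilon> < \<bar>real (card D) / real n - c\<bar>}"
  have "\<exists>c. \<forall>\<epsilon>>0. (\<lambda>n. ?p n \<omega>0 \<epsilon> c) \<longlonglongrightarrow> 0"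
    using B[unfolded condition_B_def, rule_format, of "\<lambda>n. n" "\<lambda>n. xi_tuple n \<omega>0"] g0 xi_tuple_cube
    by (simp add: good_def filterlim_ident)
  then obtain c where c: "\<And>\<epsilon>. 0 < \<epsilon> \<Longrightarrow> (\<lambda>n. ?p n \<omega>0 \<epsilon> c) \<longlonglongrightarrow> 0" by blast
  have conc: "(\<lambda>n. ?p n \<omega> \<epsilon> c) \<longlonglongrightarrow> 0" if g: "good \<omega>" and \<epsilon>: "0 < \<epsilon>" for \<omega> \<epsilon>
  proof -
    \<comment> \<open>Each size \<open>j div 2\<close> occurs twice, once per realisation, so the
      even and the odd subsequence recover the two full sequences and must share the limit granted
      by (B).\<close>
    define W where "W j = (if even j then \<omega>0 else \<omega>)" for j :: nat
    have half: "filterlim (\<lambda>j :: nat. j div 2) at_top sequentially"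
      unfolding filterlim_at_top eventually_sequentially
    proof
      fix Z :: nat
      show "\<exists>N. \<forall>n\<ge>N. Z \<le> n div 2" by (intro exI[of _ "2 * Z"]) auto
    qed
    have lim: "(\<lambda>j. SUP x. \<bar>Fhat (j div 2) (xi_tuple (j div 2) (W j)) x - F x\<bar>) \<longlonglongrightarrow> 0"
    proof (rule Lim_null_comparison)
      let ?s = "\<lambda>n \<omega>. SUP x. \<bar>Fhat n (xi_tuple n \<omega>) x - F x\<bar>"
      show "(\<lambda>j. \<bar>?s (j div 2) \<omega>0\<bar> + \<bar>?s (j div 2) \<omega>\<bar>) \<longlonglongrightarrow> 0"
        using filterlim_compose[OF g0[unfolded good_def] half] filterlim_compose[OF g[unfolded good_def] half]
        by (intro tendsto_add_zero tendsto_rabs_zero)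
      show "\<forall>\<^sub>F j in sequentially. norm (?s (j div 2) (W j)) \<le> \<bar>?s (j div 2) \<omega>0\<bar> + \<bar>?s (j div 2) \<omega>\<bar>"
        by (intro always_eventually allI) (simp add: W_def)
    qed
    have "\<exists>c'. \<forall>\<epsilon>>0. (\<lambda>j. ?p (j div 2) (W j) \<epsilon> c') \<longlonglongrightarrow> 0"
      using B[unfolded condition_B_def, rule_format, of "\<lambda>j. j div 2" "\<lambda>j. xi_tuple (j div 2) (W j)", OF half] lim xi_tuple_cube
      by simp
    then obtain c' where c': "\<And>\<epsilon>. 0 < \<epsilon> \<Longrightarrow> (\<lambda>j. ?p (j div 2) (W j) \<epsilon> c') \<longlonglongrightarrow> 0" by blast
    have sub: "strict_mono (\<lambda>n :: nat. 2 * n)" "strict_mono (\<lambda>n :: nat. 2 * n + 1)"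
      by (auto simp: strict_mono_def)
    have "(\<lambda>n. ?p n \<omega>0 \<epsilon> c') \<longlonglongrightarrow> 0" if "0 < \<epsilon>" for \<epsilon>
      using LIMSEQ_subseq_LIMSEQ[OF c'[OF that] sub(1)] by (simp add: comp_def W_def)
    then have "c = c'" using pmf_concentration_unique[OF c] by blast
    then show ?thesis
      using LIMSEQ_subseq_LIMSEQ[OF c'[OF \<epsilon>] sub(2)] by (simp add: comp_def W_def)
  qed
  show thesis
  proof (rule that)
    fix \<epsilon> :: real assume \<epsilon>: "0 < \<epsilon>"
    have m: "(\<lambda>\<omega>. ?p (Suc n) \<omega> \<epsilon> c) \<in> borel_measurable M" for n
    proof -
      note [measurable] = kernel_measurable[OF tp, of "Suc n", simplified]
      show ?thesis unfolding kernel_prob_sum[OF tp, of "Suc n", simplified] by measurable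
    qed
    have "(\<lambda>n. expectation (\<lambda>\<omega>. ?p (Suc n) \<omega> \<epsilon> c)) \<longlonglongrightarrow> expectation (\<lambda>_. 0)"
    proof (rule integral_dominated_convergence[where w = "\<lambda>_. 1"])
      show "AE \<omega> in M. (\<lambda>n. ?p (Suc n) \<omega> \<epsilon> c) \<longlonglongrightarrow> 0"
        using ae by eventually_elim (intro LIMSEQ_Suc conc \<epsilon>)
    qed (auto simp: m simp del: of_nat_Suc)
    moreover have "prob {\<omega> \<in> space M. \<epsilon> < \<bar>real (card (\<Delta> (Suc n) \<omega>)) / Suc n - c\<bar>} = expectation (\<lambda>\<omega>. ?p (Suc n) \<omega> \<epsilon> c)" for n
      using decision_law[OF tp, of "Suc n" "\<lambda>D. \<epsilon> < \<bar>real (card D) / Suc n - c\<bar>"] by (simp del: of_nat_Suc)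
    ultimately have "(\<lambda>n. prob {\<omega> \<in> space M. \<epsilon> < \<bar>real (card (\<Delta> (Suc n) \<omega>)) / Suc n - c\<bar>}) \<longlonglongrightarrow> 0"
      by (simp del: of_nat_Suc)
    then show "(\<lambda>n. prob {\<omega> \<in> space M. \<epsilon> < \<bar>real (card (\<Delta> n \<omega>)) / n - c\<bar>}) \<longlonglongrightarrow> 0"
      by (rule LIMSEQ_imp_Suc)
  qed
qed

text \<open>Rejection rates are bounded by 1, so convergence in probability upgrades to convergence
  in mean, which is what expectations of \<open>V\<close> and \<open>R\<close> require.\<close>

lemma L1_rejection_limit:
  fixes \<Delta> :: "nat \<Rightarrow> 'w \<Rightarrow> nat set"
  assumes D: "\<And>n. 1 \<le> n \<Longrightarrow> \<Delta> n \<in> M \<rightarrow>\<^sub>M count_space (Pow {..<n})"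
    and c: "\<And>\<epsilon>. 0 < \<epsilon> \<Longrightarrow> (\<lambda>n. prob {\<omega> \<in> space M. \<epsilon> < \<bar>real (card (\<Delta> n \<omega>)) / n - c\<bar>}) \<longlonglongrightarrow> 0"
  shows "(\<lambda>n. expectation (\<lambda>\<omega>. \<bar>real (card (\<Delta> n \<omega>)) / n - c\<bar>)) \<longlonglongrightarrow> 0"
proof (rule tendstoI)
  fix \<epsilon> :: real assume \<epsilon>: "0 < \<epsilon>"
  define K where "K = 1 + \<bar>c\<bar>"
  have K: "0 < K" by (simp add: K_def add_pos_nonneg)
  have "\<forall>\<^sub>F n in sequentially. prob {\<omega> \<in> space M. \<epsilon> / 2 < \<bar>real (card (\<Delta> n \<omega>)) / n - c\<bar>} < \<epsilon> / (2 * K)"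
    using \<epsilon> K by (intro order_tendstoD(2)[OF c]) auto
  then show "\<forall>\<^sub>F n in sequentially. dist (expectation (\<lambda>\<omega>. \<bar>real (card (\<Delta> n \<omega>)) / n - c\<bar>)) 0 < \<epsilon>"
    using eventually_ge_at_top[of 1]
  proof eventually_elim
    case (elim n)
    note [measurable] = decision_card_measurable(1)[OF D[OF elim(2)]]
    let ?A = "{\<omega> \<in> space M. \<epsilon> / 2 < \<bar>real (card (\<Delta> n \<omega>)) / n - c\<bar>}"
    have le: "\<bar>real (card (\<Delta> n \<omega>)) / n - c\<bar> \<le> K" if "\<omega> \<in> space M" for \<omega>
    proof -
      have "real (card (\<Delta> n \<omega>)) / n \<le> 1"
        using card_reject_bounds(1)[OF decision_subset[OF D[OF elim(2)] that]] elim(2) by (simp add: divide_le_eq_1)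
      then show ?thesis by (simp add: K_def abs_le_iff) (smt (verit) divide_nonneg_nonneg of_nat_0_le_iff)
    qed
    have "expectation (\<lambda>\<omega>. \<bar>real (card (\<Delta> n \<omega>)) / n - c\<bar>) \<le> expectation (\<lambda>\<omega>. \<epsilon> / 2 + K * indicator ?A \<omega>)"
    proof (rule integral_mono)
      show "integrable M (\<lambda>\<omega>. \<bar>real (card (\<Delta> n \<omega>)) / n - c\<bar>)"
        using le by (intro bounded_integrable[where c = K]) auto
      show "integrable M (\<lambda>\<omega>. \<epsilon> / 2 + K * indicator ?A \<omega>)"
        using \<epsilon> K by (intro bounded_integrable[where c = "\<epsilon> / 2 + K"]) (auto simp: indicator_def)
      show "\<bar>real (card (\<Delta> n \<omega>)) / n - c\<bar> \<le> \<epsilon> / 2 + K * indicator ?A \<omega>" if "\<omega> \<in> space M" for \<omega>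
        using le[OF that] \<epsilon> that by (auto simp: indicator_def)
    qed
    also have "\<dots> = \<epsilon> / 2 + K * prob ?A"
      by (subst Bochner_Integration.integral_add) (auto simp: prob_space emeasure_eq_measure)
    also have "\<dots> < \<epsilon> / 2 + K * (\<epsilon> / (2 * K))"
      using elim(1) K by (intro add_strict_left_mono mult_strict_left_mono) auto
    also have "\<dots> = \<epsilon>" using K by simp
    finally show ?case by (simp add: dist_real_def)
  qed
qed

text \<open>Up to vanishing errors, the FDR bound reads \<open>s \<le> \<alpha> * c\<close>, the
  rejections add up to \<open>c = (1 - a) * s + a * r\<close>, and Neyman--Pearson bounds
  \<open>r\<close> by a linear function of \<open>s\<close>. Eliminating \<open>c\<close> and
  \<open>r\<close> leaves \<open>(1 - k) * (s - t) \<le> \<alpha> * H t - t < 0\<close>. As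
  \<open>k < 1\<close>, this gives \<open>s < t\<close>, and the tangent, having nonnegative slope,
  gives \<open>r \<le> G t\<close>.\<close>

lemma power_upper_tangent:
  assumes \<alpha>: "0 < \<alpha>" "\<alpha> < 1" and tp: "testing_procedure M \<xi> \<kappa> \<Delta>" and A: "condition_A M \<xi> \<theta> \<Delta>"
    and B: "condition_B F \<kappa>" and FDR: "\<And>n. 1 \<le> n \<Longrightarrow> FDR M \<theta> \<Delta> n \<le> (1 - a) * \<alpha>"
    and t: "0 < t" "t \<le> 1" "\<alpha> * H t < t" and \<eta>: "0 < \<eta>"
  shows "\<forall>\<^sub>F n in sequentially. mt_power M \<theta> \<Delta> n < G t + \<eta>"
proof -
  have D: "\<Delta> n \<in> M \<rightarrow>\<^sub>M count_space (Pow {..<n})" if "1 \<le> n" for n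
    using tp that by (simp add: testing_procedure_def)
  obtain c where c: "\<And>\<epsilon>. 0 < \<epsilon> \<Longrightarrow> (\<lambda>n. prob {\<omega> \<in> space M. \<epsilon> < \<bar>real (card (\<Delta> n \<omega>)) / n - c\<bar>}) \<longlonglongrightarrow> 0"
    using rejection_limit[OF tp B] by blast
  let ?R = "\<lambda>n \<omega>. real (card (\<Delta> n \<omega>))" and ?V = "\<lambda>n \<omega>. real (card {i \<in> \<Delta> n \<omega>. \<not> \<theta> i \<omega>})"
    and ?T = "\<lambda>n \<omega>. real (card {i \<in> \<Delta> n \<omega>. \<theta> i \<omega>})"
  \<comment> \<open>\<open>e\<close> is the error in the limit of the rejection rate and
    \<open>d\<close> that of replacing the number of false nulls by \<open>n * a\<close>;
    \<open>s\<close> and \<open>r\<close> are the expected numbers of false and true rejections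
    relative to the expected numbers of true and false nulls.\<close>
  define e where "e n = expectation (\<lambda>\<omega>. \<bar>?R n \<omega> / n - c\<bar>)" for n
  define d where "d n = expectation (\<lambda>\<omega>. \<bar>1 - nonnull n \<omega> / (n * a)\<bar>)" for n
  define s where "s n = expectation (?V n) / (1 - a) / n" for n
  define r where "r n = expectation (?T n) / a / n" for n
  have e_lim: "e \<longlonglongrightarrow> 0" unfolding e_def by (rule L1_rejection_limit[OF D c])
  have d_lim: "d \<longlonglongrightarrow> 0"
  proof -
    have "d \<longlonglongrightarrow> expectation (\<lambda>_. 0)" unfolding d_def
    proof (rule integral_dominated_convergence[where w = "\<lambda>_. 1 + 1 / a"])
      show "AE \<omega> in M. (\<lambda>n. \<bar>1 - nonnull n \<omega> / (n * a)\<bar>) \<longlonglongrightarrow> 0"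
        using nonnull_tendsto
      proof eventually_elim
        case (elim \<omega>)
        have "(\<lambda>n. \<bar>1 - nonnull n \<omega> / n / a\<bar>) \<longlonglongrightarrow> \<bar>1 - a / a\<bar>"
          using a by (intro tendsto_intros elim) auto
        then show ?case using a by simp
      qed
      show "AE \<omega> in M. norm \<bar>1 - nonnull n \<omega> / (n * a)\<bar> \<le> 1 + 1 / a" for n
      proof (rule AE_I2)
        fix \<omega>
        have "0 \<le> nonnull n \<omega> / n" "nonnull n \<omega> / n \<le> 1"
          using nonnull_le[of n \<omega>] nonnull_pos[of n \<omega>] by (cases "n = 0"; simp add: divide_le_eq_1)+
        from divide_nonneg_pos[OF this(1) a(1)] divide_right_mono[OF this(2) less_imp_le[OF a(1)]]
        have "0 \<le> nonnull n \<omega> / (n * a)" "nonnull n \<omega> / (n * a) \<le> 1 / a" by simp_all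
        then show "norm \<bar>1 - nonnull n \<omega> / (n * a)\<bar> \<le> 1 + 1 / a" by (simp add: abs_le_iff)
      qed
    qed auto
    then show ?thesis by simp
  qed
  \<comment> \<open>\<open>\<alpha>\<close> times the mixture density at the boundary of
    \<open>D_t\<close>. By \<open>H_ge_lev\<close>,
    \<open>k * t \<le> \<alpha> * H t < t\<close>.\<close>
  define k where "k = \<alpha> * (1 - a + a * lev t)"
  have k: "k < 1"
  proof -
    have "k * t \<le> \<alpha> * H t" unfolding k_def mult.assoc using H_ge_lev[OF t(1,2)] \<alpha> by (intro mult_left_mono) auto
    then have "k * t < 1 * t" using t(3) by simp
    then show ?thesis using t(1) by (simp only: mult_less_cancel_right)
  qed
  have main: "mt_power M \<theta> \<Delta> n \<le> r n + d n"
    "s n \<le> \<alpha> * c + (e n + 1 / n) / (1 - a)" "c \<le> (1 - a) * s n + a * r n + e n" "r n \<le> G t + lev t * (s n - t)"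
    if n: "1 \<le> n" for n
  proof -
    note Dn = D[OF n]
    note [measurable] = decision_card_measurable[OF Dn]
    have Rn: "?R n \<omega> \<le> n" "?V n \<omega> \<le> ?R n \<omega>" "?R n \<omega> - ?V n \<omega> = ?T n \<omega>" "?T n \<omega> \<le> nonnull n \<omega>" if "\<omega> \<in> space M" for \<omega>
      using card_reject_bounds(1)[OF decision_subset[OF Dn that]]
        card_reject_bounds(2-4)[OF decision_subset[OF Dn that], of \<omega>] by simp_all
    have iR: "integrable M (?R n)" using Rn by (intro bounded_integrable[where c = n]) auto
    have iV: "integrable M (?V n)" using Rn by (intro bounded_integrable[where c = n]) (auto intro: order_trans)
    have T_le: "?T n \<omega> \<le> n" if "\<omega> \<in> space M" for \<omega> using Rn(1-3)[OF that] by linarith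
    have iT: "integrable M (?T n)" using T_le by (intro bounded_integrable[where c = n]) auto
    have ie: "integrable M (\<lambda>\<omega>. \<bar>?R n \<omega> / n - c\<bar>)" using iR by auto
    have id: "integrable M (\<lambda>\<omega>. \<bar>1 - nonnull n \<omega> / (n * a)\<bar>)"
    proof -
      have "\<bar>nonnull n \<omega>\<bar> \<le> n" for \<omega>
        using nonnull_le[OF n, of \<omega>] nonnull_pos[of n \<omega>] by simp
      then have "integrable M (nonnull n)" by (intro bounded_integrable[where c = n]) auto
      then show ?thesis by auto
    qed
    have "mt_power M \<theta> \<Delta> n = expectation (\<lambda>\<omega>. ?T n \<omega> / nonnull n \<omega>)" by (rule mt_power_eq[of \<Delta>, OF Dn])
    also have "\<dots> \<le> expectation (\<lambda>\<omega>. ?T n \<omega> / (n * a) + \<bar>1 - nonnull n \<omega> / (n * a)\<bar>)"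
    proof (intro integral_mono power_integrable[OF Dn] Bochner_Integration.integrable_add id)
      show "integrable M (\<lambda>\<omega>. ?T n \<omega> / (n * a))" using iT by auto
      fix \<omega> assume w: "\<omega> \<in> space M"
      define q where "q = ?T n \<omega> / nonnull n \<omega>"
      have q: "0 \<le> q" "q \<le> 1" using Rn(4)[OF w] nonnull_pos[of n \<omega>] by (auto simp: q_def divide_le_eq_1)
      have "?T n \<omega> / (n * a) = q * (nonnull n \<omega> / (n * a))" using nonnull_pos[of n \<omega>] by (simp add: q_def)
      then have "q - ?T n \<omega> / (n * a) = q * (1 - nonnull n \<omega> / (n * a))" by (simp add: right_diff_distrib)
      also have "\<dots> \<le> \<bar>1 - nonnull n \<omega> / (n * a)\<bar>" by (rule fraction_mult_le_abs[OF q])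
      finally show "?T n \<omega> / nonnull n \<omega> \<le> ?T n \<omega> / (n * a) + \<bar>1 - nonnull n \<omega> / (n * a)\<bar>" by (simp add: q_def)
    qed
    also have "\<dots> = r n + d n"
      using iT id by (subst Bochner_Integration.integral_add) (auto simp: r_def d_def mult.commute)
    finally show "mt_power M \<theta> \<Delta> n \<le> r n + d n" .
    have q01: "0 \<le> ?V n \<omega> / max (?R n \<omega>) 1" "?V n \<omega> / max (?R n \<omega>) 1 \<le> 1" if "\<omega> \<in> space M" for \<omega>
    proof -
      have "?V n \<omega> \<le> max (?R n \<omega>) 1" using Rn(2)[OF that] by linarith
      moreover have "0 < max (?R n \<omega>) 1" by simp
      ultimately show "?V n \<omega> / max (?R n \<omega>) 1 \<le> 1" by (simp only: divide_le_eq_1_pos)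
    qed simp
    have iVR: "integrable M (\<lambda>\<omega>. ?V n \<omega> / max (?R n \<omega>) 1)"
    proof (rule bounded_integrable[where c = 1])
      fix \<omega> assume "\<omega> \<in> space M"
      from q01[OF this] show "\<bar>?V n \<omega> / max (?R n \<omega>) 1\<bar> \<le> 1" by linarith
    qed measurable
    have "expectation (?V n) / n = expectation (\<lambda>\<omega>. ?V n \<omega> / n)" by simp
    also have "\<dots> \<le> expectation (\<lambda>\<omega>. c * (?V n \<omega> / max (?R n \<omega>) 1) + (\<bar>?R n \<omega> / n - c\<bar> + 1 / n))"
    proof (intro integral_mono Bochner_Integration.integrable_add integrable_mult_right ie)
      show "integrable M (\<lambda>\<omega>. ?V n \<omega> / n)" using iV by auto
      show "integrable M (\<lambda>\<omega>. ?V n \<omega> / max (?R n \<omega>) 1)" by (rule iVR)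
      fix \<omega> assume w: "\<omega> \<in> space M"
      define q where "q = ?V n \<omega> / max (?R n \<omega>) 1"
      have q: "0 \<le> q" "q \<le> 1" using q01[OF w] by (simp_all only: q_def)
      have "?V n \<omega> / n = q * (max (?R n \<omega>) 1 / n)" by (simp add: q_def)
      then have "?V n \<omega> / n - c * q = q * (max (?R n \<omega>) 1 / n - c)" by (simp add: algebra_simps)
      also have "\<dots> \<le> \<bar>max (?R n \<omega>) 1 / n - c\<bar>"
        by (rule fraction_mult_le_abs[OF q])
      also have "\<dots> \<le> \<bar>?R n \<omega> / n - c\<bar> + \<bar>max (?R n \<omega>) 1 / n - ?R n \<omega> / n\<bar>" by linarith
      also have "\<bar>max (?R n \<omega>) 1 / n - ?R n \<omega> / n\<bar> \<le> 1 / n"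
        by (simp add: diff_divide_distrib[symmetric] abs_divide divide_right_mono)
      finally show "?V n \<omega> / n \<le> c * (?V n \<omega> / max (?R n \<omega>) 1) + (\<bar>?R n \<omega> / n - c\<bar> + 1 / n)"
        by (simp add: q_def)
    qed simp
    also have "\<dots> = c * FDR M \<theta> \<Delta> n + (e n + 1 / n)"
    proof -
      have "expectation (\<lambda>\<omega>. c * (?V n \<omega> / max (?R n \<omega>) 1) + (\<bar>?R n \<omega> / n - c\<bar> + 1 / n))
          = expectation (\<lambda>\<omega>. c * (?V n \<omega> / max (?R n \<omega>) 1)) + expectation (\<lambda>\<omega>. \<bar>?R n \<omega> / n - c\<bar> + 1 / n)"
        by (intro Bochner_Integration.integral_add integrable_mult_right iVR Bochner_Integration.integrable_add ie) simp
      also have "expectation (\<lambda>\<omega>. c * (?V n \<omega> / max (?R n \<omega>) 1)) = c * FDR M \<theta> \<Delta> n"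
        unfolding FDR_def by (rule integral_mult_right_zero)
      also have "expectation (\<lambda>\<omega>. \<bar>?R n \<omega> / n - c\<bar> + 1 / n) = e n + 1 / n"
        unfolding e_def using ie by (simp add: prob_space)
      finally show ?thesis .
    qed
    also have "\<dots> \<le> c * ((1 - a) * \<alpha>) + (e n + 1 / n)"
    proof -
      \<comment> \<open>The FDR bound gets multiplied by \<open>c\<close>, so its sign matters; a
        negative number cannot be the limit of the nonnegative rates.\<close>
      have "0 \<le> c"
      proof (rule ccontr)
        assume "\<not> 0 \<le> c"
        then have "\<forall>\<^sub>F n in sequentially. e n < - c" by (intro order_tendstoD(2)[OF e_lim]) auto
        then obtain m where m: "e m < - c" "1 \<le> m"
          using eventually_conj[OF _ eventually_ge_at_top[of 1]] by (metis (mono_tags, lifting) eventually_happens sequentially_bot)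
        have "- c = expectation (\<lambda>_. - c)" by (simp add: prob_space)
        also have "\<dots> \<le> e m" unfolding e_def
        proof (rule integral_mono)
          note [measurable] = decision_card_measurable[OF D[OF m(2)]]
          have "integrable M (?R m)"
            using card_reject_bounds(1)[OF decision_subset[OF D[OF m(2)]]] by (intro bounded_integrable[where c = m]) auto
          then show "integrable M (\<lambda>\<omega>. \<bar>?R m \<omega> / m - c\<bar>)" by auto
          fix \<omega>
          have "0 \<le> ?R m \<omega> / m" by simp
          then show "- c \<le> \<bar>?R m \<omega> / m - c\<bar>" by linarith
        qed simp
        finally show False using m by simp
      qed
      then show ?thesis using FDR[OF n] by (intro add_right_mono mult_left_mono) auto
    qed
    finally have "expectation (?V n) / n / (1 - a) \<le> (c * ((1 - a) * \<alpha>) + (e n + 1 / n)) / (1 - a)"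
      using a by (intro divide_right_mono) auto
    also have "\<dots> = \<alpha> * c + (e n + 1 / n) / (1 - a)" using a by (simp add: add_divide_distrib)
    finally show "s n \<le> \<alpha> * c + (e n + 1 / n) / (1 - a)" by (simp add: s_def mult.commute)
    have "c = expectation (\<lambda>_. c)" by (simp add: prob_space)
    also have "\<dots> \<le> expectation (\<lambda>\<omega>. (?V n \<omega> / n + ?T n \<omega> / n) + \<bar>?R n \<omega> / n - c\<bar>)"
    proof (intro integral_mono Bochner_Integration.integrable_add ie)
      show "integrable M (\<lambda>\<omega>. ?V n \<omega> / n)" "integrable M (\<lambda>\<omega>. ?T n \<omega> / n)" using iV iT by auto
      fix \<omega> assume "\<omega> \<in> space M"
      from Rn(3)[OF this] have "?V n \<omega> / n + ?T n \<omega> / n = ?R n \<omega> / n" by (simp add: add_divide_distrib[symmetric])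
      then show "c \<le> (?V n \<omega> / n + ?T n \<omega> / n) + \<bar>?R n \<omega> / n - c\<bar>" by linarith
    qed simp
    also have "\<dots> = (expectation (?V n) / n + expectation (?T n) / n) + e n"
      using iV iT ie by (simp add: e_def)
    also have "\<dots> = (1 - a) * s n + a * r n + e n" using a by (simp add: s_def r_def)
    finally show "c \<le> (1 - a) * s n + a * r n + e n" .
    have "(expectation (?T n) / a - lev t * (expectation (?V n) / (1 - a))) / n \<le> n * (G t - lev t * t) / n"
      by (intro divide_right_mono neyman_pearson[OF n Dn A t(1,2)]) auto
    then have "r n - lev t * s n \<le> G t - lev t * t" using n by (simp add: r_def s_def diff_divide_distrib)
    then show "r n \<le> G t + lev t * (s n - t)" by (simp add: algebra_simps)
  qed
  define E where "E n = (e n + 1 / n) / (1 - a) + \<alpha> * e n" for n :: nat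
  have "E \<longlonglongrightarrow> (0 + 0) / (1 - a) + \<alpha> * 0"
    unfolding E_def using a by (intro tendsto_intros e_lim lim_1_over_n) auto
  then have "\<forall>\<^sub>F n in sequentially. E n < t - \<alpha> * H t" using t by (intro order_tendstoD(2)) auto
  moreover have "\<forall>\<^sub>F n in sequentially. d n < \<eta>" using d_lim \<eta> by (rule order_tendstoD)
  ultimately show ?thesis
    using eventually_ge_at_top[of 1]
  proof eventually_elim
    case (elim n)
    note m = main[OF elim(3)]
    have "\<alpha> * c \<le> \<alpha> * ((1 - a) * s n + a * r n + e n)" using m(3) \<alpha> by (intro mult_left_mono) auto
    moreover have "\<alpha> * (a * r n) \<le> \<alpha> * (a * (G t + lev t * (s n - t)))" using m(4) \<alpha> a by (intro mult_left_mono) auto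
    ultimately have "s n \<le> \<alpha> * ((1 - a) * s n) + \<alpha> * (a * (G t + lev t * (s n - t))) + E n"
      using m(2) unfolding E_def by (simp add: distrib_left)
    also have "\<dots> = \<alpha> * H t + k * (s n - t) + E n" by (simp add: H_def k_def algebra_simps)
    finally have "(1 - k) * (s n - t) \<le> \<alpha> * H t - t + E n" by (simp add: algebra_simps)
    also have "\<dots> < 0" using elim(1) by simp
    finally have "s n - t < 0" using k by (simp add: mult_less_0_iff)
    then have "lev t * (s n - t) \<le> 0" using lev_pos(1)[OF t(1,2)] by (intro mult_nonneg_nonpos) auto
    then show ?case using m(1,4) elim(2) by linarith
  qed
qed

text \<open>The tangent bound needs \<open>\<alpha> * H t < t\<close> strictly, which fails at
  \<open>tstar \<alpha>\<close> itself; it is used at points decreasing to it, and continuity of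
  \<open>G\<close> closes the gap.\<close>

lemma power_upper_limit:
  assumes \<alpha>: "0 < \<alpha>" "\<alpha> < 1" and tp: "testing_procedure M \<xi> \<kappa> \<Delta>" and A: "condition_A M \<xi> \<theta> \<Delta>"
    and B: "condition_B F \<kappa>" and FDR: "\<And>n. 1 \<le> n \<Longrightarrow> FDR M \<theta> \<Delta> n \<le> (1 - a) * \<alpha>" and \<eta>: "0 < \<eta>"
  shows "\<forall>\<^sub>F n in sequentially. mt_power M \<theta> \<Delta> n < G (tstar \<alpha>) + \<eta>"
proof -
  note ts = tstar[OF \<alpha>]
  define u where "u n = tstar \<alpha> + (1 - tstar \<alpha>) * (1 / real (Suc n))" for n
  have "u \<longlonglongrightarrow> tstar \<alpha> + (1 - tstar \<alpha>) * 0"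
    unfolding u_def by (intro tendsto_intros LIMSEQ_inverse_real_of_nat[unfolded inverse_eq_divide])
  moreover have u: "tstar \<alpha> < u n" "u n \<le> 1" for n
  proof -
    show "tstar \<alpha> < u n" using ts(2) by (simp add: u_def)
    have "(1 - tstar \<alpha>) * (1 / real (Suc n)) \<le> (1 - tstar \<alpha>) * 1" using ts(2) by (intro mult_left_mono) auto
    then show "u n \<le> 1" by (simp add: u_def)
  qed
  moreover have "u n \<in> {0..1}" for n using u[of n] ts(1) by auto
  ultimately have "(\<lambda>n. G (u n)) \<longlonglongrightarrow> G (tstar \<alpha>)"
    using ts(1,2) by (intro continuous_on_tendsto_compose[OF G_cont]) auto
  then have "\<forall>\<^sub>F n in sequentially. G (u n) < G (tstar \<alpha>) + \<eta> / 2" using \<eta> by (intro order_tendstoD(2)) auto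
  then obtain n where n: "G (u n) < G (tstar \<alpha>) + \<eta> / 2" by (auto simp: eventually_sequentially)
  have "\<forall>\<^sub>F m in sequentially. mt_power M \<theta> \<Delta> m < G (u n) + \<eta> / 2"
    using u[of n] ts(1) ts(4)[of "u n"] \<eta> by (intro power_upper_tangent[OF \<alpha> tp A B FDR]) auto
  then show ?thesis by eventually_elim (use n in simp)
qed

section \<open>Optimality of the procedure\<close>

text \<open>Includes \<open>n = 0\<close>, where both sets are empty, so that the two procedures
  agree as functions and can be interchanged in the final statement.\<close>

lemma D_reject_fun_eq:
  assumes \<alpha>: "0 < \<alpha>" "\<alpha> < 1"
  shows "D_reject g \<alpha> n S = BH_reject \<alpha> n (\<lambda>i. pval (S i))"
  using D_reject_eq[of n \<alpha> S] \<alpha> by (cases "n = 0") (auto simp: D_reject_def BH_reject_def)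

lemma BH_reject_pval_cube:
  assumes S: "S \<in> {..<n} \<rightarrow> unit_cube"
  shows "BH_reject \<alpha> n (\<lambda>i. pval (S i)) = BH_reject \<alpha> n (\<lambda>i. hfun g (g (S i)))"
  using S by (intro BH_reject_cong) (auto simp: pval_def)

lemma BH_asymptotically_optimal:
  assumes \<alpha>: "0 < \<alpha>" "\<alpha> < 1" and tp: "testing_procedure M \<xi> \<kappa> \<Delta>" and A: "condition_A M \<xi> \<theta> \<Delta>"
    and B: "condition_B F \<kappa>" and FDR: "\<And>n. 1 \<le> n \<Longrightarrow> FDR M \<theta> \<Delta> n \<le> (1 - a) * \<alpha>"
  shows "0 \<le> liminf (\<lambda>n. ereal (mt_power M \<theta> (BH_xi \<alpha>) n - mt_power M \<theta> \<Delta> n))"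
  unfolding le_Liminf_iff
proof (intro allI impI)
  fix y :: ereal assume "y < 0"
  \<comment> \<open>The value minus infinity is covered by \<open>e = 1\<close>, a real
    \<open>y\<close> by \<open>e = - y\<close>.\<close>
  then obtain e where e: "0 < e" "y \<le> ereal (- e)" 
    by (cases y) (auto intro: that[of 1] that[of "- real_of_ereal y"])
  have "\<forall>\<^sub>F n in sequentially. G (tstar \<alpha>) - e / 2 < mt_power M \<theta> (BH_xi \<alpha>) n"
    using e by (intro power_BH_lower_limit[OF \<alpha>]) auto
  moreover have "\<forall>\<^sub>F n in sequentially. mt_power M \<theta> \<Delta> n < G (tstar \<alpha>) + e / 2"
    using e by (intro power_upper_limit[OF \<alpha> tp A B FDR]) auto
  ultimately show "\<forall>\<^sub>F n in sequentially. y < ereal (mt_power M \<theta> (BH_xi \<alpha>) n - mt_power M \<theta> \<Delta> n)"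
  proof eventually_elim
    case (elim n)
    then have "ereal (- e) < ereal (mt_power M \<theta> (BH_xi \<alpha>) n - mt_power M \<theta> \<Delta> n)" by simp
    with e(2) show ?case by (rule le_less_trans)
  qed
qed

lemma BH_supercritical:
  assumes \<alpha>: "0 < \<alpha>" "\<alpha> < 1" and less: "alpha_star a g < \<alpha>"
  shows "0 < liminf (\<lambda>n. ereal (mt_power M \<theta> (BH_xi \<alpha>) n))"
    and "pFDR M \<theta> (BH_xi \<alpha>) \<longlonglongrightarrow> (1 - a) * \<alpha>"
proof -
  have ts: "0 < tstar \<alpha>" by (rule tstar_pos[OF \<alpha> less])
  then have G: "0 < G (tstar \<alpha>)" using tstar(2)[OF \<alpha>] by (intro G_pos) auto
  have "\<forall>\<^sub>F n in sequentially. G (tstar \<alpha>) - G (tstar \<alpha>) / 2 < mt_power M \<theta> (BH_xi \<alpha>) n"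
    using G by (intro power_BH_lower_limit[OF \<alpha>]) auto
  then have "ereal (G (tstar \<alpha>) / 2) \<le> liminf (\<lambda>n. ereal (mt_power M \<theta> (BH_xi \<alpha>) n))"
    by (intro Liminf_bounded) (auto elim: eventually_mono)
  moreover have "0 < ereal (G (tstar \<alpha>) / 2)" using G by simp
  ultimately show "0 < liminf (\<lambda>n. ereal (mt_power M \<theta> (BH_xi \<alpha>) n))" by (rule less_le_trans[rotated])
  show "pFDR M \<theta> (BH_xi \<alpha>) \<longlonglongrightarrow> (1 - a) * \<alpha>"
    using pFDR_BH_limit[OF \<alpha> _ prob_reject_supercritical[OF \<alpha> ts]] by simp
qed

lemma BH_subcritical:
  assumes \<alpha>: "0 < \<alpha>" "\<alpha> < 1" and less: "\<alpha> < alpha_star a g"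
  shows "mt_power M \<theta> (BH_xi \<alpha>) \<longlonglongrightarrow> 0"
    and "pFDR M \<theta> (BH_xi \<alpha>) \<longlonglongrightarrow> (1 - a) * alpha_star a g"
proof -
  have ts: "tstar \<alpha> = 0" by (rule tstar_zero[OF \<alpha> less])
  show "mt_power M \<theta> (BH_xi \<alpha>) \<longlonglongrightarrow> 0"
  proof (rule order_tendstoI)
    fix c :: real assume "0 < c"
    \<comment> \<open>The procedure is itself admissible, so the upper bound for competitors applies
      to it, with \<open>tstar \<alpha> = 0\<close>.\<close>
    then have "\<forall>\<^sub>F n in sequentially. mt_power M \<theta> (BH_xi \<alpha>) n < G (tstar \<alpha>) + c"
      using FDR_BH[OF _ \<alpha>]
      by (intro power_upper_limit[OF \<alpha> testing_procedure_BH[OF \<alpha>] condition_A_BH[OF \<alpha>] condition_B_BH[OF \<alpha>]]) auto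
    then show "\<forall>\<^sub>F n in sequentially. mt_power M \<theta> (BH_xi \<alpha>) n < c" by (simp add: ts G_0)
  next
    fix c :: real assume c: "c < 0"
    show "\<forall>\<^sub>F n in sequentially. c < mt_power M \<theta> (BH_xi \<alpha>) n"
      using eventually_ge_at_top[of 1]
    proof eventually_elim
      case (elim n)
      show ?case using c mt_power_nonneg[of "BH_xi \<alpha>" n, OF BH_xi_measurable[OF elim \<alpha>]] by simp
    qed
  qed
  obtain L where L: "0 < L" "alpha_star a g = 1 / L" "\<And>t. 0 \<le> t \<Longrightarrow> t \<le> 1 \<Longrightarrow> H t \<le> L * t"
    "\<And>\<epsilon>. 0 < \<epsilon> \<Longrightarrow> \<exists>t0>0. t0 \<le> 1 \<and> (\<forall>t. 0 \<le> t \<longrightarrow> t \<le> t0 \<longrightarrow> (L - \<epsilon>) * t \<le> H t)"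
    using alpha_less_star[OF \<alpha>(1) less] by blast
  have "\<alpha> * L < 1" using less L by (simp add: field_simps)
  then have "(\<lambda>n. prob {\<omega> \<in> space M. BH_xi \<alpha> n \<omega> \<noteq> {}}) \<longlonglongrightarrow> \<alpha> * L"
    using L by (intro prob_reject_subcritical[OF \<alpha>])
  from pFDR_BH_limit[OF \<alpha> _ this]
  show "pFDR M \<theta> (BH_xi \<alpha>) \<longlonglongrightarrow> (1 - a) * alpha_star a g"
    using \<alpha> L by simp
qed

end

theorem proposition3p2:
  fixes M :: "'w measure"
    and \<theta> :: "nat \<Rightarrow> 'w \<Rightarrow> bool"
    and X :: "nat \<Rightarrow> 'w \<Rightarrow> real ^ 'k::{finite,linorder}"
    and q0 q1 :: "real ^ 'k::{finite,linorder} \<Rightarrow> real"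
    and a \<alpha> :: real
    and \<xi> :: "nat \<Rightarrow> 'w \<Rightarrow> real ^ 'k::{finite,linorder}"
    and g F :: "real ^ 'k::{finite,linorder} \<Rightarrow> real"
    and \<kappa>\<^sub>\<alpha> :: "nat \<Rightarrow> (nat \<Rightarrow> real ^ 'k::{finite,linorder}) \<Rightarrow> nat set pmf"
    and \<Delta>\<^sub>\<alpha> :: "nat \<Rightarrow> 'w \<Rightarrow> nat set"
  defines "\<xi> \<equiv> (\<lambda>i \<omega>. phi q0 (X i \<omega>))"
    and "g \<equiv> gdens q0 q1"
    and "F \<equiv> distr_fun M (\<xi> 0)"
    and "\<kappa>\<^sub>\<alpha> \<equiv> (\<lambda>n S. return_pmf (D_reject g \<alpha> n S))"
    and "\<Delta>\<^sub>\<alpha> \<equiv> (\<lambda>n \<omega>. D_reject g \<alpha> n (\<lambda>i. \<xi> i \<omega>))"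
  assumes "prob_space M"
    and "0 < a" "a < 1"
    and q0: "q0 \<in> borel_measurable borel" "\<And>x. 0 \<le> q0 x" "prob_space (density lborel q0)"
    and q1: "q1 \<in> borel_measurable borel" "\<And>x. 0 \<le> q1 x" "prob_space (density lborel q1)"
    and indep: "prob_space.indep_vars M (\<lambda>_. count_space UNIV \<Otimes>\<^sub>M borel)
                  (\<lambda>i \<omega>. (\<theta> i \<omega>, X i \<omega>)) UNIV"
    and theta: "\<And>i. prob_space.prob M {\<omega> \<in> space M. \<theta> i \<omega>} = a"
    and X_null: "\<And>i A. A \<in> sets borel \<Longrightarrow>
                   cond_prob M (\<lambda>\<omega>. X i \<omega> \<in> A) (\<lambda>\<omega>. \<not> \<theta> i \<omega>) = measure (density lborel q0) A"
    and X_alt: "\<And>i A. A \<in> sets borel \<Longrightarrow>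
                   cond_prob M (\<lambda>\<omega>. X i \<omega> \<in> A) (\<lambda>\<omega>. \<theta> i \<omega>) = measure (density lborel q1) A"
    and i: "sppt q1 \<subseteq> sppt q0"
    and ii: "\<And>k. continuous_on UNIV (marginal q0 {..k})"
    and iii: "continuous_on (sppt q0) q1"
    and h_cont: "continuous_on {0..} (hfun g)"
    and "0 < \<alpha>" "\<alpha> < 1"
  shows
    "(Dset g 1 = unit_cube \<and>
      (\<forall>t\<in>{0..1}. measure lborel (Dset g t) = t) \<and>
      (\<forall>s t. 0 \<le> s \<and> s < t \<and> t \<le> 1 \<longrightarrow> Dset g s \<subseteq> Dset g t) \<and>
      (\<forall>t\<in>{0..<1}. Dset g t = (\<Inter>s\<in>{t<..1}. Dset g s)))
   \<and> (testing_procedure M \<xi> \<kappa>\<^sub>\<alpha> \<Delta>\<^sub>\<alpha> \<and> condition_A M \<xi> \<theta> \<Delta>\<^sub>\<alpha> \<and> condition_B F \<kappa>\<^sub>\<alpha> \<and>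
      (\<forall>n\<ge>1. FDR M \<theta> \<Delta>\<^sub>\<alpha> n \<le> (1 - a) * \<alpha>) \<and>
      (\<forall>\<kappa> \<Delta>. testing_procedure M \<xi> \<kappa> \<Delta> \<and> condition_A M \<xi> \<theta> \<Delta> \<and> condition_B F \<kappa> \<and>
             (\<forall>n\<ge>1. FDR M \<theta> \<Delta> n \<le> (1 - a) * \<alpha>) \<longrightarrow>
         0 \<le> liminf (\<lambda>n. ereal (mt_power M \<theta> \<Delta>\<^sub>\<alpha> n - mt_power M \<theta> \<Delta> n))))
   \<and> (\<forall>n\<ge>1. \<forall>S \<in> {..<n} \<rightarrow> unit_cube.
        D_reject g \<alpha> n S = BH_reject \<alpha> n (\<lambda>i. hfun g (g (S i))))
   \<and> (alpha_star a g < \<alpha> \<longrightarrow>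
        0 < liminf (\<lambda>n. ereal (mt_power M \<theta> \<Delta>\<^sub>\<alpha> n)) \<and>
        (\<forall>n\<ge>1. FDR M \<theta> \<Delta>\<^sub>\<alpha> n = (1 - a) * \<alpha>) \<and>
        pFDR M \<theta> \<Delta>\<^sub>\<alpha> \<longlonglongrightarrow> (1 - a) * \<alpha>)
   \<and> (\<alpha> < alpha_star a g \<longrightarrow>
        mt_power M \<theta> \<Delta>\<^sub>\<alpha> \<longlonglongrightarrow> 0 \<and>
        pFDR M \<theta> \<Delta>\<^sub>\<alpha> \<longlonglongrightarrow> (1 - a) * alpha_star a g)"
proof -
  note \<alpha> = \<open>0 < \<alpha>\<close> \<open>\<alpha> < 1\<close>
  interpret prob_space M by fact
  have F_eq: "F = distr_fun M (\<xi> 0)" by (simp add: F_def)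
  interpret T: transform2 q0 q1
    by (intro transform2.intro transform.intro transform2_axioms.intro q0 q1 i ii iii)
  have [measurable]: "phi q0 \<in> borel_measurable borel" by (rule T.phi_meas)
  have pair: "(\<lambda>\<omega>. (\<theta> i \<omega>, X i \<omega>)) \<in> M \<rightarrow>\<^sub>M count_space UNIV \<Otimes>\<^sub>M borel" for i
    using indep by (auto simp: indep_vars_def)
  have [measurable]: "\<theta> i \<in> M \<rightarrow>\<^sub>M count_space UNIV" "X i \<in> borel_measurable M" for i
    using measurable_fst'[OF pair[of i]] measurable_snd'[OF pair[of i]] by simp_all
  have gm [measurable]: "g \<in> borel_measurable borel" and g0: "0 \<le> g x" for x
    unfolding g_def by (rule T.gdens_meas, rule T.gdens_nonneg)
  have vim: "phi q0 -` B \<in> sets borel" if "B \<in> sets borel" for B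
    using measurable_sets[OF T.phi_meas that] by simp
  have g_law: "measure (density lborel q1) (phi q0 -` B) = (\<integral>x. g x * indicator B x \<partial>unif_cube)"
    if [measurable]: "B \<in> sets borel" for B
  proof -
    have "(\<integral>x. g x * indicator B x \<partial>unif_cube) = enn2real (\<integral>\<^sup>+x. ennreal (g x * indicator B x) \<partial>unif_cube)"
      by (rule integral_eq_nn_integral) (auto simp: g0)
    also have "(\<integral>\<^sup>+x. ennreal (g x * indicator B x) \<partial>unif_cube)
        = (\<integral>\<^sup>+x. ennreal (g x) * indicator (B \<inter> unit_cube) x \<partial>lborel)"
      by (subst nn_integral_density) (auto intro!: nn_integral_cong simp: indicator_def)
    also have "\<dots> = emeasure (density lborel q1) (phi q0 -` B)"
      unfolding g_def by (rule T.phi_law_alt[symmetric]) fact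
    finally show ?thesis by (simp add: measure_def)
  qed
  have g_int: "(\<integral>\<^sup>+x. ennreal (g x) * indicator unit_cube x \<partial>lborel) = 1"
    using T.phi_law_alt[of UNIV] prob_space.emeasure_space_1[OF q1(3)] by (simp add: g_def)
  have not_theta: "prob {\<omega> \<in> space M. \<not> \<theta> i \<omega>} = 1 - a" for i
    using prob_neg[of "\<theta> i"] theta[of i] by simp
  \<comment> \<open>Conditional laws given \<open>\<theta>\<close> become joint ones after
    multiplication by \<open>1 - a\<close> or \<open>a\<close>; the image of the support plays the
    role of the open set of full measure.\<close>
  interpret mt_model g a M \<theta> \<xi> "phi q0 ` sppt q0"
  proof unfold_locales
    show "\<xi> i \<omega> \<in> unit_cube" for i \<omega> unfolding \<xi>_def by (rule T.phi_cube)
    show "indep_vars (\<lambda>_. count_space UNIV \<Otimes>\<^sub>M borel) (\<lambda>i \<omega>. (\<theta> i \<omega>, \<xi> i \<omega>)) UNIV"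
      using indep_vars_compose2[OF indep, of "\<lambda>_ z. (fst z, phi q0 (snd z))" "\<lambda>_. count_space UNIV \<Otimes>\<^sub>M borel"]
      by (simp add: \<xi>_def)
    show "prob {\<omega> \<in> space M. \<not> \<theta> i \<omega> \<and> \<xi> i \<omega> \<in> B} = (1 - a) * measure unif_cube B" if B: "B \<in> sets borel" for i B
    proof -
      have "prob {\<omega> \<in> space M. \<not> \<theta> i \<omega> \<and> \<xi> i \<omega> \<in> B} / (1 - a) = measure unif_cube B"
        using X_null[OF vim[OF B], of i] T.phi_law_measure[OF B]
        unfolding cond_prob_def not_theta by (simp add: \<xi>_def conj_commute)
      then show ?thesis using \<open>a < 1\<close> by (simp add: field_simps)
    qed
    show "prob {\<omega> \<in> space M. \<theta> i \<omega> \<and> \<xi> i \<omega> \<in> B} = a * (\<integral>x. g x * indicator B x \<partial>unif_cube)" if B: "B \<in> sets borel" for i B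
    proof -
      have "prob {\<omega> \<in> space M. \<theta> i \<omega> \<and> \<xi> i \<omega> \<in> B} / a = (\<integral>x. g x * indicator B x \<partial>unif_cube)"
        using X_alt[OF vim[OF B], of i] g_law[OF B]
        unfolding cond_prob_def theta by (simp add: \<xi>_def conj_commute)
      then show ?thesis using \<open>0 < a\<close> by (simp add: field_simps)
    qed
    show "open (phi q0 ` sppt q0)" by (rule T.open_E)
    show "continuous_on (phi q0 ` sppt q0) g" unfolding g_def by (rule T.gdens_cont)
    show "measure unif_cube (phi q0 ` sppt q0) = 1"
    proof -
      have E: "phi q0 ` sppt q0 \<in> sets borel" using T.open_E by simp
      have "emeasure lborel (phi q0 ` sppt q0 \<inter> unit_cube) = emeasure lborel (unit_cube :: (real, 'k) vec set)"
        using T.E_cube T.E_full E emeasure_Diff_null_set[of "unit_cube - phi q0 ` sppt q0" lborel "unit_cube"]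
        by (auto simp: null_sets_def Diff_Diff_Int Int_commute)
      then show ?thesis using E by (simp add: measure_def emeasure_unif_cube emeasure_unit_cube)
    qed
  qed fact+
  \<comment> \<open>From here on everything is BH applied to \<open>pval\<close>. The scalars
    \<open>hfun g (g (S i))\<close> return only in claim 1, where all points lie in the cube and the
    two agree.\<close>
  have \<Delta>: "\<Delta>\<^sub>\<alpha> = BH_xi \<alpha>" and \<kappa>: "\<kappa>\<^sub>\<alpha> = (\<lambda>n S. return_pmf (BH_reject \<alpha> n (\<lambda>i. pval (S i))))"
    by (simp_all add: \<Delta>\<^sub>\<alpha>_def \<kappa>\<^sub>\<alpha>_def D_reject_fun_eq[OF \<alpha>])
  show ?thesis
    unfolding \<Delta> \<kappa> F_eq
  proof (intro conjI impI allI ballI; (elim conjE)?)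
    show "Dset g 1 = unit_cube" by (rule Dset_nested(1))
    show "measure lborel (Dset g t) = t" if "t \<in> {0..1}" for t
      using that by (intro measure_Dset) auto
    show "Dset g s \<subseteq> Dset g t" if "0 \<le> s" "s < t" "t \<le> 1" for s t
      using that by (rule Dset_nested(2))
    show "Dset g t = (\<Inter>s\<in>{t<..1}. Dset g s)" if "t \<in> {0..<1}" for t
      using that by (intro Dset_nested(3)) auto
    show "testing_procedure M \<xi> (\<lambda>n S. return_pmf (BH_reject \<alpha> n (\<lambda>i. pval (S i)))) (BH_xi \<alpha>)"
      by (rule testing_procedure_BH[OF \<alpha>])
    show "condition_A M \<xi> \<theta> (BH_xi \<alpha>)" by (rule condition_A_BH[OF \<alpha>])
    show "condition_B (distr_fun M (\<xi> 0)) (\<lambda>n S. return_pmf (BH_reject \<alpha> n (\<lambda>i. pval (S i))))"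
      by (rule condition_B_BH[OF \<alpha>, unfolded F_def])
    show "FDR M \<theta> (BH_xi \<alpha>) n \<le> (1 - a) * \<alpha>" if "1 \<le> n" for n
      using FDR_BH[OF that \<alpha>] by simp
    show "FDR M \<theta> (BH_xi \<alpha>) n = (1 - a) * \<alpha>" if "1 \<le> n" for n
      by (rule FDR_BH[OF that \<alpha>])
    show "0 \<le> liminf (\<lambda>n. ereal (mt_power M \<theta> (BH_xi \<alpha>) n - mt_power M \<theta> \<Delta> n))"
      if "testing_procedure M \<xi> \<kappa> \<Delta>" "condition_A M \<xi> \<theta> \<Delta>" "condition_B (distr_fun M (\<xi> 0)) \<kappa>"
        "\<forall>n\<ge>1. FDR M \<theta> \<Delta> n \<le> (1 - a) * \<alpha>" for \<kappa> \<Delta>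
      using that(4) by (intro BH_asymptotically_optimal[OF \<alpha> that(1,2), unfolded F_def, OF that(3)]) auto
    show "D_reject g \<alpha> n S = BH_reject \<alpha> n (\<lambda>i. hfun g (g (S i)))"
      if "S \<in> {..<n} \<rightarrow> unit_cube" for n S
      using D_reject_fun_eq[OF \<alpha>, of n S] BH_reject_pval_cube[OF that, of \<alpha>] by simp
    show "0 < liminf (\<lambda>n. ereal (mt_power M \<theta> (BH_xi \<alpha>) n))" "pFDR M \<theta> (BH_xi \<alpha>) \<longlonglongrightarrow> (1 - a) * \<alpha>"
      if "alpha_star a g < \<alpha>"
      using BH_supercritical[OF \<alpha> that] by auto
    show "mt_power M \<theta> (BH_xi \<alpha>) \<longlonglongrightarrow> 0" "pFDR M \<theta> (BH_xi \<alpha>) \<longlonglongrightarrow> (1 - a) * alpha_star a g"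
      if "\<alpha> < alpha_star a g"
      using BH_subcritical[OF \<alpha> that] by auto
  qed
qed

end
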